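(* Let $n\ge2$ and $p\in\mathbb{N}$. For any $K\in\mathcal{K}(\mathbb{R}^n)$ and $\bm t=(t_0,\dots,t_p)\in\Theta_p$, one has $$\sum_{\bm j\in\mathcal{J}^n_p}q_{n,p,\bm j}(\bm t)\,W_{p,K}(\bm j)\leq\Big(\prod_{l=0}^pt_l^n\Big)|K|^p,$$ where, denoting $t_{\min}=\min\{t_0,\dots,t_p\}$, $$q_{n,p,\bm j}(\bm t)=n(t_{\min})^n\binom{np}{n-\bm j}\int_0^1(1-s)^{n-1}\prod_{l=0}^p\big(t_l-(1-s)t_{\min}\big)^{n-j_l}\,ds.$$ If $\dim(K)=n$ and $\sum_{\bm j\in\mathcal{J}^n_p}q_{n,p,\bm j}(\bm t)\,W_{p,K}(\bm j)=\Big(\prod_{l=0}^pt_l^n\Big)|K|^p$ for some $\bm t\in\mathrm{relint}(\Theta_p)$, then $K$ is a simplex.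
   Context: $\mathcal{K}(\mathbb{R}^n)$ denotes the set of convex bodies, i.e. nonempty compact convex subsets of $\mathbb{R}^n$; $|\cdot|$ is Lebesgue measure (in the dimension of the ambient space); $\dim K$ is the dimension of the affine span of $K$; a simplex is the convex hull of affinely independent points. The mixed volume of $K_1,\dots,K_N\in\mathcal{K}(\mathbb{R}^N)$ is $V(K_1,\dots,K_N)=\frac1{N!}\frac{\partial^N}{\partial s_1\cdots\partial s_N}\big|_{s_1=\dots=s_N=0}|s_1K_1+\dots+s_NK_N|$ (Minkowski sums; the volume is a homogeneous polynomial of degree $N$ in $s_1,\dots,s_N\ge0$). $L[k]$ means that $L$ is repeated $k$ times. Identify $\mathbb{R}^{pn}=(\mathbb{R}^n)^p$; $\Delta_p(x)=(x,\dots,x)$ is the diagonal embedding $\mathbb{R}^n\to\mathbb{R}^{pn}$ and $\iota_i:\mathbb{R}^n\to\mathbb{R}^{pn}$, $1\le i\le p$, the inclusion into the $i$-th factor. $\mathcal{J}_p^n=\{\bm j=(j_0,\dots,j_p)\in\mathbb{N}_0^{p+1}:j_0+\dots+j_p=n\}$; $\binom{np}{n-\bm j}=\frac{(np)!}{(n-j_0)!\cdots(n-j_p)!}$; $W_{p,K}(\bm j)=V\big(-\Delta_pK[n-j_0],\iota_1K[n-j_1],\dots,\iota_pK[n-j_p]\big)$. $\Theta_p=\{(t_0,\dots,t_p)\in\mathbb{R}^{p+1}:t_l\ge0,\ t_0+\dots+t_p=1\}$, with relative interior $\mathrm{relint}(\Theta_p)$ (all $t_l>0$). Convention $0^0=1$.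 *)

theory Defs
  imports "HOL-Analysis.Analysis"
begin

definition convex_body :: "'a::euclidean_space set \<Rightarrow> bool" where
  "convex_body K \<longleftrightarrow> K \<noteq> {} \<and> compact K \<and> convex K"

text \<open>
  The sum of sets is the Minkowski sum of \<^theory>\<open>HOL-Library.Set_Algebras\<close>.
\<close>

definition minkowski_comb :: "'a::euclidean_space set list \<Rightarrow> (nat \<Rightarrow> real) \<Rightarrow> 'a set" where
  "minkowski_comb Ks s = (\<Sum>i<length Ks. (*\<^sub>R) (s i) ` (Ks ! i))"

text \<open>
  The volume of a Minkowski combination is a polynomial in the coefficients only as long as these
  are nonnegative. The partial derivatives of this polynomial on the closed orthant, in particular
  at the origin, are therefore taken within \<open>{0..}\<close>, i.e. they are one-sided where the
  coordinate vanishes.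
\<close>

definition orthant_partial :: "nat \<Rightarrow> ((nat \<Rightarrow> real) \<Rightarrow> real) \<Rightarrow> (nat \<Rightarrow> real) \<Rightarrow> real" where
  "orthant_partial i f s = vector_derivative (\<lambda>h. f (s(i := h))) (at (s i) within {0..})"

text \<open>
  \<open>mixed_volume [K\<^sub>1, \<dots>, K\<^sub>N]\<close> is meant for lists whose length \<open>N\<close> is the dimension
  of the ambient space.
\<close>

definition mixed_volume :: "'a::euclidean_space set list \<Rightarrow> real" where
  "mixed_volume Ks =
     foldr orthant_partial [0..<length Ks]
       (\<lambda>s. measure lebesgue (minkowski_comb Ks s)) (\<lambda>_. 0) / fact (length Ks)"

text \<open>
  With \<open>n = CARD('n)\<close> and \<open>p = CARD('p)\<close>, the type \<^typ>\<open>((real, 'n) vec, 'p) vec\<close> is the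
  \<open>p\<close>-fold product of Euclidean \<open>n\<close>-space, of dimension \<open>p * n\<close>. Its factors are labelled
  \<open>1, \<dots>, p\<close> by a fixed enumeration of \<^typ>\<open>'p\<close>.
\<close>

definition factor :: "nat \<Rightarrow> 'p::finite" where
  "factor i = from_nat_into UNIV (i - 1)"

lemma bij_betw_factor: "bij_betw factor {1..CARD('p)} (UNIV :: 'p::finite set)"
proof -
  have "bij_betw (\<lambda>i. i - 1) {1..CARD('p)} {..<CARD('p)}"
    by (rule bij_betw_byWitness[where f' = Suc]) auto
  then have "bij_betw (from_nat_into (UNIV :: 'p set) \<circ> (\<lambda>i. i - 1)) {1..CARD('p)} UNIV"
    by (rule bij_betw_trans) (rule bij_betw_from_nat_into_finite, simp)
  then show ?thesis
    by (simp add: factor_def[abs_def] comp_def)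
qed

definition diag_embed :: "real ^ 'n \<Rightarrow> real ^ 'n ^ 'p" where
  "diag_embed x = (\<chi> i. x)"

definition incl :: "nat \<Rightarrow> real ^ 'n \<Rightarrow> real ^ 'n ^ 'p::finite" where
  "incl i x = axis (factor i) x"

text \<open>Tuples indexed by \<open>0, \<dots>, p\<close> are functions on \<^typ>\<open>nat\<close> of which only the values on
  \<open>{0..p}\<close> matter; multi-indices are extensional, so that each of them is counted once.\<close>

definition J_set :: "nat \<Rightarrow> nat \<Rightarrow> (nat \<Rightarrow> nat) set" where
  "J_set n p = {j \<in> {0..p} \<rightarrow>\<^sub>E UNIV. (\<Sum>l=0..p. j l) = n}"

lemma finite_J_set: "finite (J_set n p)"
proof (rule finite_subset)
  show "J_set n p \<subseteq> {0..p} \<rightarrow>\<^sub>E {..n}"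
  proof
    fix j assume "j \<in> J_set n p"
    then have j: "j \<in> {0..p} \<rightarrow>\<^sub>E UNIV" and sum: "(\<Sum>l=0..p. j l) = n"
      by (simp_all only: J_set_def mem_Collect_eq)
    have "j l \<le> n" if "l \<in> {0..p}" for l
      using member_le_sum[of l "{0..p}" j] that sum by simp
    with j show "j \<in> {0..p} \<rightarrow>\<^sub>E {..n}"
      by (simp add: PiE_iff)
  qed
  show "finite ({0..p} \<rightarrow>\<^sub>E {..n})"
    by (intro finite_PiE) simp_all
qed

definition multinomial_coeff :: "nat \<Rightarrow> nat \<Rightarrow> (nat \<Rightarrow> nat) \<Rightarrow> real" where
  "multinomial_coeff n p j = fact (n * p) / (\<Prod>l=0..p. fact (n - j l))"

definition W :: "'p::finite itself \<Rightarrow> (real ^ 'n) set \<Rightarrow> (nat \<Rightarrow> nat) \<Rightarrow> real" where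
  "W _ K j = mixed_volume
     (replicate (CARD('n) - j 0) (uminus ` diag_embed ` K :: (real ^ 'n ^ 'p) set)
      @ concat (map (\<lambda>i. replicate (CARD('n) - j i) (incl i ` K)) [1..<CARD('p) + 1]))"

definition Theta :: "nat \<Rightarrow> (nat \<Rightarrow> real) set" where
  "Theta p = {t. (\<forall>l\<in>{0..p}. t l \<ge> 0) \<and> (\<Sum>l=0..p. t l) = 1}"

definition relint_Theta :: "nat \<Rightarrow> (nat \<Rightarrow> real) set" where
  "relint_Theta p = {t \<in> Theta p. \<forall>l\<in>{0..p}. t l > 0}"

definition t_min :: "nat \<Rightarrow> (nat \<Rightarrow> real) \<Rightarrow> real" where
  "t_min p t = Min (t ` {0..p})"

definition q :: "nat \<Rightarrow> nat \<Rightarrow> (nat \<Rightarrow> nat) \<Rightarrow> (nat \<Rightarrow> real) \<Rightarrow> real" where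
  "q n p j t =
     real n * t_min p t ^ n * multinomial_coeff n p j *
     integral {0..1}
       (\<lambda>s. (1 - s) ^ (n - 1) * (\<Prod>l=0..p. (t l - (1 - s) * t_min p t) ^ (n - j l)))"

end

theory Submission
  imports Defs
begin

text \<open>
  Put \<open>t - u = (t\<^sub>0 - u, \<dots>, t\<^sub>p - u)\<close> and let \<open>P(s)\<close> be the volume of
  \<open>D(s) = - s\<^sub>0 \<Delta>\<^sub>p K + \<Sum> s\<^sub>i \<iota>\<^sub>i K\<close>. By the polynomiality of \<open>P\<close> the left-hand
  side is \<open>\<integral> n u\<^sup>n\<^sup>-\<^sup>1 P(t - u) du\<close> over \<open>0 \<le> u \<le> t\<^sub>m\<^sub>i\<^sub>n\<close>. A point \<open>x\<close> lies in \<open>D(t)\<close> iff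
  \<open>C(x) = t\<^sub>0 K \<inter> (t\<^sub>1 K - x\<^sub>1) \<inter> \<dots> \<inter> (t\<^sub>p K - x\<^sub>p)\<close> is nonempty, and if \<open>x \<in> D(t - u)\<close>,
  then \<open>C(x)\<close> contains a translate of \<open>u K\<close>, so that \<open>\<bar>C(x)\<bar> \<ge> u\<^sup>n \<bar>K\<bar>\<close>. Integrating over \<open>x\<close> and
  using \<open>\<integral> \<bar>C(x)\<bar> dx = (\<Prod> t\<^sub>l\<^sup>n) \<bar>K\<bar>\<^sup>p\<^sup>+\<^sup>1\<close> gives the inequality.

  In the case of equality almost every \<open>C(x)\<close> is null or homothetic to \<open>K\<close>; by compactness every \<open>C(x)\<close>
  whose defining bodies have a common interior point is homothetic to \<open>K\<close>. Choosing \<open>x\<close> such that only the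
  smallest body and one other body matter, all full-dimensional intersections of \<open>K\<close> with
  translates of some fixed multiple of \<open>K\<close> are homothetic to \<open>K\<close>. If a boundary point \<open>w\<close> of \<open>K\<close>
  is touched by an inner ball, small such intersections near the face of \<open>K\<close> opposite to \<open>w\<close> show that
  \<open>K\<close> is a pyramid with base in the supporting hyperplane at \<open>w\<close>. As these touching points are dense in the
  boundary, every extreme point is the apex of such a pyramid, hence the extreme points are affinely independent.
\<close>

section \<open>Limits, Lebesgue measure and general position\<close>

text \<open>Homogeneity of the volume polynomial is not enough: only monomials whose exponents are
  all at most \<open>n\<close> have a counterpart in \<open>J_set\<close>. This cap comes from each
  body lying in an \<open>n\<close>-dimensional subspace; in the triangulation it appears because an
  independent cell has at most \<open>n + 1\<close> vertices from each body.

  In the equality case the information holds only almost everywhere and says nothing about null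
  intersections, hence the detour through intersections with a common interior point. It ends with a
  factor \<open>b\<close>, a ratio of two coordinates of \<open>t\<close>, over which there is no
  control. The argument for the simplex is therefore local: near a point touched by an inner ball
  the boundary leaves the supporting hyperplane only to second order, so at scale \<epsilon> a
  translate of \<open>b K\<close> cuts from \<open>K\<close> nearly a cap whose height is of order
  \<epsilon>, whatever \<open>b\<close> is. If such caps are shrunken copies of \<open>K\<close>, no
  extreme point can lie strictly between top and bottom height.\<close>

text \<open>One function is split off. If it depends on the others, it is dropped; if not, its
  coefficients stay bounded and converge along a subsequence, which leaves a limit in the span of
  the others.\<close>

lemma pointwise_limit_in_span:
  fixes \<phi> :: "'i \<Rightarrow> 'x \<Rightarrow> real" and f :: "nat \<Rightarrow> 'x \<Rightarrow> real"
  assumes "finite I"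
    and "\<And>k. \<exists>c. \<forall>x\<in>X. f k x = (\<Sum>i\<in>I. c i * \<phi> i x)"
    and "\<And>x. x \<in> X \<Longrightarrow> (\<lambda>k. f k x) \<longlonglongrightarrow> g x"
  shows "\<exists>c. \<forall>x\<in>X. g x = (\<Sum>i\<in>I. c i * \<phi> i x)"
  using assms
proof (induction I arbitrary: f g rule: finite_induct)
  case empty
  then have "f k x = 0" if "x \<in> X" for k x using that by auto
  with empty(2) show ?case by (force dest: LIMSEQ_unique[OF tendsto_const])
next
  case (insert i I)
  obtain c where c: "\<And>k x. x \<in> X \<Longrightarrow> f k x = (\<Sum>j\<in>insert i I. c k j * \<phi> j x)"
    using insert.prems(1) by metis
  define a where "a k = c k i" for k
  have f: "f k x = a k * \<phi> i x + (\<Sum>j\<in>I. c k j * \<phi> j x)" if "x \<in> X" for k x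
    using c[OF that] insert.hyps by (simp add: a_def)
  show ?case
  proof (cases "\<exists>c. \<forall>x\<in>X. \<phi> i x = (\<Sum>j\<in>I. c j * \<phi> j x)")
    case True
    then obtain b where b: "\<And>x. x \<in> X \<Longrightarrow> \<phi> i x = (\<Sum>j\<in>I. b j * \<phi> j x)" by blast
    have "\<exists>c. \<forall>x\<in>X. g x = (\<Sum>j\<in>I. c j * \<phi> j x)"
    proof (rule insert.IH[OF _ insert.prems(2)])
      show "\<exists>c. \<forall>x\<in>X. f k x = (\<Sum>j\<in>I. c j * \<phi> j x)" for k
        by (rule exI[of _ "\<lambda>j. a k * b j + c k j"])
          (auto simp: f b sum_distrib_left sum.distrib algebra_simps)
    qed
    then obtain c' where "\<forall>x\<in>X. g x = (\<Sum>j\<in>I. c' j * \<phi> j x)" by blast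
    then have "\<forall>x\<in>X. g x = (\<Sum>j\<in>insert i I. (c'(i := 0)) j * \<phi> j x)"
      using insert.hyps by (auto intro!: sum.cong)
    then show ?thesis by blast
  next
    case False
    \<comment> \<open>Otherwise division by the coefficients would make \<open>- \<phi> i\<close> a
      pointwise limit of members of the span of the others, against the case assumption.\<close>
    have "bounded (range a)"
    proof (rule ccontr)
      assume "\<not> bounded (range a)"
      then have "\<forall>n. \<exists>k. \<bar>a k\<bar> > real n" unfolding bounded_iff by (force simp: not_le)
      then obtain r where r: "\<And>n. \<bar>a (r n)\<bar> > real n" by metis
      have "(\<lambda>n. inverse (a (r n))) \<longlonglongrightarrow> 0"
      proof (rule tendsto_0_le[OF lim_inverse_n])
        show "\<forall>\<^sub>F n in sequentially. norm (inverse (a (r n))) \<le> norm (inverse (real n)) * 1"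
          using eventually_gt_at_top[of 0]
        proof eventually_elim
          case (elim n)
          then show ?case using r[of n] by (simp add: abs_inverse le_imp_inverse_le)
        qed
      qed
      then have z: "(\<lambda>n. inverse (a (r n)) * f (r n) x - \<phi> i x) \<longlonglongrightarrow> 0 - \<phi> i x" if "x \<in> X" for x
      proof (intro tendsto_diff tendsto_const)
        \<comment> \<open>\<open>r\<close> need not be increasing, so \<open>f (r n) x\<close> is
          only known to be bounded; this suffices against the null sequence
          \<open>inverse (a (r n))\<close>.\<close>
        have "Bseq (\<lambda>k. f k x)"
          using insert.prems(2)[OF that] convergentI convergent_imp_Bseq by blast
        then obtain B where "\<And>k. norm (f k x) \<le> B" by (auto simp: Bseq_def)
        then have "Bfun (\<lambda>n. f (r n) x) sequentially" by (intro BfunI[of _ B]) auto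
        then show "(\<lambda>n. inverse (a (r n)) * f (r n) x) \<longlonglongrightarrow> 0"
          using \<open>(\<lambda>n. inverse (a (r n))) \<longlonglongrightarrow> 0\<close>
          by (simp add: tendsto_Zfun_iff bounded_bilinear.Zfun_prod_Bfun[OF bounded_bilinear_mult])
      qed
      have "\<exists>c. \<forall>x\<in>X. 0 - \<phi> i x = (\<Sum>j\<in>I. c j * \<phi> j x)"
      proof (rule insert.IH[OF _ z])
        show "\<exists>c'. \<forall>x\<in>X. inverse (a (r n)) * f (r n) x - \<phi> i x = (\<Sum>j\<in>I. c' j * \<phi> j x)" for n
        proof (intro exI[of _ "\<lambda>j. inverse (a (r n)) * c (r n) j"] ballI)
          fix x assume "x \<in> X"
          have "a (r n) \<noteq> 0" using r[of n] by auto
          then show "inverse (a (r n)) * f (r n) x - \<phi> i x = (\<Sum>j\<in>I. inverse (a (r n)) * c (r n) j * \<phi> j x)"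
            by (simp add: f[OF \<open>x \<in> X\<close>] distrib_left sum_distrib_left mult.assoc)
        qed
      qed
      then obtain c' where "\<And>x. x \<in> X \<Longrightarrow> 0 - \<phi> i x = (\<Sum>j\<in>I. c' j * \<phi> j x)" by blast
      then have "\<forall>x\<in>X. \<phi> i x = (\<Sum>j\<in>I. - c' j * \<phi> j x)"
        by (metis (no_types, lifting) diff_0 minus_mult_left minus_minus sum.cong sum_negf)
      then show False using exI[of "\<lambda>c. \<forall>x\<in>X. \<phi> i x = (\<Sum>j\<in>I. c j * \<phi> j x)" "\<lambda>j. - c' j"] False by blast
    qed
    then obtain s l where s: "strict_mono s" "(a \<circ> s) \<longlonglongrightarrow> l"
      using bounded_imp_convergent_subsequence by blast
    have "\<exists>c. \<forall>x\<in>X. g x - l * \<phi> i x = (\<Sum>j\<in>I. c j * \<phi> j x)"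
    proof (rule insert.IH)
      show "\<exists>c'. \<forall>x\<in>X. f (s k) x - a (s k) * \<phi> i x = (\<Sum>j\<in>I. c' j * \<phi> j x)" for k
        using f by (intro exI[of _ "c (s k)"]) auto
      show "(\<lambda>k. f (s k) x - a (s k) * \<phi> i x) \<longlonglongrightarrow> g x - l * \<phi> i x" if "x \<in> X" for x
        using LIMSEQ_subseq_LIMSEQ[OF insert.prems(2)[OF that] s(1)] s(2)
        by (auto intro!: tendsto_intros simp: comp_def)
    qed
    then obtain c' where c': "\<And>x. x \<in> X \<Longrightarrow> g x - l * \<phi> i x = (\<Sum>j\<in>I. c' j * \<phi> j x)" by blast
    have "\<forall>x\<in>X. g x = (\<Sum>j\<in>insert i I. (c'(i := l)) j * \<phi> j x)"
    proof
      fix x assume "x \<in> X"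
      have "(\<Sum>j\<in>I. (c'(i := l)) j * \<phi> j x) = (\<Sum>j\<in>I. c' j * \<phi> j x)"
        using insert.hyps by (intro sum.cong) auto
      then show "g x = (\<Sum>j\<in>insert i I. (c'(i := l)) j * \<phi> j x)"
        using insert.hyps c'[OF \<open>x \<in> X\<close>] by simp
    qed
    then show ?thesis by blast
  qed
qed

lemma nn_integral_lborel_shift:
  fixes f :: "'a::euclidean_space \<Rightarrow> ennreal"
  assumes [measurable]: "f \<in> borel_measurable borel"
  shows "(\<integral>\<^sup>+x. f (c + x) \<partial>lborel) = (\<integral>\<^sup>+x. f x \<partial>lborel)"
proof -
  have "(\<integral>\<^sup>+x. f x \<partial>lborel) = (\<integral>\<^sup>+x. f x \<partial>distr lborel borel ((+) c))" by (simp add: lborel_distr_plus)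
  also have "\<dots> = (\<integral>\<^sup>+x. f (c + x) \<partial>lborel)" by (rule nn_integral_distr) auto
  finally show ?thesis ..
qed

text \<open>
  The library determines the factor as a determinant, but only for \<open>real ^ 'n\<close> with a wellordered index type.
  Its existence follows from Fubini's theorem, as in the proof that Haar measure is unique.
\<close>

lemma measure_linear_bij_image:
  fixes A :: "'a::euclidean_space \<Rightarrow> 'a"
  assumes "linear A" "inj A"
  shows "\<exists>k\<ge>0. \<forall>S. compact S \<longrightarrow> measure lebesgue (A ` S) = k * measure lebesgue S"
proof -
  obtain B where B: "linear B" "\<And>x. B (A x) = x" "\<And>x. A (B x) = x"
    using linear_injective_isomorphism[OF assms] by blast
  have [measurable]: "B \<in> borel_measurable borel" "A \<in> borel_measurable borel"
    using B(1) assms(1) by (auto intro!: borel_measurable_continuous_onI linear_continuous_on linear_conv_bounded_linear[THEN iffD1])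
  have Badd: "B (x + y) = B x + B y" for x y using B(1) by (rule linear_add)
  have AS: "A ` S = B -` S" for S
  proof
    show "B -` S \<subseteq> A ` S" using B(3) by (metis image_eqI subsetI vimageE)
  qed (use B(2) in auto)
  define Q where "Q = cball (0::'a) 1"
  \<comment> \<open>The sign comes from the last substitution below, which leaves the indicator of
    \<open>Q\<close> at \<open>- B x\<close>.\<close>
  define k where "k = measure lebesgue (A ` uminus ` Q) / measure lebesgue Q"
  have cI: "compact (A ` T)" if "compact T" for T
    using that assms(1) by (intro compact_continuous_image linear_continuous_on) (simp_all add: linear_conv_bounded_linear)
  have cAQ: "compact (A ` uminus ` Q)" unfolding Q_def
    by (intro cI compact_negations compact_cball)
  then have fin: "emeasure lborel (A ` uminus ` Q) \<noteq> \<infinity>" using emeasure_compact_finite by fastforce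
  show ?thesis
  proof (intro exI[of _ k] conjI allI impI)
    show "k \<ge> 0" by (simp add: k_def)
    fix S :: "'a set" assume cS: "compact S"
    then have [measurable]: "S \<in> sets borel" by (simp add: borel_compact)
    have [measurable]: "Q \<in> sets borel" by (simp add: Q_def)
    \<comment> \<open>Shifting \<open>x\<close> by \<open>A y\<close>, then \<open>y\<close> by
      \<open>- B x\<close>, then \<open>x\<close> by \<open>A y\<close> again separates the
      variables anew, with \<open>A\<close> now applied to \<open>Q\<close> instead of
      \<open>S\<close>.\<close>
    have "emeasure lborel Q * emeasure lborel (A ` S)
        = (\<integral>\<^sup>+y. indicator Q y * (\<integral>\<^sup>+x. indicator S (B x) \<partial>lborel) \<partial>lborel)"
    proof -
      have "B -` S \<in> sets borel" using measurable_sets[of B borel borel S] by simp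
      then have "emeasure lborel (B -` S) = (\<integral>\<^sup>+x. indicator (B -` S) x \<partial>lborel)" by simp
      also have "\<dots> = (\<integral>\<^sup>+x. indicator S (B x) \<partial>lborel)" by (simp add: indicator_def)
      finally show ?thesis unfolding AS by (simp add: nn_integral_multc)
    qed
    also have "\<dots> = (\<integral>\<^sup>+y. (\<integral>\<^sup>+x. indicator Q y * indicator S (B x + y) \<partial>lborel) \<partial>lborel)"
    proof (rule nn_integral_cong)
      fix y
      have "(\<integral>\<^sup>+x. indicator S (B x) \<partial>lborel) = (\<integral>\<^sup>+x. indicator S (B (A y + x)) \<partial>lborel)"
        by (rule nn_integral_lborel_shift[symmetric]) simp
      also have "\<dots> = (\<integral>\<^sup>+x. indicator S (B x + y) \<partial>lborel)" by (simp add: Badd B add.commute)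
      finally show "indicator Q y * (\<integral>\<^sup>+x. indicator S (B x) \<partial>lborel)
          = (\<integral>\<^sup>+x. indicator Q y * indicator S (B x + y) \<partial>lborel)"
        by (simp add: nn_integral_cmult)
    qed
    also have "\<dots> = (\<integral>\<^sup>+x. (\<integral>\<^sup>+y. indicator Q y * indicator S (B x + y) \<partial>lborel) \<partial>lborel)"
      by (rule lborel_pair.Fubini') measurable
    also have "\<dots> = (\<integral>\<^sup>+x. (\<integral>\<^sup>+y. indicator Q (y - B x) * indicator S y \<partial>lborel) \<partial>lborel)"
    proof (rule nn_integral_cong)
      fix x
      show "(\<integral>\<^sup>+y. indicator Q y * indicator S (B x + y) \<partial>lborel) = (\<integral>\<^sup>+y. indicator Q (y - B x) * indicator S y \<partial>lborel)"
        using nn_integral_lborel_shift[of "\<lambda>y. indicator Q (y - B x) * indicator S y" "B x"] by simp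
    qed
    also have "\<dots> = (\<integral>\<^sup>+y. (\<integral>\<^sup>+x. indicator Q (y - B x) * indicator S y \<partial>lborel) \<partial>lborel)"
      by (rule lborel_pair.Fubini'[symmetric]) measurable
    also have "\<dots> = (\<integral>\<^sup>+y. emeasure lborel (A ` uminus ` Q) * indicator S y \<partial>lborel)"
    proof (rule nn_integral_cong)
      fix y
      have "(\<integral>\<^sup>+x. indicator Q (y - B x) \<partial>lborel) = (\<integral>\<^sup>+x. indicator Q (y - B (A y + x)) \<partial>lborel)"
        by (rule nn_integral_lborel_shift[symmetric]) simp
      also have "\<dots> = (\<integral>\<^sup>+x. indicator Q (- B x) \<partial>lborel)" by (simp add: Badd B)
      also have "\<dots> = (\<integral>\<^sup>+x. indicator (B -` uminus ` Q) x \<partial>lborel)"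
        by (intro nn_integral_cong) (auto simp: indicator_def image_iff intro: bexI[of _ "- B _"])
      also have "\<dots> = emeasure lborel (A ` uminus ` Q)" unfolding AS
      proof (rule nn_integral_indicator)
        have "B -` uminus ` Q = (\<lambda>x. - B x) -` Q" by (auto simp: image_iff) (metis minus_minus)
        moreover have "(\<lambda>x. - B x) \<in> borel_measurable borel" by measurable
        ultimately show "B -` uminus ` Q \<in> sets lborel"
          using measurable_sets[of "\<lambda>x. - B x" borel borel Q] by (simp add: Q_def)
      qed
      finally show "(\<integral>\<^sup>+x. indicator Q (y - B x) * indicator S y \<partial>lborel) = emeasure lborel (A ` uminus ` Q) * indicator S y"
        by (simp add: nn_integral_multc)
    qed
    also have "\<dots> = emeasure lborel (A ` uminus ` Q) * emeasure lborel S" by (simp add: nn_integral_cmult)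
    finally have eq: "emeasure lborel Q * emeasure lborel (A ` S) = emeasure lborel (A ` uminus ` Q) * emeasure lborel S" .
    have cA: "compact (A ` S)" using cS by (rule cI)
    have cQ: "compact Q" by (simp add: Q_def)
    have em: "measure lebesgue T = enn2real (emeasure lborel T)" if "compact T" for T :: "'a set"
      using that by (simp add: measure_def borel_compact)
    have "measure lebesgue Q * measure lebesgue (A ` S) = measure lebesgue (A ` uminus ` Q) * measure lebesgue S"
      unfolding em[OF cQ] em[OF cA] em[OF cAQ] em[OF cS] enn2real_mult[symmetric] using eq by simp
    moreover have "measure lebesgue Q > 0"
      using content_cball_pos[of 1 "0::'a"] by (simp add: Q_def)
    ultimately show "measure lebesgue (A ` S) = k * measure lebesgue S"
      unfolding k_def by (metis less_irrefl nonzero_mult_div_cancel_left times_divide_eq_left)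
  qed
qed

text \<open>
  The heights are powers of a number that is not a root of any of the finitely many polynomials given
  by the linear relations between the vectors.
\<close>

lemma generic_heights:
  fixes c :: "'e \<Rightarrow> 'b::real_inner"
  assumes "finite E"
  shows "\<exists>h :: 'e \<Rightarrow> real. (\<forall>e\<in>E. h e > 0) \<and>
    (\<forall>S\<subseteq>E. \<forall>\<phi>. (\<forall>e\<in>S. \<phi> \<bullet> c e = h e) \<longrightarrow> (\<forall>\<alpha>. (\<Sum>e\<in>S. \<alpha> e *\<^sub>R c e) = 0 \<longrightarrow> (\<forall>e\<in>S. \<alpha> e = 0)))"
proof -
  obtain enum where en: "bij_betw enum {..<card E} E"
    using ex_bij_betw_nat_finite[OF assms] by (auto simp: atLeast0LessThan)
  define idx where "idx = the_inv_into {..<card E} enum"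
  have idx: "idx e < card E" "enum (idx e) = e" if "e \<in> E" for e
    using the_inv_into_into[OF bij_betw_imp_inj_on[OF en], of e] f_the_inv_into_f_bij_betw[OF en, of e] that en
    by (auto simp: idx_def bij_betw_def)
  have idx_inj: "inj_on idx E" by (rule inj_on_inverseI[of _ enum]) (rule idx)
  \<comment> \<open>One fixed nontrivial relation \<open>al S\<close> for each dependent subfamily
    suffices, so only finitely many polynomials have to be avoided.\<close>
  define D where "D = {S. S \<subseteq> E \<and> (\<exists>\<alpha>. (\<Sum>e\<in>S. \<alpha> e *\<^sub>R c e) = 0 \<and> (\<exists>e\<in>S. \<alpha> e \<noteq> 0))}"
  have "\<forall>S\<in>D. \<exists>\<alpha>. (\<Sum>e\<in>S. \<alpha> e *\<^sub>R c e) = 0 \<and> (\<exists>e\<in>S. \<alpha> e \<noteq> 0)" by (auto simp: D_def)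
  then obtain al where al: "\<And>S. S \<in> D \<Longrightarrow> (\<Sum>e\<in>S. al S e *\<^sub>R c e) = 0" "\<And>S. S \<in> D \<Longrightarrow> \<exists>e\<in>S. al S e \<noteq> 0"
    by metis
  define co where "co S i = (if i < card E \<and> enum i \<in> S then al S (enum i) else 0)" for S i
  have val: "(\<Sum>i\<le>card E. co S i * t ^ i) = (\<Sum>e\<in>S. al S e * t ^ idx e)" if "S \<in> D" for S t
  proof -
    have SE: "S \<subseteq> E" using that by (simp add: D_def)
    have "(\<Sum>i\<le>card E. co S i * t ^ i) = (\<Sum>i\<in>idx ` S. co S i * t ^ i)"
    proof (rule sum.mono_neutral_right)
      show "idx ` S \<subseteq> {..card E}" using idx SE by fastforce
      show "\<forall>i\<in>{..card E} - idx ` S. co S i * t ^ i = 0"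
      proof
        fix i assume i: "i \<in> {..card E} - idx ` S"
        have "idx (enum i) = i" if "i < card E"
          using that en by (simp add: idx_def the_inv_into_f_f bij_betw_def)
        then show "co S i * t ^ i = 0" using i by (force simp: co_def)
      qed
    qed simp
    also have "\<dots> = (\<Sum>e\<in>S. co S (idx e) * t ^ idx e)"
      by (rule sum.reindex_cong[OF inj_on_subset[OF idx_inj SE] refl]) simp
    also have "\<dots> = (\<Sum>e\<in>S. al S e * t ^ idx e)" using idx SE by (intro sum.cong) (auto simp: co_def)
    finally show ?thesis .
  qed
  have fin: "finite {t. (\<Sum>i\<le>card E. co S i * t ^ i) = 0}" if S: "S \<in> D" for S
  proof -
    obtain e where e: "e \<in> S" "al S e \<noteq> 0" using al(2)[OF S] by blast
    then have "e \<in> E" using S by (auto simp: D_def)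
    then have "co S (idx e) \<noteq> 0" "idx e \<le> card E" using idx[of e] e by (auto simp: co_def)
    then show ?thesis by (subst polyfun_finite_roots) blast
  qed
  have "finite D" using assms by (simp add: D_def)
  then have "finite (\<Union>S\<in>D. {t. (\<Sum>i\<le>card E. co S i * t ^ i) = 0})" using fin by blast
  then have "infinite ({0<..} - (\<Union>S\<in>D. {t. (\<Sum>i\<le>card E. co S i * t ^ i) = 0}))"
    using Diff_infinite_finite infinite_Ioi by blast
  then obtain t where t: "t \<in> {0<..} - (\<Union>S\<in>D. {t. (\<Sum>i\<le>card E. co S i * t ^ i) = 0})"
    using infinite_imp_nonempty by blast
  show ?thesis
  proof (intro exI[of _ "\<lambda>e. t ^ idx e"] conjI ballI allI impI)
    show "t ^ idx e > 0" for e using t by simp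
    fix S \<phi> \<alpha> e0 assume S: "S \<subseteq> E" and \<phi>: "\<forall>e\<in>S. \<phi> \<bullet> c e = t ^ idx e" and \<alpha>: "(\<Sum>e\<in>S. \<alpha> e *\<^sub>R c e) = 0"
      and e0: "e0 \<in> S"
    show "\<alpha> e0 = 0"
    proof (rule ccontr)
      assume "\<alpha> e0 \<noteq> 0"
      then have SD: "S \<in> D" using S \<alpha> e0 by (auto simp: D_def)
      have "(\<Sum>e\<in>S. al S e * t ^ idx e) = \<phi> \<bullet> (\<Sum>e\<in>S. al S e *\<^sub>R c e)"
        by (simp add: inner_sum_right \<phi>)
      then have "(\<Sum>e\<in>S. al S e * t ^ idx e) = 0" by (simp add: al(1)[OF SD])
      then show False using t SD val[OF SD, of t] by auto
    qed
  qed
qed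

section \<open>Volumes of Minkowski combinations are polynomials\<close>

text \<open>
  The proof uses the Cayley trick. For polytopes with vertices \<open>a e\<close>, the body \<open>l\<close> having the
  vertices with \<open>cl e = l\<close>, the Minkowski combination with coefficients \<open>t\<close> is the slice at height \<open>t\<close>
  of the cone generated by the vectors \<open>(a e, axis (cl e) 1)\<close>. Generic heights \<open>h e\<close> induce a triangulation
  of this cone which does not depend on \<open>t\<close>, and the slice of a simplicial cone has monomial volume.
\<close>

definition pos_cone :: "('e \<Rightarrow> 'b::real_vector) \<Rightarrow> 'e set \<Rightarrow> 'b set" where
  "pos_cone c S = {\<Sum>e\<in>S. \<mu> e *\<^sub>R c e | \<mu>. \<forall>e\<in>S. 0 \<le> \<mu> e}"

lemma pos_cone_mono:
  assumes "S \<subseteq> T" "finite T"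
  shows "pos_cone c S \<subseteq> pos_cone c T"
proof
  fix x assume "x \<in> pos_cone c S"
  then obtain \<mu> where \<mu>: "x = (\<Sum>e\<in>S. \<mu> e *\<^sub>R c e)" "\<forall>e\<in>S. 0 \<le> \<mu> e" by (auto simp: pos_cone_def)
  have "x = (\<Sum>e\<in>T. (if e \<in> S then \<mu> e else 0) *\<^sub>R c e)"
    unfolding \<mu>(1) using assms by (intro sum.mono_neutral_cong_left) auto
  then show "x \<in> pos_cone c T" using \<mu>(2) unfolding pos_cone_def
    by (intro CollectI exI[of _ "\<lambda>e. if e \<in> S then \<mu> e else 0"]) auto
qed

lemma pos_cone_support:
  assumes "finite T" "\<And>e. e \<in> T \<Longrightarrow> 0 \<le> \<mu> e" "\<And>e. e \<in> T \<Longrightarrow> \<mu> e \<noteq> 0 \<Longrightarrow> e \<in> S" "S \<subseteq> T"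
  shows "(\<Sum>e\<in>T. \<mu> e *\<^sub>R c e) \<in> pos_cone c S"
proof -
  have "(\<Sum>e\<in>T. \<mu> e *\<^sub>R c e) = (\<Sum>e\<in>S. \<mu> e *\<^sub>R c e)"
    using assms by (intro sum.mono_neutral_right) auto
  then show ?thesis using assms by (auto simp: pos_cone_def)
qed

lemma pos_cone_eq_hull:
  assumes "finite S"
  shows "pos_cone c S = convex_cone hull (c ` S)"
proof
  show "convex_cone hull (c ` S) \<subseteq> pos_cone c S"
  proof (rule hull_minimal)
    show "c ` S \<subseteq> pos_cone c S"
    proof
      fix x assume "x \<in> c ` S"
      then obtain e where e: "e \<in> S" "x = c e" by blast
      have "(\<Sum>e'\<in>S. (if e' = e then 1 else 0) *\<^sub>R c e') = x"
        using assms e by (simp add: if_distrib[of "\<lambda>t. t *\<^sub>R c _"] cong: if_cong)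
      then show "x \<in> pos_cone c S" unfolding pos_cone_def
        by (intro CollectI exI[of _ "\<lambda>e'. if e' = e then 1 else 0"]) auto
    qed
    show "convex_cone (pos_cone c S)"
      unfolding convex_cone_iff
    proof (intro conjI ballI allI impI)
      show "0 \<in> pos_cone c S" unfolding pos_cone_def by (intro CollectI exI[of _ "\<lambda>_. 0"]) auto
      fix x assume x: "x \<in> pos_cone c S"
      then obtain \<mu> where \<mu>: "x = (\<Sum>e\<in>S. \<mu> e *\<^sub>R c e)" "\<forall>e\<in>S. 0 \<le> \<mu> e" by (auto simp: pos_cone_def)
      { fix y assume "y \<in> pos_cone c S"
        then obtain \<nu> where \<nu>: "y = (\<Sum>e\<in>S. \<nu> e *\<^sub>R c e)" "\<forall>e\<in>S. 0 \<le> \<nu> e" by (auto simp: pos_cone_def)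
        then show "x + y \<in> pos_cone c S" using \<mu> unfolding pos_cone_def
          by (intro CollectI exI[of _ "\<lambda>e. \<mu> e + \<nu> e"]) (auto simp: sum.distrib scaleR_add_left) }
      fix t :: real assume "0 \<le> t"
      then show "t *\<^sub>R x \<in> pos_cone c S" using \<mu> unfolding pos_cone_def
        by (intro CollectI exI[of _ "\<lambda>e. t * \<mu> e"]) (auto simp: scaleR_sum_right)
    qed
  qed
  show "pos_cone c S \<subseteq> convex_cone hull (c ` S)"
  proof
    fix x assume "x \<in> pos_cone c S"
    then obtain \<mu> where \<mu>: "x = (\<Sum>e\<in>S. \<mu> e *\<^sub>R c e)" "\<forall>e\<in>S. 0 \<le> \<mu> e" by (auto simp: pos_cone_def)
    have "(\<Sum>e\<in>T. \<mu> e *\<^sub>R c e) \<in> convex_cone hull (c ` S)" if "T \<subseteq> S" for T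
      using finite_subset[OF that assms] that
      by (induction T rule: finite_induct)
        (use \<mu>(2) in \<open>auto simp: convex_cone_hull_contains_0 intro: convex_cone_hull_add[OF convex_cone_hull_mul[OF hull_inc]]\<close>)
    then show "x \<in> convex_cone hull (c ` S)" using \<mu>(1) by blast
  qed
qed

lemma closed_pos_cone: "finite S \<Longrightarrow> closed (pos_cone c S)" for c :: "'e \<Rightarrow> 'b::euclidean_space"
  by (simp add: pos_cone_eq_hull closed_convex_cone_hull)

lemma convex_pos_cone: "finite S \<Longrightarrow> convex (pos_cone c S)" for c :: "'e \<Rightarrow> 'b::euclidean_space"
  by (simp add: pos_cone_eq_hull convex_convex_cone_hull)

text \<open>
  Linear programming duality; the second alternative is degenerate and will concern a null set only.
\<close>

lemma pos_cone_dual_certificate: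
  fixes c :: "'e \<Rightarrow> 'b::euclidean_space"
  assumes "finite E" "\<forall>e\<in>E. h e > 0" "x \<in> pos_cone c E"
  shows "(\<exists>\<phi>. (\<forall>e\<in>E. \<phi> \<bullet> c e \<le> h e) \<and> x \<in> pos_cone c {e \<in> E. \<phi> \<bullet> c e = h e})
       \<or> (\<exists>\<psi>. \<psi> \<noteq> 0 \<and> x \<in> pos_cone c {e \<in> E. \<psi> \<bullet> c e = 0})"
proof -
  \<comment> \<open>The upward ray \<open>(0, 1)\<close> joins the lifted generators, so that
    \<open>C\<close> is the epigraph of the least cost \<Sum> \<mu> e * h e of representing a point
    of the cone.\<close>
  let ?g = "\<lambda>oe. case oe of None \<Rightarrow> (0, 1) | Some e \<Rightarrow> (c e, h e)"
  define C where "C = pos_cone ?g (insert None (Some ` E))"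
  have fin: "finite (insert None (Some ` E))" using assms(1) by simp
  have clC: "closed C" and coC: "convex C" unfolding C_def by (rule closed_pos_cone[OF fin] convex_pos_cone[OF fin])+
  have C: "z \<in> C \<longleftrightarrow> (\<exists>\<mu> r. (\<forall>e\<in>E. 0 \<le> \<mu> e) \<and> r \<ge> 0 \<and> z = (\<Sum>e\<in>E. \<mu> e *\<^sub>R c e, (\<Sum>e\<in>E. \<mu> e * h e) + r))" for z
  proof
    assume "z \<in> C"
    then obtain \<mu> where \<mu>: "z = (\<Sum>e\<in>insert None (Some ` E). \<mu> e *\<^sub>R ?g e)" "\<forall>e\<in>insert None (Some ` E). 0 \<le> \<mu> e"
      by (auto simp: C_def pos_cone_def)
    have "z = \<mu> None *\<^sub>R (0, 1) + (\<Sum>e\<in>E. \<mu> (Some e) *\<^sub>R (c e, h e))"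
      unfolding \<mu>(1) using assms(1) by (subst sum.insert) (auto simp: sum.reindex)
    then have "z = (\<Sum>e\<in>E. \<mu> (Some e) *\<^sub>R c e, (\<Sum>e\<in>E. \<mu> (Some e) * h e) + \<mu> None)"
      by (simp add: prod_eq_iff fst_sum snd_sum)
    then show "\<exists>\<mu> r. (\<forall>e\<in>E. 0 \<le> \<mu> e) \<and> r \<ge> 0 \<and> z = (\<Sum>e\<in>E. \<mu> e *\<^sub>R c e, (\<Sum>e\<in>E. \<mu> e * h e) + r)"
      using \<mu>(2) by (intro exI[of _ "\<lambda>e. \<mu> (Some e)"] exI[of _ "\<mu> None"]) auto
  next
    assume "\<exists>\<mu> r. (\<forall>e\<in>E. 0 \<le> \<mu> e) \<and> r \<ge> 0 \<and> z = (\<Sum>e\<in>E. \<mu> e *\<^sub>R c e, (\<Sum>e\<in>E. \<mu> e * h e) + r)"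
    then obtain \<mu> r where \<mu>: "\<forall>e\<in>E. 0 \<le> \<mu> e" "r \<ge> 0" "z = (\<Sum>e\<in>E. \<mu> e *\<^sub>R c e, (\<Sum>e\<in>E. \<mu> e * h e) + r)" by blast
    let ?m = "\<lambda>oe. case oe of None \<Rightarrow> r | Some e \<Rightarrow> \<mu> e"
    have "(\<Sum>e\<in>insert None (Some ` E). ?m e *\<^sub>R ?g e) = r *\<^sub>R (0, 1) + (\<Sum>e\<in>E. \<mu> e *\<^sub>R (c e, h e))"
      using assms(1) by (subst sum.insert) (auto simp: sum.reindex)
    also have "\<dots> = z" by (simp add: \<mu>(3) prod_eq_iff fst_sum snd_sum)
    finally show "z \<in> C" using \<mu>(1,2) unfolding C_def pos_cone_def
      by (intro CollectI exI[of _ ?m]) auto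
  qed
  \<comment> \<open>The costs above \<open>x\<close>; the least one is attained because a finitely
    generated cone is closed.\<close>
  define T where "T = {t. (x, t) \<in> C}"
  obtain \<mu>0 where \<mu>0: "x = (\<Sum>e\<in>E. \<mu>0 e *\<^sub>R c e)" "\<forall>e\<in>E. 0 \<le> \<mu>0 e" using assms(3) by (auto simp: pos_cone_def)
  then have "(\<Sum>e\<in>E. \<mu>0 e * h e) + 0 \<in> T" unfolding T_def C by (intro CollectI exI[of _ \<mu>0] exI[of _ 0]) auto
  then have Tne: "T \<noteq> {}" by blast
  have T0: "t \<ge> 0" if "t \<in> T" for t
  proof -
    have "(x, t) \<in> C" using that by (simp add: T_def)
    then obtain \<mu> r where m: "\<forall>e\<in>E. 0 \<le> \<mu> e" "r \<ge> 0" "(x, t) = (\<Sum>e\<in>E. \<mu> e *\<^sub>R c e, (\<Sum>e\<in>E. \<mu> e * h e) + r)"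
      unfolding C by blast
    have "t = (\<Sum>e\<in>E. \<mu> e * h e) + r" using m(3) unfolding prod.inject by (rule conjunct2)
    moreover have "0 \<le> (\<Sum>e\<in>E. \<mu> e * h e)" using m(1) assms(2) by (intro sum_nonneg mult_nonneg_nonneg) (auto intro: less_imp_le)
    ultimately show ?thesis using m(2) by linarith
  qed
  have "closed T"
  proof -
    have "T = (\<lambda>t. (x, t)) -` C" by (auto simp: T_def)
    then show ?thesis using clC by (auto intro!: continuous_closed_vimage continuous_intros)
  qed
  moreover have bdd: "bdd_below T" using T0 by (intro bdd_belowI[of _ 0]) auto
  ultimately have t0: "Inf T \<in> T" using Tne by (intro closed_contains_Inf) auto
  define t0 where "t0 = Inf T"
  have t0C: "(x, t0) \<in> C" using t0 by (simp add: T_def t0_def)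
  have below: "t < t0 \<Longrightarrow> (x, t) \<notin> C" for t
    using cInf_lower[of t T] bdd by (force simp: T_def t0_def)
  \<comment> \<open>The open ray below \<open>(x, t0)\<close> is separated from the epigraph; the
    normal of the hyperplane yields the dual solution.\<close>
  have "\<exists>a b. a \<noteq> 0 \<and> (\<forall>z\<in>{x} \<times> {..<t0}. a \<bullet> z \<le> b) \<and> (\<forall>z\<in>C. a \<bullet> z \<ge> b)"
  proof (rule separating_hyperplane_sets)
    show "convex ({x} \<times> {..<t0})" by (intro convex_Times) (auto intro: convex_real_interval)
    have "(x, t0 - 1) \<in> {x} \<times> {..<t0}" by simp
    then show "{x} \<times> {..<t0} \<noteq> {}" by blast
  qed (use coC t0C below in auto)
  then obtain a b where ab: "a \<noteq> 0" "\<forall>z\<in>{x} \<times> {..<t0}. a \<bullet> z \<le> b" "\<forall>z\<in>C. a \<bullet> z \<ge> b"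
    by blast
  have a: "a \<noteq> 0" "\<And>t. t < t0 \<Longrightarrow> a \<bullet> (x, t) \<le> b" "\<And>z. z \<in> C \<Longrightarrow> a \<bullet> z \<ge> b"
    using ab by (blast, simp, blast)
  obtain \<psi> \<tau> where psi: "a = (\<psi>, \<tau>)" by (cases a)
  have b0: "b \<le> 0"
  proof -
    have "0 \<in> C" unfolding C_def pos_cone_eq_hull[OF fin] by (rule convex_cone_hull_contains_0)
    from a(3)[OF this] show ?thesis by simp
  qed
  have Csc: "s *\<^sub>R z \<in> C" if "z \<in> C" "s \<ge> 0" for s z
    using that unfolding C_def pos_cone_eq_hull[OF fin] by (rule convex_cone_hull_mul)
  \<comment> \<open>A functional bounded below on a cone is nonnegative there.\<close>
  have aC: "a \<bullet> z \<ge> 0" if "z \<in> C" for z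
  proof (rule ccontr)
    assume "\<not> 0 \<le> a \<bullet> z"
    then have neg: "a \<bullet> z < 0" by simp
    have "a \<bullet> (((b - 1) / (a \<bullet> z)) *\<^sub>R z) \<ge> b"
      using neg b0 that by (intro a(3) Csc) (auto simp: divide_nonpos_neg)
    then show False using neg by simp
  qed
  have \<tau>: "\<tau> \<ge> 0"
  proof -
    have "?g None \<in> C" unfolding C_def pos_cone_eq_hull[OF fin] by (intro hull_inc) blast
    from aC[OF this] show ?thesis by (simp add: psi)
  qed
  have gen: "\<psi> \<bullet> c e + \<tau> * h e \<ge> 0" if "e \<in> E" for e
  proof -
    have "?g (Some e) \<in> C" unfolding C_def pos_cone_eq_hull[OF fin] using that by (intro hull_inc) blast
    from aC[OF this] show ?thesis by (simp add: psi)
  qed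
  have "a \<bullet> (x, t0) \<le> b"
  proof (rule ccontr)
    assume "\<not> a \<bullet> (x, t0) \<le> b"
    then have "\<psi> \<bullet> x + \<tau> * t0 > b" by (simp add: psi)
    define s where "s = (\<psi> \<bullet> x + \<tau> * t0 - b) / (2 * (\<tau> + 1))"
    have s: "s > 0" using \<open>\<psi> \<bullet> x + \<tau> * t0 > b\<close> \<tau> by (simp add: s_def)
    have "\<psi> \<bullet> x + \<tau> * (t0 - s) \<le> b" using a(2)[of "t0 - s"] s by (simp add: psi)
    moreover have "\<tau> * s < \<psi> \<bullet> x + \<tau> * t0 - b"
    proof -
      have "2 * (\<tau> + 1) * s = \<psi> \<bullet> x + \<tau> * t0 - b" using \<tau> by (simp add: s_def)
      moreover have "\<tau> * s < 2 * (\<tau> + 1) * s" using s \<tau> by simp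
      ultimately show ?thesis by simp
    qed
    ultimately show False by (simp add: algebra_simps)
  qed
  then have ax0: "a \<bullet> (x, t0) = 0" using b0 aC[OF t0C] by linarith
  obtain \<mu> r where \<mu>: "\<forall>e\<in>E. 0 \<le> \<mu> e" "r \<ge> 0" "x = (\<Sum>e\<in>E. \<mu> e *\<^sub>R c e)" "t0 = (\<Sum>e\<in>E. \<mu> e * h e) + r"
    using t0C unfolding C prod.inject by (elim exE conjE) (rule that)
  \<comment> \<open>Complementary slackness: a vanishing sum of nonnegative terms, so only
    generators on the separating hyperplane carry weight.\<close>
  have "(\<Sum>e\<in>E. \<mu> e * (\<psi> \<bullet> c e + \<tau> * h e)) + \<tau> * r = 0"
    using ax0 by (simp add: psi \<mu>(3,4) inner_sum_right sum.distrib sum_distrib_left algebra_simps)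
  moreover have "(\<Sum>e\<in>E. \<mu> e * (\<psi> \<bullet> c e + \<tau> * h e)) \<ge> 0"
    using \<mu>(1) gen by (intro sum_nonneg mult_nonneg_nonneg) auto
  moreover have "\<tau> * r \<ge> 0" using \<tau> \<mu>(2) by simp
  ultimately have "(\<Sum>e\<in>E. \<mu> e * (\<psi> \<bullet> c e + \<tau> * h e)) = 0" by linarith
  then have "\<forall>e\<in>E. \<mu> e * (\<psi> \<bullet> c e + \<tau> * h e) = 0"
    using \<mu>(1) gen assms(1) by (subst (asm) sum_nonneg_eq_0_iff) auto
  then have supp: "\<psi> \<bullet> c e + \<tau> * h e = 0" if "e \<in> E" "\<mu> e \<noteq> 0" for e using that by auto
  show ?thesis
  \<comment> \<open>A vertical hyperplane gives the degenerate alternative; any other one is, after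
    division by \<tau>, the graph of the dual optimum.\<close>
  proof (cases "\<tau> = 0")
    case True
    then have "\<psi> \<noteq> 0" using a(1) psi by (auto simp: zero_prod_def)
    moreover have "x \<in> pos_cone c {e \<in> E. \<psi> \<bullet> c e = 0}"
      unfolding \<mu>(3) using \<mu>(1) supp True assms(1) by (intro pos_cone_support) auto
    ultimately show ?thesis by blast
  next
    case False
    then have \<tau>: "\<tau> > 0" using \<tau> by simp
    define \<phi> where "\<phi> = (- (1 / \<tau>)) *\<^sub>R \<psi>"
    have \<phi>: "\<phi> \<bullet> c e = h e - (\<psi> \<bullet> c e + \<tau> * h e) / \<tau>" for e
      using \<tau> by (simp add: \<phi>_def field_simps)
    have "\<forall>e\<in>E. \<phi> \<bullet> c e \<le> h e" using gen \<tau> by (simp add: \<phi>)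
    moreover have "x \<in> pos_cone c {e \<in> E. \<phi> \<bullet> c e = h e}"
      unfolding \<mu>(3) using \<mu>(1) supp assms(1) by (intro pos_cone_support) (auto simp: \<phi>)
    ultimately show ?thesis by blast
  qed
qed

section \<open>Slices of simplicial cones\<close>

definition lift_vec :: "('e \<Rightarrow> 'a) \<Rightarrow> ('e \<Rightarrow> 'l) \<Rightarrow> 'e \<Rightarrow> 'a \<times> (real ^ 'l)" where
  "lift_vec a cl e = (a e, axis (cl e) 1)"

definition slice :: "('e \<Rightarrow> 'a::euclidean_space) \<Rightarrow> ('e \<Rightarrow> 'l::finite) \<Rightarrow> 'e set \<Rightarrow> real ^ 'l \<Rightarrow> 'a set" where
  "slice a cl S t = {x. (x, t) \<in> pos_cone (lift_vec a cl) S}"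

lemma sum_lift_vec:
  assumes "finite S"
  shows "(\<Sum>e\<in>S. \<mu> e *\<^sub>R lift_vec a cl e) = (\<Sum>e\<in>S. \<mu> e *\<^sub>R a e, \<chi> l. \<Sum>e\<in>{e\<in>S. cl e = l}. \<mu> e)"
proof -
  have "(\<Sum>e\<in>S. \<mu> e * axis (cl e) 1 $ l) = (\<Sum>e\<in>{e\<in>S. cl e = l}. \<mu> e)" for l
    using assms by (auto simp: axis_def sum.If_cases if_distrib Int_def conj_commute cong: if_cong intro!: sum.cong)
  then show ?thesis
    by (simp add: lift_vec_def prod_eq_iff fst_sum snd_sum vec_eq_iff)
qed

lemma slice_iff:
  assumes "finite S"
  shows "x \<in> slice a cl S t \<longleftrightarrow>
    (\<exists>\<mu>. (\<forall>e\<in>S. 0 \<le> \<mu> e) \<and> x = (\<Sum>e\<in>S. \<mu> e *\<^sub>R a e) \<and> (\<forall>l. (\<Sum>e\<in>{e\<in>S. cl e = l}. \<mu> e) = t $ l))"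
  unfolding slice_def pos_cone_def mem_Collect_eq sum_lift_vec[OF assms] prod.inject vec_eq_iff vec_lambda_beta
  by metis

lemma compact_slice:
  assumes "finite S"
  shows "compact (slice a cl S t)"
proof -
  have "slice a cl S t = (\<lambda>x. (x, t)) -` pos_cone (lift_vec a cl) S" by (auto simp: slice_def)
  then have "closed (slice a cl S t)"
    using closed_pos_cone[OF assms] by (auto intro!: continuous_closed_vimage continuous_intros)
  moreover have "norm x \<le> (\<Sum>e\<in>S. t $ cl e * norm (a e))" if x: "x \<in> slice a cl S t" for x
  proof -
    obtain \<mu> where \<mu>: "\<forall>e\<in>S. 0 \<le> \<mu> e" "x = (\<Sum>e\<in>S. \<mu> e *\<^sub>R a e)" "\<forall>l. (\<Sum>e\<in>{e\<in>S. cl e = l}. \<mu> e) = t $ l"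
      using x unfolding slice_iff[OF assms] by blast
    have "\<mu> e \<le> t $ cl e" if "e \<in> S" for e
      unfolding \<mu>(3)[rule_format, symmetric] using that assms \<mu>(1) by (intro member_le_sum) auto
    then show ?thesis unfolding \<mu>(2) using \<mu>(1)
      by (intro order.trans[OF norm_sum] sum_mono) (auto intro!: mult_right_mono)
  qed
  then have "bounded (slice a cl S t)" by (auto simp: bounded_iff)
  ultimately show ?thesis by (simp add: compact_eq_bounded_closed)
qed

text \<open>If the first component of \<psi> is nonzero, the slice lies in a hyperplane. Otherwise
  some class has no generator at all, and its positive coefficient cannot be attained.\<close>

lemma negligible_slice_hyperplane:
  fixes a :: "'e \<Rightarrow> 'a::euclidean_space" and cl :: "'e \<Rightarrow> 'l::finite"
  assumes "finite S" "\<psi> \<noteq> 0" "\<And>e. e \<in> S \<Longrightarrow> \<psi> \<bullet> lift_vec a cl e = 0" "\<And>l. t $ l > 0"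
  shows "negligible (slice a cl S t)"
proof -
  obtain \<psi>1 \<psi>2 where \<psi>: "\<psi> = (\<psi>1, \<psi>2)" by (cases \<psi>)
  have eq: "\<psi>1 \<bullet> x + \<psi>2 \<bullet> t = 0" if x: "x \<in> slice a cl S t" for x
  proof -
    have "(x, t) \<in> pos_cone (lift_vec a cl) S" using x by (simp add: slice_def)
    then obtain \<mu> where "(x, t) = (\<Sum>e\<in>S. \<mu> e *\<^sub>R lift_vec a cl e)" by (auto simp: pos_cone_def)
    then have "\<psi> \<bullet> (x, t) = (\<Sum>e\<in>S. \<mu> e * (\<psi> \<bullet> lift_vec a cl e))" by (simp add: inner_sum_right)
    then show ?thesis using assms(3) by (simp add: \<psi>)
  qed
  show ?thesis
  proof (cases "\<psi>1 = 0")
    case False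
    then have "negligible {x. \<psi>1 \<bullet> x = - (\<psi>2 \<bullet> t)}" by (intro negligible_hyperplane) auto
    then show ?thesis by (rule negligible_subset) (use eq in force)
  next
    case True
    then obtain l where l: "\<psi>2 $ l \<noteq> 0" using assms(2) \<psi> by (auto simp: zero_prod_def vec_eq_iff)
    have "{e\<in>S. cl e = l} = {}"
      using assms(3) l True by (auto simp: \<psi> lift_vec_def inner_axis)
    have "slice a cl S t = {}"
    proof (rule equals0I)
      fix x assume "x \<in> slice a cl S t"
      then obtain \<mu> where "\<forall>l. (\<Sum>e\<in>{e\<in>S. cl e = l}. \<mu> e) = t $ l"
        unfolding slice_iff[OF assms(1)] by blast
      then have "(\<Sum>e\<in>{e\<in>S. cl e = l}. \<mu> e) = t $ l" by blast
      then show False using \<open>{e\<in>S. cl e = l} = {}\<close> assms(4)[of l] by simp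
    qed
    then show ?thesis by simp
  qed
qed

lemma independent_image_family:
  fixes c :: "'e \<Rightarrow> 'b::real_vector"
  assumes "finite S" and ind: "\<And>\<alpha>. (\<Sum>e\<in>S. \<alpha> e *\<^sub>R c e) = 0 \<Longrightarrow> \<forall>e\<in>S. \<alpha> e = 0"
  shows "inj_on c S" "independent (c ` S)"
proof -
  show inj: "inj_on c S"
  proof (rule inj_onI, rule ccontr)
    fix x y assume xy: "x \<in> S" "y \<in> S" "c x = c y" "x \<noteq> y"
    let ?\<alpha> = "\<lambda>e. (if e = x then 1 else 0) - (if e = y then 1 else (0::real))"
    have "(\<Sum>e\<in>S. ?\<alpha> e *\<^sub>R c e) = c x - c y"
      using assms(1) xy(1,2) by (simp add: scaleR_diff_left sum_subtractf if_distrib[of "\<lambda>t. t *\<^sub>R c _"] cong: if_cong)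
    then have "\<forall>e\<in>S. ?\<alpha> e = 0" using xy(3) by (intro ind) simp
    then show False using xy by auto
  qed
  show "independent (c ` S)"
  proof (rule independent_if_scalars_zero)
    fix f x assume f: "(\<Sum>x\<in>c ` S. f x *\<^sub>R x) = 0" "x \<in> c ` S"
    then have "(\<Sum>e\<in>S. f (c e) *\<^sub>R c e) = 0" by (simp add: sum.reindex[OF inj])
    from ind[OF this] show "f x = 0" using f(2) by blast
  qed (use assms(1) in simp)
qed

text \<open>The factor supplied by \<open>measure_linear_bij_image\<close> is read off from the
  image of the unit box.\<close>

lemma measure_diag_image:
  fixes d :: "'a::euclidean_space \<Rightarrow> real"
  assumes "compact S" "\<And>i. i \<in> Basis \<Longrightarrow> d i > 0"
  shows "measure lebesgue ((\<lambda>x. \<Sum>i\<in>Basis. (d i * (x \<bullet> i)) *\<^sub>R i) ` S) = (\<Prod>i\<in>Basis. d i) * measure lebesgue S"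
proof -
  let ?D = "\<lambda>x::'a. \<Sum>i\<in>Basis. (d i * (x \<bullet> i)) *\<^sub>R i"
  have lin: "linear ?D"
    by (rule linearI) (auto simp: inner_add_left scaleR_sum_right sum.distrib[symmetric] algebra_simps intro!: sum.cong)
  have Di: "?D x \<bullet> i = d i * (x \<bullet> i)" if "i \<in> Basis" for x i
    using that by (simp add: inner_sum_left inner_Basis if_distrib cong: if_cong)
  have "inj ?D"
  proof (rule injI)
    fix x y assume "?D x = ?D y"
    then have "d i * (x \<bullet> i) = d i * (y \<bullet> i)" if "i \<in> Basis" for i using Di[OF that] by metis
    then have "x \<bullet> i = y \<bullet> i" if "i \<in> Basis" for i
      using that assms(2)[OF that] by (metis less_irrefl mult_left_cancel)
    then show "x = y" by (rule euclidean_eqI)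
  qed
  then obtain k where k: "\<And>S. compact S \<Longrightarrow> measure lebesgue (?D ` S) = k * measure lebesgue S"
    using measure_linear_bij_image[OF lin] by blast
  have img: "?D ` cbox 0 One = cbox 0 (\<Sum>i\<in>Basis. d i *\<^sub>R i)"
  proof
    show "?D ` cbox 0 One \<subseteq> cbox 0 (\<Sum>i\<in>Basis. d i *\<^sub>R i)"
    proof
      fix y assume "y \<in> ?D ` cbox 0 One"
      then obtain x where x: "y = ?D x" "x \<in> cbox 0 One" by blast
      show "y \<in> cbox 0 (\<Sum>i\<in>Basis. d i *\<^sub>R i)"
        unfolding mem_box
      proof (intro ballI conjI)
        fix i :: 'a assume i: "i \<in> Basis"
        then have xi: "0 \<le> x \<bullet> i" "x \<bullet> i \<le> 1" using x(2) by (auto simp: mem_box)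
        have yi: "y \<bullet> i = d i * (x \<bullet> i)" unfolding x(1) by (rule Di[OF i])
        show "0 \<bullet> i \<le> y \<bullet> i" using xi assms(2)[OF i] by (simp add: yi)
        show "y \<bullet> i \<le> (\<Sum>i\<in>Basis. d i *\<^sub>R i) \<bullet> i"
          using xi assms(2)[OF i] i by (simp add: yi mult_left_le)
      qed
    qed
    show "cbox 0 (\<Sum>i\<in>Basis. d i *\<^sub>R i) \<subseteq> ?D ` cbox 0 One"
    proof
      fix y assume y: "y \<in> cbox 0 (\<Sum>i\<in>Basis. d i *\<^sub>R i)"
      let ?x = "\<Sum>i\<in>Basis. (y \<bullet> i / d i) *\<^sub>R i"
      have x: "?x \<in> cbox 0 One" using y assms(2) by (auto simp: mem_box)
      have "y = ?D ?x"
      proof (rule euclidean_eqI)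
        fix i :: 'a assume i: "i \<in> Basis"
        have "?x \<bullet> i = y \<bullet> i / d i" using i by simp
        then show "y \<bullet> i = ?D ?x \<bullet> i" unfolding Di[OF i] using assms(2)[OF i] by simp
      qed
      then show "y \<in> ?D ` cbox 0 One" using x by (rule image_eqI)
    qed
  qed
  have "k = measure lebesgue (?D ` cbox 0 One)" using k[of "cbox 0 One"] by simp
  also have "\<dots> = (\<Prod>i\<in>Basis. d i)"
  proof -
    have "Henstock_Kurzweil_Integration.content (cbox 0 (\<Sum>i\<in>Basis. d i *\<^sub>R i)) = (\<Prod>i\<in>Basis. d i)"
      using assms(2) by (subst content_cbox) (auto intro: less_imp_le)
    then show ?thesis unfolding img by simp
  qed
  finally show ?thesis using k[OF assms(1)] by simp
qed

lemma card_spanning_family: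
  fixes c :: "'e \<Rightarrow> 'b::euclidean_space"
  assumes "finite S" and ind: "\<And>\<alpha>. (\<Sum>e\<in>S. \<alpha> e *\<^sub>R c e) = 0 \<Longrightarrow> \<forall>e\<in>S. \<alpha> e = 0"
    and sp: "\<And>\<psi>. \<psi> \<noteq> 0 \<Longrightarrow> \<exists>e\<in>S. \<psi> \<bullet> c e \<noteq> 0"
  shows "card S = DIM('b)"
proof -
  have I: "inj_on c S" "independent (c ` S)"
    by (rule independent_image_family[OF assms(1)], erule ind)+
  have "span (c ` S) = UNIV"
  proof (rule ccontr)
    assume "span (c ` S) \<noteq> UNIV"
    then obtain \<psi> where "\<psi> \<noteq> 0" "\<forall>x\<in>span (c ` S). \<psi> \<bullet> x = 0" using span_not_UNIV_orthogonal by blast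
    then show False using sp[of \<psi>] by (auto simp: span_base)
  qed
  then have "dim (c ` S) = DIM('b)" by (metis dim_UNIV dim_span)
  then show ?thesis using I dim_eq_card_independent[of "c ` S"] by (simp add: card_image)
qed

text \<open>When the lifted vectors form a basis, the slice is an affine image of a product of
  simplices, one for each class \<open>l\<close>, of dimension \<open>d l\<close> and size
  \<open>t $ l\<close>; this accounts for the monomial.\<close>

lemma measure_slice_basis:
  fixes a :: "'e \<Rightarrow> 'a::euclidean_space" and cl :: "'e \<Rightarrow> 'l::finite"
  assumes fin: "finite S"
    and ind: "\<And>\<alpha>. (\<Sum>e\<in>S. \<alpha> e *\<^sub>R lift_vec a cl e) = 0 \<Longrightarrow> \<forall>e\<in>S. \<alpha> e = 0"
    and sp: "\<And>\<psi>. \<psi> \<noteq> 0 \<Longrightarrow> \<exists>e\<in>S. \<psi> \<bullet> lift_vec a cl e \<noteq> 0"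
  defines "d \<equiv> \<lambda>l. card {e\<in>S. cl e = l} - 1"
  shows "(\<Sum>l\<in>UNIV. d l) = DIM('a)"
    and "\<exists>k. \<forall>t. (\<forall>l. t $ l > 0) \<longrightarrow> measure lebesgue (slice a cl S t) = k * (\<Prod>l\<in>UNIV. (t $ l) ^ d l)"
proof -
  have cardS: "card S = DIM('a) + CARD('l)" using card_spanning_family[OF fin ind sp] by simp
  \<comment> \<open>Every class contains a generator; one of them, \<open>b l\<close>, becomes the
    origin of its simplex, and the others provide the coordinates.\<close>
  have "\<exists>e\<in>S. cl e = l" for l
  proof -
    have "(0, axis l 1) \<noteq> (0 :: 'a \<times> (real ^ 'l))" by (simp add: zero_prod_def)
    from sp[OF this] show ?thesis by (auto simp: lift_vec_def inner_axis_axis split: if_splits)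
  qed
  then obtain b where b: "\<And>l. b l \<in> S" "\<And>l. cl (b l) = l" by metis
  have binj: "inj b" by (rule injI) (metis b(2))
  define S' where "S' = S - range b"
  have finS': "finite S'" using fin by (simp add: S'_def)
  have cardS': "card S' = DIM('a)"
    unfolding S'_def using cardS b(1) by (subst card_Diff_subset) (auto simp: card_image[OF binj])
  obtain g where g: "bij_betw g (Basis :: 'a set) S'"
    using finite_same_card_bij[of "Basis :: 'a set" S'] cardS' finS' by auto
  have gS: "g i \<in> S" if "i \<in> Basis" for i using that g by (auto simp: S'_def bij_betw_def)
  have split_sum: "(\<Sum>e\<in>S. F e) = (\<Sum>i\<in>Basis. F (g i)) + (\<Sum>l\<in>UNIV. F (b l))" for F :: "'e \<Rightarrow> 'z::comm_monoid_add"
  proof -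
    have "(\<Sum>e\<in>S. F e) = (\<Sum>e\<in>S'. F e) + (\<Sum>e\<in>range b. F e)"
      unfolding S'_def using fin b(1) by (intro sum.subset_diff) auto
    also have "(\<Sum>e\<in>S'. F e) = (\<Sum>i\<in>Basis. F (g i))" using sum.reindex_bij_betw[OF g, of F] by simp
    also have "(\<Sum>e\<in>range b. F e) = (\<Sum>l\<in>UNIV. F (b l))" by (simp add: sum.reindex[OF binj])
    finally show ?thesis .
  qed
  have cl_card: "card {i\<in>Basis. cl (g i) = l} = d l" for l
  proof -
    have "card {e\<in>S. cl e = l} = (\<Sum>e\<in>S. if cl e = l then 1 else 0)" using fin by (simp add: sum.If_cases Int_def)
    also have "\<dots> = (\<Sum>i\<in>Basis. if cl (g i) = l then 1 else 0) + (\<Sum>l'\<in>UNIV. if l' = l then 1 else 0)"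
      unfolding split_sum by (simp add: b)
    also have "\<dots> = card {i\<in>Basis. cl (g i) = l} + 1" by (simp add: sum.If_cases Int_def)
    finally show ?thesis by (simp add: d_def)
  qed
  have "DIM('a) = (\<Sum>l\<in>UNIV. card {i\<in>Basis. cl (g i) = l})"
    using sum.group[of "Basis :: 'a set" "UNIV :: 'l set" "\<lambda>i. cl (g i)" "\<lambda>_. 1::nat"] by simp
  then show "(\<Sum>l\<in>UNIV. d l) = DIM('a)" by (simp add: cl_card)

  define A where "A \<xi> = (\<Sum>i\<in>Basis. (\<xi> \<bullet> i) *\<^sub>R (a (g i) - a (b (cl (g i)))))" for \<xi> :: 'a
  have linA: "linear A"
    by (rule linearI) (simp_all add: A_def inner_add_left scaleR_add_left sum.distrib scaleR_sum_right)
  have "inj A"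
  proof (rule linear_injective_0[OF linA, THEN iffD2], intro allI impI)
    fix \<xi> assume A0: "A \<xi> = 0"
    \<comment> \<open>A kernel vector of \<open>A\<close> becomes a linear relation between the
      lifted vectors once the origins \<open>b l\<close> absorb the class sums.\<close>
    define \<alpha> where "\<alpha> e = (if e \<in> range b then - (\<Sum>i\<in>{i\<in>Basis. cl (g i) = cl e}. \<xi> \<bullet> i) else \<xi> \<bullet> the_inv_into Basis g e)" for e
    have \<alpha>g: "\<alpha> (g i) = \<xi> \<bullet> i" if "i \<in> Basis" for i
      using that g by (auto simp: \<alpha>_def bij_betw_def S'_def the_inv_into_f_f)
    have \<alpha>b: "\<alpha> (b l) = - (\<Sum>i\<in>{i\<in>Basis. cl (g i) = l}. \<xi> \<bullet> i)" for l by (simp add: \<alpha>_def b)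
    have "(\<Sum>e\<in>S. \<alpha> e *\<^sub>R lift_vec a cl e) = (\<Sum>i\<in>Basis. (\<xi> \<bullet> i) *\<^sub>R lift_vec a cl (g i))
        - (\<Sum>l\<in>UNIV. \<Sum>i\<in>{i\<in>Basis. cl (g i) = l}. (\<xi> \<bullet> i) *\<^sub>R lift_vec a cl (b l))"
      unfolding split_sum by (simp add: \<alpha>g \<alpha>b scaleR_sum_left sum_negf)
    also have "(\<Sum>l\<in>UNIV. \<Sum>i\<in>{i\<in>Basis. cl (g i) = l}. (\<xi> \<bullet> i) *\<^sub>R lift_vec a cl (b l))
        = (\<Sum>l\<in>UNIV. \<Sum>i\<in>{i\<in>Basis. cl (g i) = l}. (\<xi> \<bullet> i) *\<^sub>R lift_vec a cl (b (cl (g i))))"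
      by (intro sum.cong) auto
    also have "\<dots> = (\<Sum>i\<in>Basis. (\<xi> \<bullet> i) *\<^sub>R lift_vec a cl (b (cl (g i))))"
      by (rule sum.group) auto
    also have "(\<Sum>i\<in>Basis. (\<xi> \<bullet> i) *\<^sub>R lift_vec a cl (g i)) - (\<Sum>i\<in>Basis. (\<xi> \<bullet> i) *\<^sub>R lift_vec a cl (b (cl (g i)))) = (A \<xi>, 0)"
      unfolding sum_subtractf[symmetric]
      by (simp add: lift_vec_def A_def b(2) prod_eq_iff fst_sum snd_sum scaleR_diff_right)
    finally have "\<forall>e\<in>S. \<alpha> e = 0" using A0 by (intro ind) (simp add: zero_prod_def)
    then have "\<xi> \<bullet> i = 0" if "i \<in> Basis" for i using \<alpha>g[OF that] gS[OF that] by metis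
    then show "\<xi> = 0" by (intro euclidean_eqI[of \<xi> 0]) simp
  qed
  then obtain k where k: "\<And>T. compact T \<Longrightarrow> measure lebesgue (A ` T) = k * measure lebesgue T"
    using measure_linear_bij_image[OF linA] by blast

  \<comment> \<open>The product of corner simplices; the inequality for class \<open>l\<close>
    leaves a nonnegative weight for \<open>b l\<close>.\<close>
  define Z where "Z t = {\<xi>::'a. (\<forall>i\<in>Basis. 0 \<le> \<xi> \<bullet> i) \<and> (\<forall>l. (\<Sum>i\<in>{i\<in>Basis. cl (g i) = l}. \<xi> \<bullet> i) \<le> t $ l)}" for t :: "real ^ 'l"
  have cZ: "compact (Z t)" for t
  proof -
    have "Z t = (\<Inter>i\<in>Basis. {\<xi>. 0 \<le> \<xi> \<bullet> i}) \<inter> (\<Inter>l. {\<xi>. (\<Sum>i\<in>{i\<in>Basis. cl (g i) = l}. \<xi> \<bullet> i) \<le> t $ l})"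
      by (auto simp: Z_def)
    then have "closed (Z t)"
      by (auto intro!: closed_Int closed_INT closed_Collect_le continuous_intros)
    moreover have "Z t \<subseteq> cbox 0 (\<Sum>i\<in>Basis. (t $ cl (g i)) *\<^sub>R i)"
    proof
      fix \<xi> assume \<xi>: "\<xi> \<in> Z t"
      have "\<xi> \<bullet> i \<le> t $ cl (g i)" if "i \<in> Basis" for i
      proof -
        have "\<xi> \<bullet> i \<le> (\<Sum>j\<in>{j\<in>Basis. cl (g j) = cl (g i)}. \<xi> \<bullet> j)"
          using that \<xi> by (intro member_le_sum) (auto simp: Z_def)
        also have "\<dots> \<le> t $ cl (g i)" using \<xi> by (simp add: Z_def)
        finally show ?thesis .
      qed
      then show "\<xi> \<in> cbox 0 (\<Sum>i\<in>Basis. (t $ cl (g i)) *\<^sub>R i)" using \<xi> by (auto simp: mem_box Z_def)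
    qed
    ultimately show ?thesis by (metis bounded_cbox bounded_subset compact_eq_bounded_closed)
  qed
  have slice_eq: "slice a cl S t = (+) (\<Sum>l\<in>UNIV. (t $ l) *\<^sub>R a (b l)) ` A ` Z t" for t
  proof -
    have lin: "(\<Sum>i\<in>Basis. x i *\<^sub>R a (g i)) + (\<Sum>l\<in>UNIV. (t $ l - (\<Sum>i\<in>{i\<in>Basis. cl (g i) = l}. x i)) *\<^sub>R a (b l))
        = (\<Sum>l\<in>UNIV. (t $ l) *\<^sub>R a (b l)) + (\<Sum>i\<in>Basis. x i *\<^sub>R (a (g i) - a (b (cl (g i)))))" for x :: "'a \<Rightarrow> real"
    proof -
      have "(\<Sum>l\<in>UNIV. (\<Sum>i\<in>{i\<in>Basis. cl (g i) = l}. x i) *\<^sub>R a (b l))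
          = (\<Sum>l\<in>UNIV. \<Sum>i\<in>{i\<in>Basis. cl (g i) = l}. x i *\<^sub>R a (b (cl (g i))))"
        by (auto simp: scaleR_sum_left intro!: sum.cong)
      also have "\<dots> = (\<Sum>i\<in>Basis. x i *\<^sub>R a (b (cl (g i))))" by (rule sum.group) auto
      finally show ?thesis by (simp add: scaleR_diff_left scaleR_diff_right sum_subtractf)
    qed
    have clsum: "(\<Sum>e\<in>{e\<in>S. cl e = l}. \<mu> e) = (\<Sum>i\<in>{i\<in>Basis. cl (g i) = l}. \<mu> (g i)) + \<mu> (b l)" for \<mu> :: "'e \<Rightarrow> real" and l
    proof -
      have "(\<Sum>e\<in>{e\<in>S. cl e = l}. \<mu> e) = (\<Sum>e\<in>S. if cl e = l then \<mu> e else 0)" using fin by (simp add: sum.inter_filter)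
      also have "\<dots> = (\<Sum>i\<in>Basis. if cl (g i) = l then \<mu> (g i) else 0) + (\<Sum>l'\<in>UNIV. if l' = l then \<mu> (b l') else 0)"
        unfolding split_sum by (simp add: b)
      also have "\<dots> = (\<Sum>i\<in>{i\<in>Basis. cl (g i) = l}. \<mu> (g i)) + \<mu> (b l)" by (simp add: sum.inter_filter)
      finally show ?thesis .
    qed
    show ?thesis
    proof
      show "slice a cl S t \<subseteq> (+) (\<Sum>l\<in>UNIV. (t $ l) *\<^sub>R a (b l)) ` A ` Z t"
      proof
        fix x assume "x \<in> slice a cl S t"
        then obtain \<mu> where \<mu>: "\<forall>e\<in>S. 0 \<le> \<mu> e" "x = (\<Sum>e\<in>S. \<mu> e *\<^sub>R a e)" "\<forall>l. (\<Sum>e\<in>{e\<in>S. cl e = l}. \<mu> e) = t $ l"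
          unfolding slice_iff[OF fin] by blast
        have \<mu>b: "\<mu> (b l) = t $ l - (\<Sum>i\<in>{i\<in>Basis. cl (g i) = l}. \<mu> (g i))" for l
          using \<mu>(3) clsum[of \<mu> l] by (metis add_diff_cancel_left')
        let ?\<xi> = "\<Sum>i\<in>Basis. \<mu> (g i) *\<^sub>R i"
        have "x = (\<Sum>l\<in>UNIV. (t $ l) *\<^sub>R a (b l)) + A ?\<xi>"
          unfolding \<mu>(2) split_sum \<mu>b lin by (simp add: A_def)
        moreover have "?\<xi> \<in> Z t"
          unfolding Z_def
        proof (intro CollectI conjI ballI allI)
          show "0 \<le> ?\<xi> \<bullet> i" if "i \<in> Basis" for i using that \<mu>(1) gS by simp
          fix l
          have "(\<Sum>i\<in>{i\<in>Basis. cl (g i) = l}. ?\<xi> \<bullet> i) = (\<Sum>i\<in>{i\<in>Basis. cl (g i) = l}. \<mu> (g i))"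
            by (rule sum.cong) auto
          also have "\<dots> \<le> t $ l" using \<mu>(1) b(1)[of l] \<mu>b[of l] by auto
          finally show "(\<Sum>i\<in>{i\<in>Basis. cl (g i) = l}. ?\<xi> \<bullet> i) \<le> t $ l" .
        qed
        ultimately show "x \<in> (+) (\<Sum>l\<in>UNIV. (t $ l) *\<^sub>R a (b l)) ` A ` Z t" by blast
      qed
      show "(+) (\<Sum>l\<in>UNIV. (t $ l) *\<^sub>R a (b l)) ` A ` Z t \<subseteq> slice a cl S t"
      proof
        fix x assume "x \<in> (+) (\<Sum>l\<in>UNIV. (t $ l) *\<^sub>R a (b l)) ` A ` Z t"
        then obtain \<xi> where \<xi>: "\<xi> \<in> Z t" "x = (\<Sum>l\<in>UNIV. (t $ l) *\<^sub>R a (b l)) + A \<xi>" by blast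
        define \<mu> where "\<mu> e = (if e \<in> range b then t $ cl e - (\<Sum>i\<in>{i\<in>Basis. cl (g i) = cl e}. \<xi> \<bullet> i) else \<xi> \<bullet> the_inv_into Basis g e)" for e
        have \<mu>g: "\<mu> (g i) = \<xi> \<bullet> i" if "i \<in> Basis" for i
          using that g by (auto simp: \<mu>_def bij_betw_def S'_def the_inv_into_f_f)
        have \<mu>b: "\<mu> (b l) = t $ l - (\<Sum>i\<in>{i\<in>Basis. cl (g i) = l}. \<xi> \<bullet> i)" for l by (simp add: \<mu>_def b)
        have "\<mu> e \<ge> 0" if "e \<in> S" for e
        proof (cases "e \<in> range b")
          case True then show ?thesis using \<mu>b \<xi>(1) by (auto simp: Z_def)
        next
          case False
          then have "e \<in> S'" using that by (simp add: S'_def)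
          then obtain i where "i \<in> Basis" "e = g i" using g by (auto simp: bij_betw_def)
          then show ?thesis using \<mu>g \<xi>(1) by (auto simp: Z_def)
        qed
        moreover have "x = (\<Sum>e\<in>S. \<mu> e *\<^sub>R a e)"
          unfolding split_sum \<xi>(2) A_def lin[symmetric] by (simp add: \<mu>g \<mu>b)
        moreover have "(\<Sum>e\<in>{e\<in>S. cl e = l}. \<mu> e) = t $ l" for l
          unfolding clsum \<mu>b by (simp add: \<mu>g)
        ultimately show "x \<in> slice a cl S t" unfolding slice_iff[OF fin] by blast
      qed
    qed
  qed
  have measZ: "measure lebesgue (Z t) = (\<Prod>l\<in>UNIV. (t $ l) ^ d l) * measure lebesgue (Z (\<chi> l. 1))" if t: "\<And>l. t $ l > 0" for t
  proof -
    let ?D = "\<lambda>x::'a. \<Sum>i\<in>Basis. (t $ cl (g i) * (x \<bullet> i)) *\<^sub>R i"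
    have Di: "?D x \<bullet> i = t $ cl (g i) * (x \<bullet> i)" if "i \<in> Basis" for x i
      using that by (simp add: inner_sum_left inner_Basis if_distrib cong: if_cong)
    have sumD: "(\<Sum>i\<in>{i\<in>Basis. cl (g i) = l}. ?D x \<bullet> i) = t $ l * (\<Sum>i\<in>{i\<in>Basis. cl (g i) = l}. x \<bullet> i)" for x l
      unfolding sum_distrib_left by (rule sum.cong) (auto simp: Di)
    have tl: "t $ l * s \<le> t $ l \<longleftrightarrow> s \<le> 1" for l s
      using mult_le_cancel_left_pos[OF t[of l], of s 1] by simp
    have Dset: "?D x \<in> Z t \<longleftrightarrow> x \<in> Z (\<chi> l. 1)" for x
    proof -
      have eq: "(\<forall>i\<in>Basis. 0 \<le> ?D x \<bullet> i) \<longleftrightarrow> (\<forall>i\<in>Basis. 0 \<le> x \<bullet> i)"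
        using t by (intro ball_cong refl) (simp only: Di zero_le_mult_iff, smt (verit))
      show ?thesis unfolding Z_def mem_Collect_eq sumD eq tl vec_lambda_beta ..
    qed
    have surj: "\<exists>x. y = ?D x" for y
    proof -
      let ?x = "\<Sum>i\<in>Basis. (y \<bullet> i / t $ cl (g i)) *\<^sub>R i"
      have "y = ?D ?x"
      proof (rule euclidean_eqI)
        fix i :: 'a assume i: "i \<in> Basis"
        have xi: "?x \<bullet> i = y \<bullet> i / t $ cl (g i)" using i by simp
        have "y \<bullet> i = t $ cl (g i) * (y \<bullet> i / t $ cl (g i))" using t[of "cl (g i)"] by simp
        then show "y \<bullet> i = ?D ?x \<bullet> i" unfolding Di[OF i] xi .
      qed
      then show ?thesis by (rule exI)
    qed
    have "Z t = ?D ` Z (\<chi> l. 1)"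
    proof
      show "Z t \<subseteq> ?D ` Z (\<chi> l. 1)"
      proof
        fix y assume "y \<in> Z t"
        moreover obtain x where "y = ?D x" using surj by blast
        ultimately show "y \<in> ?D ` Z (\<chi> l. 1)" using Dset by blast
      qed
      show "?D ` Z (\<chi> l. 1) \<subseteq> Z t" using Dset by blast
    qed
    then have "measure lebesgue (Z t) = (\<Prod>i\<in>(Basis::'a set). t $ cl (g i)) * measure lebesgue (Z (\<chi> l. 1))"
      using measure_diag_image[OF cZ, of "\<lambda>i. t $ cl (g i)"] t by simp
    also have "(\<Prod>i\<in>(Basis::'a set). t $ cl (g i)) = (\<Prod>l\<in>UNIV. \<Prod>i\<in>{i\<in>Basis. cl (g i) = l}. t $ cl (g i))"
      by (rule prod.group[symmetric]) auto
    also have "\<dots> = (\<Prod>l\<in>UNIV. (t $ l) ^ d l)" by (simp add: cl_card)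
    finally show ?thesis .
  qed
  show "\<exists>k. \<forall>t. (\<forall>l. t $ l > 0) \<longrightarrow> measure lebesgue (slice a cl S t) = k * (\<Prod>l\<in>UNIV. (t $ l) ^ d l)"
  proof (intro exI[of _ "k * measure lebesgue (Z (\<chi> l. 1))"] allI impI)
    fix t :: "real ^ 'l" assume "\<forall>l. t $ l > 0"
    then have "measure lebesgue (Z t) = (\<Prod>l\<in>UNIV. (t $ l) ^ d l) * measure lebesgue (Z (\<chi> l. 1))"
      using measZ by blast
    then show "measure lebesgue (slice a cl S t) = k * measure lebesgue (Z (\<chi> l. 1)) * (\<Prod>l\<in>UNIV. (t $ l) ^ d l)"
      unfolding slice_eq measure_translation k[OF cZ] by (simp only: ac_simps)
  qed
qed

text \<open>The lifted vectors of class \<open>l\<close> lie in the product of \<open>U\<close> with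
  the line of one axis vector, of dimension \<open>dim U + 1\<close>. This bounds the exponent of
  \<open>t $ l\<close>.\<close>

lemma independent_class_card:
  fixes a :: "'e \<Rightarrow> 'a::euclidean_space" and cl :: "'e \<Rightarrow> 'l::finite"
  assumes fin: "finite S"
    and ind: "\<And>\<alpha>. (\<Sum>e\<in>S. \<alpha> e *\<^sub>R lift_vec a cl e) = 0 \<Longrightarrow> \<forall>e\<in>S. \<alpha> e = 0"
    and U: "subspace U" "\<And>e. e \<in> S \<Longrightarrow> cl e = l \<Longrightarrow> a e \<in> U"
  shows "card {e\<in>S. cl e = l} - 1 \<le> dim U"
proof -
  let ?T = "{e\<in>S. cl e = l}"
  let ?ax = "axis l 1 :: real ^ 'l"
  have I: "inj_on (lift_vec a cl) S" "independent (lift_vec a cl ` S)"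
    by (rule independent_image_family[OF fin], erule ind)+
  have "independent (lift_vec a cl ` ?T)" using I(2) by (rule independent_mono) (intro image_mono, blast)
  then have "card (lift_vec a cl ` ?T) \<le> dim (U \<times> span {?ax})"
    by (rule independent_card_le_dim[rotated]) (auto simp: lift_vec_def U(2) span_base)
  also have "\<dots> = dim U + dim (span {?ax})" by (rule dim_Times) (simp_all add: U(1))
  also have "dim (span {?ax}) = 1" by (simp add: dim_span)
  finally have "card (lift_vec a cl ` ?T) \<le> dim U + 1" .
  moreover have "card (lift_vec a cl ` ?T) = card ?T"
    by (rule card_image) (rule inj_on_subset[OF I(1)], blast)
  ultimately show ?thesis by simp
qed

lemma slice_mono: "S \<subseteq> T \<Longrightarrow> finite T \<Longrightarrow> slice a cl S t \<subseteq> slice a cl T t"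
  unfolding slice_def using pos_cone_mono[of S T "lift_vec a cl"] by blast

section \<open>Triangulation of a slice\<close>

text \<open>The first representation gives \<phi>' \<bullet> x \<le> \<phi> \<bullet> x, while each
  term of the second contributes nonnegatively to \<phi>' \<bullet> x - \<phi> \<bullet> x; so only
  generators tight for both carry weight. Cells of the triangulation thus overlap only in common
  faces.\<close>

lemma pos_cone_eq_of_tight:
  fixes c :: "'e \<Rightarrow> 'b::euclidean_space"
  assumes "finite E" "\<forall>e\<in>E. \<phi> \<bullet> c e \<le> h e" "\<forall>e\<in>E. \<phi>' \<bullet> c e \<le> h e"
    and x: "x \<in> pos_cone c {e\<in>E. \<phi> \<bullet> c e = h e}" "x \<in> pos_cone c {e\<in>E. \<phi>' \<bullet> c e = h e}"
  shows "x \<in> pos_cone c ({e\<in>E. \<phi> \<bullet> c e = h e} \<inter> {e\<in>E. \<phi>' \<bullet> c e = h e})"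
proof -
  let ?S = "{e\<in>E. \<phi> \<bullet> c e = h e}" and ?S' = "{e\<in>E. \<phi>' \<bullet> c e = h e}"
  obtain \<mu> where \<mu>: "x = (\<Sum>e\<in>?S. \<mu> e *\<^sub>R c e)" "\<forall>e\<in>?S. 0 \<le> \<mu> e" using x(1) by (auto simp: pos_cone_def)
  obtain \<nu> where \<nu>: "x = (\<Sum>e\<in>?S'. \<nu> e *\<^sub>R c e)" "\<forall>e\<in>?S'. 0 \<le> \<nu> e" using x(2) by (auto simp: pos_cone_def)
  have 1: "\<phi>' \<bullet> x \<le> \<phi> \<bullet> x"
  proof -
    have "\<phi>' \<bullet> x = (\<Sum>e\<in>?S. \<mu> e * (\<phi>' \<bullet> c e))" unfolding \<mu>(1) by (simp add: inner_sum_right)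
    also have "\<dots> \<le> (\<Sum>e\<in>?S. \<mu> e * (\<phi> \<bullet> c e))" using \<mu>(2) assms(3) by (intro sum_mono mult_left_mono) auto
    also have "\<dots> = \<phi> \<bullet> x" unfolding \<mu>(1) by (simp add: inner_sum_right)
    finally show ?thesis .
  qed
  have "\<phi>' \<bullet> x = (\<Sum>e\<in>?S'. \<nu> e * (\<phi>' \<bullet> c e))" unfolding \<nu>(1) by (simp add: inner_sum_right)
  moreover have "\<phi> \<bullet> x = (\<Sum>e\<in>?S'. \<nu> e * (\<phi> \<bullet> c e))" unfolding \<nu>(1) by (simp add: inner_sum_right)
  ultimately have "(\<Sum>e\<in>?S'. \<nu> e * (\<phi>' \<bullet> c e - \<phi> \<bullet> c e)) \<le> 0"
    using 1 by (simp add: right_diff_distrib sum_subtractf)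
  moreover have nn: "\<nu> e * (\<phi>' \<bullet> c e - \<phi> \<bullet> c e) \<ge> 0" if "e \<in> ?S'" for e
    using that \<nu>(2) assms(2) by auto
  ultimately have "(\<Sum>e\<in>?S'. \<nu> e * (\<phi>' \<bullet> c e - \<phi> \<bullet> c e)) = 0"
    by (intro antisym sum_nonneg)
  then have "\<forall>e\<in>?S'. \<nu> e * (\<phi>' \<bullet> c e - \<phi> \<bullet> c e) = 0"
    using nn assms(1) by (subst (asm) sum_nonneg_eq_0_iff) auto
  then have "e \<in> ?S" if "e \<in> ?S'" "\<nu> e \<noteq> 0" for e using that by auto
  then show ?thesis unfolding \<nu>(1) using \<nu>(2) assms(1) by (intro pos_cone_support) auto
qed

text \<open>With \<open>N = n * p\<close> for \<open>p + 1\<close> labels, the cap \<open>n\<close>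
  makes these exactly the exponents \<open>n - j l\<close> for \<open>j\<close> in
  \<open>J_set\<close>.\<close>

definition degrees :: "nat \<Rightarrow> nat \<Rightarrow> ('l::finite \<Rightarrow> nat) set" where
  "degrees n N = {d. (\<forall>l. d l \<le> n) \<and> (\<Sum>l\<in>UNIV. d l) = N}"

lemma finite_degrees: "finite (degrees n N)"
proof (rule finite_subset)
  show "degrees n N \<subseteq> UNIV \<rightarrow>\<^sub>E {..n}" unfolding degrees_def PiE_UNIV_domain by blast
  show "finite ((UNIV :: 'a set) \<rightarrow>\<^sub>E {..n})" by (intro finite_PiE) simp_all
qed

text \<open>The sets of generators tight for dual feasible functionals are the cells of a regular
  subdivision of the cone. Generic heights make them linearly independent, so the spanning ones are
  covered by \<open>measure_slice_basis\<close>.\<close>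

lemma measure_slice_polynomial:
  fixes a :: "'e \<Rightarrow> 'a::euclidean_space" and cl :: "'e \<Rightarrow> 'l::finite"
  assumes fin: "finite E" and U: "\<And>l. subspace (U l)" "\<And>l. dim (U l) \<le> n" "\<And>e. e \<in> E \<Longrightarrow> a e \<in> U (cl e)"
  shows "\<exists>k. \<forall>t. (\<forall>l. t $ l > 0) \<longrightarrow>
    measure lebesgue (slice a cl E t) = (\<Sum>d\<in>degrees n DIM('a). k d * (\<Prod>l\<in>UNIV. (t $ l) ^ d l))"
proof -
  let ?c = "lift_vec a cl"
  obtain h where h0: "\<forall>e\<in>E. h e > 0"
    and gen: "\<forall>S\<subseteq>E. \<forall>\<phi>. (\<forall>e\<in>S. \<phi> \<bullet> ?c e = h e) \<longrightarrow> (\<forall>\<alpha>. (\<Sum>e\<in>S. \<alpha> e *\<^sub>R ?c e) = 0 \<longrightarrow> (\<forall>e\<in>S. \<alpha> e = 0))"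
    using generic_heights[OF fin, of ?c] by (elim exE conjE)

  \<comment> \<open>\<open>B\<close> consists of the full-dimensional cells, \<open>R\<close> of the
    families contained in a hyperplane, whose slices are null.\<close>
  define B where "B = {S. S \<subseteq> E \<and> (\<exists>\<phi>. (\<forall>e\<in>E. \<phi> \<bullet> ?c e \<le> h e) \<and> S = {e\<in>E. \<phi> \<bullet> ?c e = h e})
      \<and> (\<forall>\<psi>. \<psi> \<noteq> 0 \<longrightarrow> (\<exists>e\<in>S. \<psi> \<bullet> ?c e \<noteq> 0))}"
  define R where "R = {S. S \<subseteq> E \<and> (\<exists>\<psi>. \<psi> \<noteq> 0 \<and> (\<forall>e\<in>S. \<psi> \<bullet> ?c e = 0))}"
  have finB: "finite B" and finR: "finite R" using fin by (simp_all add: B_def R_def)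
  have BD: "S \<subseteq> E" "\<exists>\<phi>. (\<forall>e\<in>E. \<phi> \<bullet> ?c e \<le> h e) \<and> S = {e\<in>E. \<phi> \<bullet> ?c e = h e}"
    if "S \<in> B" for S
    using that[unfolded B_def, THEN CollectD] by - (elim conjE; assumption)+
  have Bfin: "finite S" if "S \<in> B" for S using that fin by (auto simp: B_def intro: finite_subset)
  have Bind: "\<forall>e\<in>S. \<alpha> e = 0" if SB: "S \<in> B" "(\<Sum>e\<in>S. \<alpha> e *\<^sub>R ?c e) = 0" for S \<alpha>
  proof -
    obtain \<phi> where S: "S = {e\<in>E. \<phi> \<bullet> ?c e = h e}" using BD(2)[OF SB(1)] by (elim exE conjE)
    have "\<forall>e\<in>S. \<phi> \<bullet> ?c e = h e" by (subst S) blast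
    then show ?thesis using gen BD(1) SB by blast
  qed
  have Bsp: "\<exists>e\<in>S. \<psi> \<bullet> ?c e \<noteq> 0" if "S \<in> B" "\<psi> \<noteq> 0" for S \<psi> using that unfolding B_def by blast
  have Bcard: "card S = DIM('a \<times> (real ^ 'l))" if "S \<in> B" for S
    using card_spanning_family[of S ?c] Bfin Bind Bsp that by blast
  define dg where "dg S l = card {e\<in>S. cl e = l} - 1" for S l
  have dg: "dg S \<in> degrees n DIM('a)" if "S \<in> B" for S
    unfolding degrees_def mem_Collect_eq
  proof
    show "sum (dg S) UNIV = DIM('a)"
      unfolding dg_def by (rule measure_slice_basis(1)[where a=a]) (use Bfin Bind Bsp that in blast)+
    show "\<forall>l. dg S l \<le> n"
    proof
      fix l
      have "dg S l \<le> dim (U l)" unfolding dg_def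
        by (rule independent_class_card[where a=a]) (use Bfin Bind that U in \<open>auto simp: B_def\<close>)
      then show "dg S l \<le> n" using U(2)[of l] by linarith
    qed
  qed
  have "\<forall>S\<in>B. \<exists>k. \<forall>t. (\<forall>l. t $ l > 0) \<longrightarrow> measure lebesgue (slice a cl S t) = k * (\<Prod>l\<in>UNIV. (t $ l) ^ dg S l)"
    unfolding dg_def by (intro ballI measure_slice_basis(2)) (use Bfin Bind Bsp in blast)+
  then obtain k where k: "\<And>S t. S \<in> B \<Longrightarrow> (\<And>l. t $ l > 0) \<Longrightarrow>
      measure lebesgue (slice a cl S t) = k S * (\<Prod>l\<in>UNIV. (t $ l) ^ dg S l)"
    by metis
  show ?thesis
  \<comment> \<open>Cells with equal exponents share one coefficient; it does not depend on
    \<open>t\<close>, since the triangulation does not.\<close>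
  proof (intro exI[of _ "\<lambda>d. \<Sum>S\<in>{S\<in>B. dg S = d}. k S"] allI impI)
    fix t :: "real ^ 'l" assume "\<forall>l. t $ l > 0"
    then have t: "\<And>l. t $ l > 0" by blast
    have meas: "slice a cl S t \<in> lmeasurable" if "finite S" for S
      using compact_slice[OF that] by (rule lmeasurable_compact)
    have negR: "negligible (\<Union>S\<in>R. slice a cl S t)"
    proof (rule negligible_Union)
      show "finite ((\<lambda>S. slice a cl S t) ` R)" using finR by simp
      fix T assume "T \<in> (\<lambda>S. slice a cl S t) ` R"
      then obtain S \<psi> where "T = slice a cl S t" "S \<subseteq> E" "\<psi> \<noteq> 0" "\<forall>e\<in>S. \<psi> \<bullet> ?c e = 0" unfolding R_def by blast
      then show "negligible T" using negligible_slice_hyperplane[of S \<psi> a cl t] t finite_subset[OF _ fin] by blast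
    qed
    have cover: "slice a cl E t \<subseteq> (\<Union>S\<in>B. slice a cl S t) \<union> (\<Union>S\<in>R. slice a cl S t)"
    proof
      fix x assume "x \<in> slice a cl E t"
      then have "(x, t) \<in> pos_cone ?c E" by (simp add: slice_def)
      from pos_cone_dual_certificate[OF fin h0 this]
      show "x \<in> (\<Union>S\<in>B. slice a cl S t) \<union> (\<Union>S\<in>R. slice a cl S t)"
      proof (elim disjE exE conjE)
        fix \<phi>
        let ?S = "{e \<in> E. \<phi> \<bullet> ?c e = h e}"
        assume le: "\<forall>e\<in>E. \<phi> \<bullet> ?c e \<le> h e" and "(x, t) \<in> pos_cone ?c ?S"
        then have x: "x \<in> slice a cl ?S t" by (simp add: slice_def)
        have "?S \<in> B \<or> ?S \<in> R"
        proof (cases "\<forall>\<psi>. \<psi> \<noteq> 0 \<longrightarrow> (\<exists>e\<in>?S. \<psi> \<bullet> ?c e \<noteq> 0)")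
          case True
          have "?S \<in> B" unfolding B_def
            by (intro CollectI conjI exI[of _ \<phi>] refl le True) blast
          then show ?thesis ..
        next
          case False
          then show ?thesis unfolding R_def by blast
        qed
        then show ?thesis using x by blast
      next
        fix \<psi> assume "\<psi> \<noteq> 0" and x: "(x, t) \<in> pos_cone ?c {e \<in> E. \<psi> \<bullet> ?c e = 0}"
        then have "{e \<in> E. \<psi> \<bullet> ?c e = 0} \<in> R" unfolding R_def by blast
        moreover have "x \<in> slice a cl {e \<in> E. \<psi> \<bullet> ?c e = 0} t" using x by (simp add: slice_def)
        ultimately show ?thesis by blast
      qed
    qed
    have overlap: "negligible (slice a cl S t \<inter> slice a cl S' t)" if SS: "S \<in> B" "S' \<in> B" "S \<noteq> S'" for S S'
    proof -
      obtain \<phi> where \<phi>: "\<forall>e\<in>E. \<phi> \<bullet> ?c e \<le> h e" "S = {e\<in>E. \<phi> \<bullet> ?c e = h e}" using BD(2)[OF SS(1)] by (elim exE conjE)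
      obtain \<phi>' where \<phi>': "\<forall>e\<in>E. \<phi>' \<bullet> ?c e \<le> h e" "S' = {e\<in>E. \<phi>' \<bullet> ?c e = h e}" using BD(2)[OF SS(2)] by (elim exE conjE)
      have sub: "slice a cl S t \<inter> slice a cl S' t \<subseteq> slice a cl (S \<inter> S') t"
        using pos_cone_eq_of_tight[OF fin \<phi>(1) \<phi>'(1)] unfolding slice_def \<phi>(2) \<phi>'(2) by blast
      \<comment> \<open>All members of \<open>B\<close> have the same cardinality, so two distinct
        ones share too few generators to span the space.\<close>
      have "card (S \<inter> S') < card S"
      proof (rule psubset_card_mono[OF Bfin[OF SS(1)]])
        show "S \<inter> S' \<subset> S"
          using card_subset_eq[OF Bfin[OF SS(2)], of S] Bcard SS by auto
      qed
      then have "card (?c ` (S \<inter> S')) < DIM('a \<times> (real ^ 'l))"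
        using card_image_le[of "S \<inter> S'" ?c] Bfin[OF SS(1)] Bcard[OF SS(1)] by fastforce
      then have "dim (?c ` (S \<inter> S')) < DIM('a \<times> (real ^ 'l))"
        using dim_le_card'[of "?c ` (S \<inter> S')"] Bfin[OF SS(1)] by fastforce
      then have "span (?c ` (S \<inter> S')) \<noteq> UNIV" by (metis dim_UNIV dim_span less_irrefl)
      then obtain \<psi> where "\<psi> \<noteq> 0" "\<forall>x\<in>span (?c ` (S \<inter> S')). \<psi> \<bullet> x = 0" using span_not_UNIV_orthogonal by blast
      then have "negligible (slice a cl (S \<inter> S') t)"
        using Bfin[OF SS(1)] t by (intro negligible_slice_hyperplane[of _ \<psi>]) (auto simp: span_base)
      then show ?thesis by (rule negligible_subset) (rule sub)
    qed
    have "measure lebesgue (slice a cl E t) = measure lebesgue (\<Union>S\<in>B. slice a cl S t)"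
    proof (rule measure_negligible_symdiff)
      show "(\<Union>S\<in>B. slice a cl S t) \<in> lmeasurable" using finB meas Bfin by (intro fmeasurable.finite_UN) auto
      have "(\<Union>S\<in>B. slice a cl S t) \<subseteq> slice a cl E t" using slice_mono fin unfolding B_def by blast
      then show "negligible ((\<Union>S\<in>B. slice a cl S t) - slice a cl E t \<union> (slice a cl E t - (\<Union>S\<in>B. slice a cl S t)))"
        using cover by (intro negligible_subset[OF negR]) blast
    qed
    also have "\<dots> = (\<Sum>S\<in>B. measure lebesgue (slice a cl S t))"
      using finB meas Bfin overlap by (intro measure_negligible_finite_Union_image) (auto simp: pairwise_def)
    also have "\<dots> = (\<Sum>S\<in>B. k S * (\<Prod>l\<in>UNIV. (t $ l) ^ dg S l))" using k t by (intro sum.cong) auto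
    also have "\<dots> = (\<Sum>d\<in>degrees n DIM('a). \<Sum>S\<in>{S\<in>B. dg S = d}. k S * (\<Prod>l\<in>UNIV. (t $ l) ^ dg S l))"
      by (rule sum.group[symmetric]) (use finB finite_degrees dg in auto)
    also have "\<dots> = (\<Sum>d\<in>degrees n DIM('a). (\<Sum>S\<in>{S\<in>B. dg S = d}. k S) * (\<Prod>l\<in>UNIV. (t $ l) ^ d l))"
      unfolding sum_distrib_right by (intro sum.cong refl) auto
    finally show "measure lebesgue (slice a cl E t) = (\<Sum>d\<in>degrees n DIM('a). (\<Sum>S\<in>{S\<in>B. dg S = d}. k S) * (\<Prod>l\<in>UNIV. (t $ l) ^ d l))" .
  qed
qed

section \<open>From polytopes to convex bodies\<close>

text \<open>As a linear image of a set of families, the sum inherits convexity and compactness.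
  Indexing the bodies by a type lets repeated entries of a mixed volume share one
  coefficient.\<close>

definition msum :: "('l::finite \<Rightarrow> 'a::euclidean_space set) \<Rightarrow> real ^ 'l \<Rightarrow> 'a set" where
  "msum G t = (\<lambda>g. \<Sum>l\<in>UNIV. (t $ l) *\<^sub>R (g $ l)) ` {g :: 'a ^ 'l. \<forall>l. g $ l \<in> G l}"

lemma msumI: "(\<And>l. g l \<in> G l) \<Longrightarrow> x = (\<Sum>l\<in>UNIV. (t $ l) *\<^sub>R g l) \<Longrightarrow> x \<in> msum G t"
  unfolding msum_def by (intro image_eqI[of _ _ "\<chi> l. g l"]) auto

lemma msumE:
  assumes "x \<in> msum G t"
  obtains g where "\<And>l. g l \<in> G l" "x = (\<Sum>l\<in>UNIV. (t $ l) *\<^sub>R g l)"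
proof -
  obtain g where "\<forall>l. g $ l \<in> G l" "x = (\<Sum>l\<in>UNIV. (t $ l) *\<^sub>R (g $ l))" using assms by (auto simp: msum_def)
  then show thesis by (intro that[of "\<lambda>l. g $ l"]) auto
qed

lemma msum_mono: "(\<And>l. G l \<subseteq> H l) \<Longrightarrow> msum G t \<subseteq> msum H t"
  unfolding msum_def by blast

lemma linear_weighted_sum: "linear (\<lambda>g :: 'a::euclidean_space ^ 'l::finite. \<Sum>l\<in>UNIV. (t $ l) *\<^sub>R (g $ l))"
  by (rule linearI) (simp_all add: scaleR_add_right sum.distrib scaleR_sum_right mult.commute)

lemma convex_msum:
  fixes G :: "'l::finite \<Rightarrow> 'a::euclidean_space set"
  assumes "\<And>l. convex (G l)"
  shows "convex (msum G t)"
  unfolding msum_def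
proof (rule convex_linear_image[OF linear_weighted_sum])
  show "convex {g. \<forall>l. g $ l \<in> G l}"
  proof (rule convexI)
    fix x y :: "'a ^ 'l" and u v :: real
    assume "x \<in> {g. \<forall>l. g $ l \<in> G l}" "y \<in> {g. \<forall>l. g $ l \<in> G l}" and uv: "0 \<le> u" "0 \<le> v" "u + v = 1"
    then have "u *\<^sub>R (x $ l) + v *\<^sub>R (y $ l) \<in> G l" for l using convexD[OF assms] by blast
    then show "u *\<^sub>R x + v *\<^sub>R y \<in> {g. \<forall>l. g $ l \<in> G l}" by simp
  qed
qed

lemma compact_vec_family:
  fixes G :: "'l::finite \<Rightarrow> 'a::euclidean_space set"
  assumes "\<And>l. compact (G l)"
  shows "compact {g :: 'a ^ 'l. \<forall>l. g $ l \<in> G l}"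
proof -
  have "closed (G l)" for l using assms by (rule compact_imp_closed)
  then have "closed (\<Inter>l. (\<lambda>g :: 'a ^ 'l. g $ l) -` G l)"
    by (intro closed_INT ballI continuous_closed_vimage) (auto intro: continuous_intros)
  moreover have "(\<Inter>l. (\<lambda>g :: 'a ^ 'l. g $ l) -` G l) = {g. \<forall>l. g $ l \<in> G l}" by auto
  ultimately have "closed {g. \<forall>l. g $ l \<in> G l}" by simp
  moreover have "bounded {g. \<forall>l. g $ l \<in> G l}"
  proof -
    have "bounded (G l)" for l using assms by (rule compact_imp_bounded)
    then have "\<forall>l. \<exists>b. \<forall>x\<in>G l. norm x \<le> b" unfolding bounded_iff by (rule allI)
    then obtain b where b: "\<And>l x. x \<in> G l \<Longrightarrow> norm x \<le> b l" by metis
    show ?thesis unfolding bounded_iff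
    proof (intro exI[of _ "\<Sum>l\<in>UNIV. b l"] ballI)
      fix g assume "g \<in> {g. \<forall>l. g $ l \<in> G l}"
      then have "norm (g $ l) \<le> b l" for l using b by blast
      then have "(\<Sum>l\<in>UNIV. norm (g $ l)) \<le> (\<Sum>l\<in>UNIV. b l)" by (intro sum_mono)
      moreover have "norm g \<le> (\<Sum>l\<in>UNIV. norm (g $ l))" unfolding norm_vec_def by (intro L2_set_le_sum) simp
      ultimately show "norm g \<le> (\<Sum>l\<in>UNIV. b l)" by linarith
    qed
  qed
  ultimately show ?thesis by (simp add: compact_eq_bounded_closed)
qed

lemma compact_msum:
  fixes G :: "'l::finite \<Rightarrow> 'a::euclidean_space set"
  assumes "\<And>l. compact (G l)"
  shows "compact (msum G t)"
  unfolding msum_def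
proof (rule compact_continuous_image)
  show "continuous_on {g. \<forall>l. g $ l \<in> G l} (\<lambda>g. \<Sum>l\<in>UNIV. (t $ l) *\<^sub>R (g $ l))"
    by (intro continuous_intros)
  show "compact {g. \<forall>l. g $ l \<in> G l}" using assms by (rule compact_vec_family)
qed

text \<open>The weights correspond by \<open>\<mu> (l, v) = t $ l * u l v\<close>; the way back
  divides by \<open>t $ l\<close>.\<close>

lemma msum_convex_hull:
  fixes V :: "'l::finite \<Rightarrow> 'a::euclidean_space set"
  assumes V: "\<And>l. finite (V l)" and t: "\<And>l. t $ l > 0"
  shows "msum (\<lambda>l. convex hull V l) t = slice snd fst (Sigma UNIV V) t"
proof -
  have fin: "finite (Sigma UNIV V)" using V by (intro finite_SigmaI) auto
  have cls: "(\<Sum>e\<in>{e \<in> Sigma UNIV V. fst e = l}. \<mu> e) = (\<Sum>v\<in>V l. \<mu> (l, v))" for \<mu> :: "'l \<times> 'a \<Rightarrow> real" and l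
  proof -
    have "{e \<in> Sigma UNIV V. fst e = l} = Pair l ` V l" by auto
    then show ?thesis by (simp add: sum.reindex inj_on_def)
  qed
  have tot: "(\<Sum>e\<in>Sigma UNIV V. \<mu> e *\<^sub>R snd e) = (\<Sum>l\<in>UNIV. \<Sum>v\<in>V l. \<mu> (l, v) *\<^sub>R v)" for \<mu> :: "'l \<times> 'a \<Rightarrow> real"
    using V by (subst sum.Sigma) (auto simp: case_prod_beta)
  show ?thesis
  proof
    show "msum (\<lambda>l. convex hull V l) t \<subseteq> slice snd fst (Sigma UNIV V) t"
    proof
      fix x assume "x \<in> msum (\<lambda>l. convex hull V l) t"
      then obtain g where g: "\<And>l. g l \<in> convex hull V l" "x = (\<Sum>l\<in>UNIV. (t $ l) *\<^sub>R g l)" by (rule msumE) blast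
      have "\<forall>l. \<exists>u. (\<forall>v\<in>V l. 0 \<le> u v) \<and> sum u (V l) = 1 \<and> (\<Sum>v\<in>V l. u v *\<^sub>R v) = g l"
        using g(1) unfolding convex_hull_finite[OF V] by blast
      then obtain u where u: "\<And>l v. v \<in> V l \<Longrightarrow> 0 \<le> u l v" "\<And>l. sum (u l) (V l) = 1" "\<And>l. (\<Sum>v\<in>V l. u l v *\<^sub>R v) = g l"
        by metis
      show "x \<in> slice snd fst (Sigma UNIV V) t"
        unfolding slice_iff[OF fin] cls tot
      proof (intro exI[of _ "\<lambda>e. t $ fst e * u (fst e) (snd e)"] conjI allI ballI)
        show "0 \<le> t $ fst e * u (fst e) (snd e)" if "e \<in> Sigma UNIV V" for e
          using that u(1) t[of "fst e"] by auto
        show "x = (\<Sum>l\<in>UNIV. \<Sum>v\<in>V l. (t $ fst (l, v) * u (fst (l, v)) (snd (l, v))) *\<^sub>R v)"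
          unfolding g(2) u(3)[symmetric] by (simp add: scaleR_sum_right)
        show "(\<Sum>v\<in>V l. t $ fst (l, v) * u (fst (l, v)) (snd (l, v))) = t $ l" for l
          using u(2)[of l] by (simp add: sum_distrib_left[symmetric])
      qed
    qed
    show "slice snd fst (Sigma UNIV V) t \<subseteq> msum (\<lambda>l. convex hull V l) t"
    proof
      fix x assume "x \<in> slice snd fst (Sigma UNIV V) t"
      then obtain \<mu> where \<mu>: "\<forall>e\<in>Sigma UNIV V. 0 \<le> \<mu> e" "x = (\<Sum>l\<in>UNIV. \<Sum>v\<in>V l. \<mu> (l, v) *\<^sub>R v)"
          "\<forall>l. (\<Sum>v\<in>V l. \<mu> (l, v)) = t $ l"
        unfolding slice_iff[OF fin] cls tot by blast
      define g where "g l = (\<Sum>v\<in>V l. (\<mu> (l, v) / t $ l) *\<^sub>R v)" for l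
      have "g l \<in> convex hull V l" for l
        unfolding convex_hull_finite[OF V] mem_Collect_eq
      proof (intro exI[of _ "\<lambda>v. \<mu> (l, v) / t $ l"] conjI ballI)
        show "0 \<le> \<mu> (l, v) / t $ l" if "v \<in> V l" for v using that \<mu>(1) t[of l] by simp
        show "(\<Sum>v\<in>V l. \<mu> (l, v) / t $ l) = 1"
          using \<mu>(3) t[of l] by (simp add: sum_divide_distrib[symmetric])
      qed (simp add: g_def)
      moreover have "x = (\<Sum>l\<in>UNIV. (t $ l) *\<^sub>R g l)"
        unfolding \<mu>(2) g_def scaleR_sum_right
      proof (intro sum.cong refl)
        fix l v
        show "\<mu> (l, v) *\<^sub>R v = (t $ l) *\<^sub>R (\<mu> (l, v) / t $ l) *\<^sub>R v" using t[of l] by simp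
      qed
      ultimately show "x \<in> msum (\<lambda>l. convex hull V l) t" by (rule msumI)
    qed
  qed
qed

lemma msum_dense:
  fixes G :: "'l::finite \<Rightarrow> 'a::euclidean_space set" and s :: "'l \<Rightarrow> nat \<Rightarrow> 'a"
  assumes D: "\<And>l. G l \<subseteq> closure (range (s l))"
  shows "msum G t \<subseteq> closure (\<Union>k. msum (\<lambda>l. convex hull (s l ` {..k})) t)"
proof
  fix x assume "x \<in> msum G t"
  then obtain g where g: "\<And>l. g l \<in> G l" "x = (\<Sum>l\<in>UNIV. (t $ l) *\<^sub>R g l)" by (rule msumE) blast
  show "x \<in> closure (\<Union>k. msum (\<lambda>l. convex hull (s l ` {..k})) t)"
    unfolding closure_approachable
  proof (intro allI impI)
    fix \<epsilon> :: real assume "\<epsilon> > 0"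
    \<comment> \<open>The summand 1 keeps \<open>T\<close> positive and makes the final estimate
      strict.\<close>
    define T where "T = (\<Sum>l\<in>UNIV. \<bar>t $ l\<bar>) + 1"
    have T: "T > 0" by (simp add: T_def sum_nonneg add_nonneg_pos)
    have "\<exists>i. dist (s l i) (g l) < \<epsilon> / T" for l
    proof -
      have "g l \<in> closure (range (s l))" using D g(1) by blast
      moreover have "\<epsilon> / T > 0" using \<open>\<epsilon> > 0\<close> T by simp
      ultimately show ?thesis unfolding closure_approachable by blast
    qed
    then obtain i where i: "\<And>l. dist (s l (i l)) (g l) < \<epsilon> / T" by metis
    define k where "k = Max (range i)"
    have ik: "i l \<le> k" for l unfolding k_def by (intro Max_ge) auto
    let ?y = "\<Sum>l\<in>UNIV. (t $ l) *\<^sub>R s l (i l)"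
    have "?y \<in> msum (\<lambda>l. convex hull (s l ` {..k})) t"
      by (rule msumI[of "\<lambda>l. s l (i l)"]) (auto intro!: hull_inc ik)
    moreover have "dist ?y x < \<epsilon>"
    proof -
      have "dist ?y x = norm (\<Sum>l\<in>UNIV. (t $ l) *\<^sub>R (s l (i l) - g l))"
        by (simp add: g(2) dist_norm scaleR_diff_right sum_subtractf)
      also have "\<dots> \<le> (\<Sum>l\<in>UNIV. \<bar>t $ l\<bar> * (\<epsilon> / T))"
      proof (intro order.trans[OF norm_sum] sum_mono)
        fix l
        have "norm (s l (i l) - g l) \<le> \<epsilon> / T" using i[of l] by (simp add: dist_norm)
        then show "norm ((t $ l) *\<^sub>R (s l (i l) - g l)) \<le> \<bar>t $ l\<bar> * (\<epsilon> / T)"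
          unfolding norm_scaleR by (rule mult_left_mono) simp
      qed
      also have "\<dots> = (T - 1) * (\<epsilon> / T)" by (simp only: T_def sum_distrib_right add_diff_cancel_right')
      also have "\<dots> < \<epsilon>" using T \<open>\<epsilon> > 0\<close> by (simp add: field_simps)
      finally show ?thesis .
    qed
    ultimately show "\<exists>y\<in>\<Union>k. msum (\<lambda>l. convex hull (s l ` {..k})) t. dist y x < \<epsilon>" by blast
  qed
qed

text \<open>The union is convex, and a set between it and its closure differs from it only within
  the frontier, which is null.\<close>

lemma measure_convex_dense:
  fixes A :: "nat \<Rightarrow> 'a::euclidean_space set"
  assumes conv: "\<And>k. convex (A k)" and inc: "incseq A" and M: "bounded M" "(\<Union>k. A k) \<subseteq> M" "M \<subseteq> closure (\<Union>k. A k)"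
  shows "(\<lambda>k. measure lebesgue (A k)) \<longlonglongrightarrow> measure lebesgue M"
proof -
  let ?U = "\<Union>k. A k"
  have cU: "convex ?U"
  proof (rule convexI)
    fix x y :: 'a and u v :: real
    assume "x \<in> ?U" "y \<in> ?U" and uv: "0 \<le> u" "0 \<le> v" "u + v = 1"
    then obtain i j where "x \<in> A i" "y \<in> A j" by blast
    then have "x \<in> A (max i j)" "y \<in> A (max i j)"
      using incseqD[OF inc, of i "max i j"] incseqD[OF inc, of j "max i j"] by auto
    then have "u *\<^sub>R x + v *\<^sub>R y \<in> A (max i j)" using convexD[OF conv] uv by blast
    then show "u *\<^sub>R x + v *\<^sub>R y \<in> ?U" by blast
  qed
  have bU: "bounded ?U" using M(1,2) by (rule bounded_subset)
  have mU: "?U \<in> lmeasurable" using cU bU by (rule measurable_convex)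
  have "(\<lambda>k. measure lebesgue (A k)) \<longlonglongrightarrow> measure lebesgue ?U"
  proof (rule Lim_measure_incseq[OF _ inc])
    have "A k \<in> lmeasurable" for k
      by (rule measurable_convex[OF conv]) (use bU in \<open>blast intro: bounded_subset\<close>)
    then show "range A \<subseteq> sets lebesgue" by (auto dest: fmeasurableD)
    show "emeasure lebesgue ?U \<noteq> \<infinity>" using mU by (auto simp: fmeasurable_def)
  qed
  moreover have "measure lebesgue M = measure lebesgue ?U"
  proof (rule measure_negligible_symdiff[OF mU])
    have "?U - M \<union> (M - ?U) \<subseteq> frontier ?U"
      using M(2,3) interior_subset[of ?U] unfolding frontier_def by blast
    then show "negligible (?U - M \<union> (M - ?U))"
      using negligible_convex_frontier[OF cU] negligible_subset by blast
  qed
  ultimately show ?thesis by simp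
qed


text \<open>Convex hulls of initial segments of dense sequences approximate the bodies from within.
  They stay in the same subspaces, so one finite set of monomials serves for all of them and for the
  limit.\<close>

lemma measure_msum_pos:
  fixes G :: "'l::finite \<Rightarrow> 'a::euclidean_space set"
  assumes G: "\<And>l. compact (G l)" "\<And>l. convex (G l)" "\<And>l. G l \<noteq> {}"
    and U: "\<And>l. subspace (U l)" "\<And>l. dim (U l) \<le> n" "\<And>l. G l \<subseteq> U l"
  shows "\<exists>c. \<forall>t\<in>{t. \<forall>l. t $ l > 0}.
    measure lebesgue (msum G t) = (\<Sum>d\<in>degrees n DIM('a). c d * (\<Prod>l\<in>UNIV. (t $ l) ^ d l))"
proof -
  have "\<exists>s :: nat \<Rightarrow> 'a. range s \<subseteq> G l \<and> G l \<subseteq> closure (range s)" for l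
  proof -
    obtain T where T: "countable T" "T \<subseteq> G l" "G l \<subseteq> closure T" using separable[of "G l"] by blast
    then have "T \<noteq> {}" using G(3)[of l] by auto
    then have "range (from_nat_into T) = T" using T(1) by (rule range_from_nat_into)
    then show ?thesis using T by (intro exI[of _ "from_nat_into T"]) simp
  qed
  then obtain s where s: "\<And>l. range (s l :: nat \<Rightarrow> 'a) \<subseteq> G l" "\<And>l. G l \<subseteq> closure (range (s l))"
    by metis
  define P where "P k = msum (\<lambda>l. convex hull (s l ` {..k}))" for k
  show ?thesis
  proof (rule pointwise_limit_in_span[OF finite_degrees, where f = "\<lambda>k t. measure lebesgue (P k t)"])
    fix k
    have "\<exists>c. \<forall>t. (\<forall>l. t $ l > 0) \<longrightarrow> measure lebesgue (slice snd fst (Sigma UNIV (\<lambda>l. s l ` {..k})) t)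
        = (\<Sum>d\<in>degrees n DIM('a). c d * (\<Prod>l\<in>UNIV. (t $ l) ^ d l))"
    proof (rule measure_slice_polynomial[where U = U])
      show "snd e \<in> U (fst e)" if "e \<in> Sigma UNIV (\<lambda>l. s l ` {..k})" for e
        using that s(1) U(3) by fastforce
    qed (use U in auto)
    then show "\<exists>c. \<forall>t\<in>{t. \<forall>l. t $ l > 0}. measure lebesgue (P k t)
        = (\<Sum>d\<in>degrees n DIM('a). c d * (\<Prod>l\<in>UNIV. (t $ l) ^ d l))"
      unfolding P_def by (simp add: msum_convex_hull)
  next
    fix t :: "real ^ 'l"
    show "(\<lambda>k. measure lebesgue (P k t)) \<longlonglongrightarrow> measure lebesgue (msum G t)"
    proof (rule measure_convex_dense)
      show "convex (P k t)" for k unfolding P_def by (intro convex_msum convex_convex_hull)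
      show "incseq (\<lambda>k. P k t)" unfolding P_def
        by (intro incseq_SucI msum_mono hull_mono image_mono) auto
      show "bounded (msum G t)" using compact_msum[OF G(1)] by (rule compact_imp_bounded)
      show "(\<Union>k. P k t) \<subseteq> msum G t" unfolding P_def
        by (intro UN_least msum_mono hull_minimal G(2)) (use s(1) in auto)
      show "msum G t \<subseteq> closure (\<Union>k. P k t)" unfolding P_def using s(2) by (rule msum_dense)
    qed
  qed
qed

lemma msum_scaleR: "msum G (\<delta> *\<^sub>R t) = (*\<^sub>R) \<delta> ` msum G t"
  unfolding msum_def image_image by (simp add: scaleR_sum_right)

text \<open>Two points chosen from the convex body \<open>G l\<close> merge into their mean with
  weights proportional to \<open>t $ l\<close> and \<open>u $ l\<close>; if both vanish, any point
  will do.\<close>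

lemma msum_add:
  fixes G :: "'l::finite \<Rightarrow> 'a::euclidean_space set"
  assumes "\<And>l. convex (G l)" "\<And>l. t $ l \<ge> 0" "\<And>l. u $ l \<ge> 0"
  shows "msum G (t + u) = {x + y | x y. x \<in> msum G t \<and> y \<in> msum G u}"
proof (intro set_eqI iffI)
  fix z assume "z \<in> msum G (t + u)"
  then obtain g where g: "\<And>l. g l \<in> G l" "z = (\<Sum>l\<in>UNIV. ((t + u) $ l) *\<^sub>R g l)" by (rule msumE) blast
  have zeq: "z = (\<Sum>l\<in>UNIV. (t $ l) *\<^sub>R g l) + (\<Sum>l\<in>UNIV. (u $ l) *\<^sub>R g l)"
    unfolding g(2) by (simp add: scaleR_add_left sum.distrib)
  have "(\<Sum>l\<in>UNIV. (t' $ l) *\<^sub>R g l) \<in> msum G t'" for t' by (rule msumI[of g]) (auto intro: g(1))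
  then show "z \<in> {x + y | x y. x \<in> msum G t \<and> y \<in> msum G u}" using zeq by blast
next
  fix z assume "z \<in> {x + y | x y. x \<in> msum G t \<and> y \<in> msum G u}"
  then obtain x y where z: "z = x + y" "x \<in> msum G t" "y \<in> msum G u" by blast
  obtain g where g: "\<And>l. g l \<in> G l" "x = (\<Sum>l\<in>UNIV. (t $ l) *\<^sub>R g l)" using z(2) by (rule msumE) blast
  obtain g' where g': "\<And>l. g' l \<in> G l" "y = (\<Sum>l\<in>UNIV. (u $ l) *\<^sub>R g' l)" using z(3) by (rule msumE) blast
  have "\<exists>h. h \<in> G l \<and> (t $ l + u $ l) *\<^sub>R h = (t $ l) *\<^sub>R g l + (u $ l) *\<^sub>R g' l" for l
  proof (cases "t $ l + u $ l = 0")
    case True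
    then have "t $ l = 0" "u $ l = 0" using assms(2,3)[of l] by linarith+
    then show ?thesis using g(1)[of l] by (intro exI[of _ "g l"]) simp
  next
    case False
    then have pos: "t $ l + u $ l > 0" using assms(2,3)[of l] by linarith
    let ?h = "(t $ l / (t $ l + u $ l)) *\<^sub>R g l + (u $ l / (t $ l + u $ l)) *\<^sub>R g' l"
    have "?h \<in> G l"
      using pos assms(2,3)[of l] by (intro convexD[OF assms(1)] g(1) g'(1)) (auto simp: add_divide_distrib[symmetric])
    moreover have "(t $ l + u $ l) *\<^sub>R ?h = (t $ l) *\<^sub>R g l + (u $ l) *\<^sub>R g' l"
      using pos by (simp add: scaleR_add_right)
    ultimately show ?thesis by blast
  qed
  then obtain h where h: "\<And>l. h l \<in> G l" "\<And>l. (t $ l + u $ l) *\<^sub>R h l = (t $ l) *\<^sub>R g l + (u $ l) *\<^sub>R g' l" by metis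
  have "z = (\<Sum>l\<in>UNIV. ((t + u) $ l) *\<^sub>R h l)"
    unfolding z(1) g(2) g'(2) by (simp add: h(2) sum.distrib)
  then show "z \<in> msum G (t + u)" by (rule msumI[OF h(1)])
qed

text \<open>This lets positive coefficients tend to vanishing ones.\<close>

lemma measure_parallel_body_tendsto:
  fixes A Q :: "'a::euclidean_space set"
  assumes A: "compact A" "convex A" and Q: "compact Q" "convex Q" "q0 \<in> Q"
  shows "(\<lambda>k. measure lebesgue {x + (1 / real (Suc k)) *\<^sub>R y | x y. x \<in> A \<and> y \<in> Q}) \<longlonglongrightarrow> measure lebesgue A"
proof -
  \<comment> \<open>Subtracting \<open>q0\<close> puts the origin into the added body, so that the
    sets decrease with \<open>k\<close>; the translation does not change the volume.\<close>
  define N where "N k = {x + (1 / real (Suc k)) *\<^sub>R (y - q0) | x y. x \<in> A \<and> y \<in> Q}" for k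
  have shift: "{x + (1 / real (Suc k)) *\<^sub>R y | x y. x \<in> A \<and> y \<in> Q} = (+) ((1 / real (Suc k)) *\<^sub>R q0) ` N k" for k
  proof -
    define \<delta> where "\<delta> = 1 / real (Suc k)"
    have eq: "\<delta> *\<^sub>R q0 + (x + \<delta> *\<^sub>R (y - q0)) = x + \<delta> *\<^sub>R y" for x y
      by (simp add: scaleR_diff_right)
    have "(+) (\<delta> *\<^sub>R q0) ` {x + \<delta> *\<^sub>R (y - q0) | x y. x \<in> A \<and> y \<in> Q}
        = {\<delta> *\<^sub>R q0 + (x + \<delta> *\<^sub>R (y - q0)) | x y. x \<in> A \<and> y \<in> Q}" by blast
    then show ?thesis unfolding N_def eq \<delta>_def[symmetric] by simp
  qed
  have cN: "compact (N k)" for k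
  proof -
    have "compact ((\<lambda>z. fst z + (1 / real (Suc k)) *\<^sub>R (snd z - q0)) ` (A \<times> Q))"
      by (intro compact_continuous_image continuous_intros compact_Times A Q)
    moreover have "(\<lambda>z. fst z + (1 / real (Suc k)) *\<^sub>R (snd z - q0)) ` (A \<times> Q) = N k"
      unfolding N_def by force
    ultimately show ?thesis by simp
  qed
  have dec: "decseq N"
  proof (rule decseq_SucI, rule subsetI)
    fix k z assume "z \<in> N (Suc k)"
    then obtain x y where xy: "z = x + (1 / real (Suc (Suc k))) *\<^sub>R (y - q0)" "x \<in> A" "y \<in> Q" by (auto simp: N_def)
    define \<theta> where "\<theta> = real (Suc k) / real (Suc (Suc k))"
    have th: "0 \<le> \<theta>" "\<theta> \<le> 1" by (simp_all add: \<theta>_def)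
    have y': "q0 + \<theta> *\<^sub>R (y - q0) \<in> Q"
      using convexD_alt[OF Q(2,3) xy(3) th] by (simp add: algebra_simps)
    have "z = x + (1 / real (Suc k)) *\<^sub>R ((q0 + \<theta> *\<^sub>R (y - q0)) - q0)"
      unfolding xy(1) \<theta>_def by (simp del: of_nat_Suc)
    then show "z \<in> N k" using xy(2) y' unfolding N_def by blast
  qed
  have int: "(\<Inter>k. N k) = A"
  proof
    show "A \<subseteq> (\<Inter>k. N k)"
    proof
      fix x assume "x \<in> A"
      moreover have "x = x + (1 / real (Suc k)) *\<^sub>R (q0 - q0)" for k by simp
      ultimately show "x \<in> (\<Inter>k. N k)" unfolding N_def using Q(3) by blast
    qed
    show "(\<Inter>k. N k) \<subseteq> A"
    proof
      fix z assume z: "z \<in> (\<Inter>k. N k)"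
      have "\<forall>k. \<exists>x y. z = x + (1 / real (Suc k)) *\<^sub>R (y - q0) \<and> x \<in> A \<and> y \<in> Q" using z by (auto simp: N_def)
      then obtain x y where xy: "\<And>k. z = x k + (1 / real (Suc k)) *\<^sub>R (y k - q0)" "\<And>k. x k \<in> A" "\<And>k. y k \<in> Q"
        by metis
      obtain b where b: "\<And>y. y \<in> Q \<Longrightarrow> norm (y - q0) \<le> b"
        using compact_imp_bounded[OF Q(1)] bounded_minus_comp[of "\<lambda>y. y" Q "\<lambda>_. q0"] unfolding bounded_iff by auto
      have "(\<lambda>k. x k) \<longlonglongrightarrow> z"
      proof (rule LIM_zero_cancel, rule tendsto_0_le[OF LIMSEQ_inverse_real_of_nat])
        show "\<forall>\<^sub>F k in sequentially. norm (x k - z) \<le> norm (inverse (real (Suc k))) * b"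
        proof (intro always_eventually allI)
          fix k
          have "x k - z = - ((1 / real (Suc k)) *\<^sub>R (y k - q0))" using xy(1)[of k] by (metis diff_add_cancel diff_diff_eq2 diff_self diff_0 add_diff_cancel_left')
          then have "norm (x k - z) = inverse (real (Suc k)) * norm (y k - q0)" by (simp add: inverse_eq_divide)
          then show "norm (x k - z) \<le> norm (inverse (real (Suc k))) * b" using b[OF xy(3)[of k]] by (simp add: mult_left_mono)
        qed
      qed
      then show "z \<in> A" using closed_sequentially[OF compact_imp_closed[OF A(1)]] xy(2) by blast
    qed
  qed
  have "(\<lambda>k. measure lebesgue (N k)) \<longlonglongrightarrow> measure lebesgue (\<Inter>k. N k)"
  proof (rule Lim_measure_decseq[OF _ dec])
    have Nm: "N k \<in> lmeasurable" for k using cN by (rule lmeasurable_compact)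
    show "range N \<subseteq> sets lebesgue" using Nm by (auto dest: fmeasurableD)
    show "emeasure lebesgue (N k) \<noteq> \<infinity>" for k using Nm[of k] unfolding fmeasurable_def by fastforce
  qed
  then show ?thesis unfolding shift measure_translation int .
qed

text \<open>Both sides pass to the limit along \<open>t + (1, ..., 1) / (k + 1)\<close>. This
  extends the formula to the boundary of the orthant, where the derivatives of
  \<open>mixed_volume\<close> are taken.\<close>

theorem measure_msum_polynomial:
  fixes G :: "'l::finite \<Rightarrow> 'a::euclidean_space set"
  assumes G: "\<And>l. compact (G l)" "\<And>l. convex (G l)" "\<And>l. G l \<noteq> {}"
    and U: "\<And>l. subspace (U l)" "\<And>l. dim (U l) \<le> n" "\<And>l. G l \<subseteq> U l"
  shows "\<exists>c. \<forall>t. (\<forall>l. t $ l \<ge> 0) \<longrightarrow>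
    measure lebesgue (msum G t) = (\<Sum>d\<in>degrees n DIM('a). c d * (\<Prod>l\<in>UNIV. (t $ l) ^ d l))"
proof -
  obtain c where c: "\<And>t. (\<forall>l. t $ l > 0) \<Longrightarrow>
      measure lebesgue (msum G t) = (\<Sum>d\<in>degrees n DIM('a). c d * (\<Prod>l\<in>UNIV. (t $ l) ^ d l))"
  proof -
    have "\<exists>c. \<forall>t\<in>{t. \<forall>l. t $ l > 0}.
      measure lebesgue (msum G t) = (\<Sum>d\<in>degrees n DIM('a). c d * (\<Prod>l\<in>UNIV. (t $ l) ^ d l))"
      by (rule measure_msum_pos[where U = U]) (use G U in auto)
    then show thesis using that by blast
  qed
  show ?thesis
  proof (intro exI[of _ c] allI impI)
    fix t :: "real ^ 'l" assume "\<forall>l. t $ l \<ge> 0"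
    then have t: "\<And>l. t $ l \<ge> 0" by blast
    define u where "u k = t + (1 / real (Suc k)) *\<^sub>R (\<chi> l. 1)" for k
    have upos: "\<forall>l. u k $ l > 0" for k using t by (auto simp: u_def intro: add_nonneg_pos)
    obtain q0 where q0: "q0 \<in> msum G (\<chi> l. 1)"
    proof -
      have "\<forall>l. \<exists>g. g \<in> G l" using G(3) by blast
      then obtain g where "\<And>l. g l \<in> G l" by metis
          then show thesis by (intro that msumI[of g]) auto
    qed
    have "(\<lambda>k. measure lebesgue (msum G (u k))) \<longlonglongrightarrow> measure lebesgue (msum G t)"
    proof -
      have "msum G (u k) = {x + (1 / real (Suc k)) *\<^sub>R y | x y. x \<in> msum G t \<and> y \<in> msum G (\<chi> l. 1)}" for k
      proof -
        have "msum G (u k) = {x + y | x y. x \<in> msum G t \<and> y \<in> msum G ((1 / real (Suc k)) *\<^sub>R (\<chi> l. 1))}"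
          unfolding u_def by (rule msum_add[OF G(2) t]) simp
        then show ?thesis unfolding msum_scaleR by blast
      qed
      then show ?thesis
        by (simp only:) (rule measure_parallel_body_tendsto[OF compact_msum convex_msum compact_msum convex_msum q0]; rule G)
    qed
    moreover have "(\<lambda>k. measure lebesgue (msum G (u k))) \<longlonglongrightarrow> (\<Sum>d\<in>degrees n DIM('a). c d * (\<Prod>l\<in>UNIV. (t $ l) ^ d l))"
    proof -
      have "(\<lambda>k. u k $ l) \<longlonglongrightarrow> t $ l" for l
        using tendsto_add[OF tendsto_const[of "t $ l"] LIMSEQ_inverse_real_of_nat] by (simp add: u_def inverse_eq_divide)
      then show ?thesis unfolding c[OF upos] by (intro tendsto_sum tendsto_mult tendsto_const tendsto_prod tendsto_power)
    qed
    ultimately show "measure lebesgue (msum G t) = (\<Sum>d\<in>degrees n DIM('a). c d * (\<Prod>l\<in>UNIV. (t $ l) ^ d l))"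
      by (rule LIMSEQ_unique)
  qed
qed

section \<open>Mixed volumes as coefficients\<close>

lemma minkowski_comb_snoc:
  "minkowski_comb (Ks @ [L]) s = minkowski_comb Ks s + (*\<^sub>R) (s (length Ks)) ` L"
proof -
  have "(\<Sum>i<length Ks. (*\<^sub>R) (s i) ` ((Ks @ [L]) ! i)) = (\<Sum>i<length Ks. (*\<^sub>R) (s i) ` (Ks ! i))"
    by (intro sum.cong) (auto simp: nth_append)
  then show ?thesis by (simp add: minkowski_comb_def)
qed

lemma msum_0:
  assumes "\<And>l. G l \<noteq> {}"
  shows "msum G 0 = {0}"
proof -
  have "\<forall>l. \<exists>g. g \<in> G l" using assms by blast
  then obtain g where "\<And>l. g l \<in> G l" by metis
  then have "0 \<in> msum G 0" by (intro msumI[of g]) auto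
  moreover have "msum G 0 \<subseteq> {0}" by (auto simp: msum_def)
  ultimately show ?thesis by blast
qed

lemma msum_axis:
  fixes G :: "'l::finite \<Rightarrow> 'a::euclidean_space set"
  assumes "\<And>l. G l \<noteq> {}"
  shows "msum G (axis l \<delta>) = (*\<^sub>R) \<delta> ` G l"
proof
  have sum_axis: "(\<Sum>l'\<in>UNIV. (axis l \<delta> $ l') *\<^sub>R g l') = \<delta> *\<^sub>R g l" for g :: "'l \<Rightarrow> 'a"
  proof -
    have "(axis l \<delta> $ l') *\<^sub>R g l' = (if l' = l then \<delta> *\<^sub>R g l else 0)" for l' by (simp add: axis_def)
    then show ?thesis by simp
  qed
  show "msum G (axis l \<delta>) \<subseteq> (*\<^sub>R) \<delta> ` G l"
    by (auto elim!: msumE simp: sum_axis)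
  have "\<forall>l. \<exists>g. g \<in> G l" using assms by blast
  then obtain g where g: "\<And>l. g l \<in> G l" by metis
  show "(*\<^sub>R) \<delta> ` G l \<subseteq> msum G (axis l \<delta>)"
  proof
    fix x assume "x \<in> (*\<^sub>R) \<delta> ` G l"
    then obtain y where y: "y \<in> G l" "x = \<delta> *\<^sub>R y" by blast
    then show "x \<in> msum G (axis l \<delta>)"
      by (intro msumI[of "g(l := y)"]) (use g in \<open>auto simp: sum_axis\<close>)
  qed
qed

text \<open>Since \<open>a L + b L = (a + b) L\<close> for convex \<open>L\<close> and nonnegative
  \<open>a\<close>, \<open>b\<close>, a repeated body enters only through the sum of its
  coefficients.\<close>

definition label_sum :: "'l list \<Rightarrow> (nat \<Rightarrow> real) \<Rightarrow> 'l \<Rightarrow> real" where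
  "label_sum ls s l = (\<Sum>i\<in>{i. i < length ls \<and> ls ! i = l}. s i)"

lemma label_sum_nonneg: "(\<And>i. 0 \<le> s i) \<Longrightarrow> 0 \<le> label_sum ls s l"
  by (simp add: label_sum_def sum_nonneg)

lemma label_sum_snoc:
  "label_sum (ls @ [x]) s l = label_sum ls s l + (if x = l then s (length ls) else 0)"
proof -
  have "{i. i < length (ls @ [x]) \<and> (ls @ [x]) ! i = l}
      = {i. i < length ls \<and> ls ! i = l} \<union> (if x = l then {length ls} else {})"
    by (auto simp: nth_append less_Suc_eq)
  then show ?thesis unfolding label_sum_def
    by (simp add: sum.union_disjoint)
qed

lemma minkowski_comb_labels:
  fixes G :: "'l::finite \<Rightarrow> 'a::euclidean_space set"
  assumes G: "\<And>l. convex (G l)" "\<And>l. G l \<noteq> {}" and s: "\<And>i. 0 \<le> s i"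
  shows "minkowski_comb (map G ls) s = msum G (\<chi> l. label_sum ls s l)"
proof (induction ls rule: rev_induct)
  case Nil
  have "(\<chi> l. label_sum [] s l) = (0 :: real ^ 'l)" by (simp add: label_sum_def vec_eq_iff)
  then show ?case using msum_0[of G] G(2) by (simp add: minkowski_comb_def)
next
  case (snoc x ls)
  have "(\<chi> l. label_sum (ls @ [x]) s l) = (\<chi> l. label_sum ls s l) + axis x (s (length ls))"
    by (auto simp: vec_eq_iff label_sum_snoc axis_def)
  also have "msum G \<dots> = {a + b | a b. a \<in> msum G (\<chi> l. label_sum ls s l) \<and> b \<in> msum G (axis x (s (length ls)))}"
    by (rule msum_add[OF G(1)]) (use s label_sum_nonneg[OF s] in \<open>auto simp: axis_def\<close>)
  also have "\<dots> = msum G (\<chi> l. label_sum ls s l) + (*\<^sub>R) (s (length ls)) ` G x"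
    unfolding msum_axis[of G, OF G(2)] by (auto simp: set_plus_def)
  finally show ?case using snoc by (simp add: minkowski_comb_snoc)
qed

text \<open>The falling factorial. As a real product it vanishes for \<open>m > a\<close>, so the
  truncated subtraction in exponents \<open>a - m\<close> does no harm.\<close>

definition falling :: "nat \<Rightarrow> nat \<Rightarrow> real" where
  "falling a m = (\<Prod>j<m. real a - real j)"

lemma falling_Suc: "falling a (Suc m) = falling a m * real (a - m)"
proof (cases "m \<le> a")
  case False
  then have "falling a m = 0" unfolding falling_def by (intro prod_zero) auto
  then show ?thesis by (simp add: falling_def)
qed (simp add: falling_def of_nat_diff)

lemma falling_0 [simp]: "falling a 0 = 1"
  by (simp add: falling_def)

text \<open>At the origin a power survives only if it has been differentiated exactly as often as
  its degree; \<open>0 ^ 0 = 1\<close> enters here.\<close>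

lemma falling_power_0: "falling a m * 0 ^ (a - m) = (if a = m then fact m else 0)"
proof -
  consider "a < m" | "a = m" | "a > m" by linarith
  then show ?thesis
  proof cases
    case 1
    then have "falling a m = 0" unfolding falling_def by (intro prod_zero) auto
    then show ?thesis using 1 by simp
  next
    case 2
    have "falling m m = (\<Prod>j<m. real (m - j))" unfolding falling_def by (intro prod.cong) (auto simp: of_nat_diff)
    also have "\<dots> = fact m" by (simp add: fact_prod_rev atLeast0LessThan)
    finally show ?thesis using 2 by simp
  qed simp
qed

text \<open>The fold differentiates in the last positions first, so at stage \<open>k\<close> label
  \<open>l\<close> has been hit \<open>count_list (drop k ls) l\<close> times. The formula is
  carried along for all nonnegative \<open>s\<close>, since the next one-sided derivative needs it
  beside the point.\<close>

lemma foldr_orthant_partial: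
  fixes c :: "('l::finite \<Rightarrow> nat) \<Rightarrow> real" and ls :: "'l list"
  assumes "finite I"
    and F: "\<And>s. (\<And>i. 0 \<le> s i) \<Longrightarrow> F s = (\<Sum>d\<in>I. c d * (\<Prod>l\<in>UNIV. label_sum ls s l ^ d l))"
    and k: "k \<le> length ls" and s: "\<And>i. 0 \<le> s i"
  shows "foldr orthant_partial [k..<length ls] F s =
    (\<Sum>d\<in>I. c d * (\<Prod>l\<in>UNIV. falling (d l) (count_list (drop k ls) l) * label_sum ls s l ^ (d l - count_list (drop k ls) l)))"
  using k s
proof (induction k arbitrary: s rule: inc_induct)
  case base
  then show ?case using F[of s] by simp
next
  case (step k)
  let ?G = "foldr orthant_partial [Suc k..<length ls] F"
  let ?m = "\<lambda>l. count_list (drop (Suc k) ls) l"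
  let ?x = "ls ! k"
  have cnt: "count_list (drop k ls) l = (if l = ?x then Suc (?m l) else ?m l)" for l
    using step.hyps by (simp add: Cons_nth_drop_Suc[symmetric])
  have ls_upd: "label_sum ls (s(k := h)) l = label_sum ls s l + (if l = ?x then h - s k else 0)" for h l
  proof -
    let ?A = "{i. i < length ls \<and> ls ! i = l}"
    have "(\<Sum>i\<in>?A. (s(k := h)) i) = (\<Sum>i\<in>?A. s i + (if i = k then h - s k else 0))"
      by (rule sum.cong) auto
    also have "\<dots> = (\<Sum>i\<in>?A. s i) + (if k \<in> ?A then h - s k else 0)" by (simp add: sum.distrib)
    finally show ?thesis using step.hyps by (auto simp: label_sum_def)
  qed
  \<comment> \<open>All factors of the monomial \<open>d\<close> that do not involve the coefficient
    at position \<open>k\<close>.\<close>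
  define P where "P d = c d * (\<Prod>l\<in>UNIV - {?x}. falling (d l) (?m l) * label_sum ls s l ^ (d l - ?m l)) * falling (d ?x) (?m ?x)" for d
  have G: "?G (s(k := h)) = (\<Sum>d\<in>I. P d * (label_sum ls s ?x + (h - s k)) ^ (d ?x - ?m ?x))" if "h \<ge> 0" for h
  proof -
    have "(\<Prod>l\<in>UNIV. falling (d l) (?m l) * label_sum ls (s(k := h)) l ^ (d l - ?m l))
       = (falling (d ?x) (?m ?x) * (label_sum ls s ?x + (h - s k)) ^ (d ?x - ?m ?x))
        * (\<Prod>l\<in>UNIV - {?x}. falling (d l) (?m l) * label_sum ls s l ^ (d l - ?m l))" for d
    proof -
      have "(\<Prod>l\<in>UNIV - {?x}. falling (d l) (?m l) * label_sum ls (s(k := h)) l ^ (d l - ?m l))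
          = (\<Prod>l\<in>UNIV - {?x}. falling (d l) (?m l) * label_sum ls s l ^ (d l - ?m l))"
        by (rule prod.cong) (auto simp: ls_upd)
      then show ?thesis by (subst prod.remove[of _ ?x]) (auto simp: ls_upd)
    qed
    moreover have "?G (s(k := h)) = (\<Sum>d\<in>I. c d * (\<Prod>l\<in>UNIV. falling (d l) (?m l) * label_sum ls (s(k := h)) l ^ (d l - ?m l)))"
      by (rule step.IH) (use step.prems that in auto)
    ultimately show ?thesis by (simp add: P_def mult_ac)
  qed
  have "((\<lambda>h. \<Sum>d\<in>I. P d * (label_sum ls s ?x + (h - s k)) ^ (d ?x - ?m ?x)) has_vector_derivative
      (\<Sum>d\<in>I. P d * (real (d ?x - ?m ?x) * label_sum ls s ?x ^ (d ?x - ?m ?x - 1)))) (at (s k) within {0..})"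
    unfolding has_real_derivative_iff_has_vector_derivative[symmetric]
    by (auto intro!: derivative_eq_intros sum.cong)
  then have "((\<lambda>h. ?G (s(k := h))) has_vector_derivative
      (\<Sum>d\<in>I. P d * (real (d ?x - ?m ?x) * label_sum ls s ?x ^ (d ?x - ?m ?x - 1)))) (at (s k) within {0..})"
    by (rule has_vector_derivative_transform[rotated 2]) (use step.prems G in auto)
  \<comment> \<open>\<open>s k\<close> is not isolated in \<open>{0..}\<close>, so the one-sided
    derivative is unique.\<close>
  moreover have "at (s k) within {0..} \<noteq> bot"
  proof -
    have "at_right (s k) \<le> at (s k) within {0..}"
      using step.prems[of k] by (intro at_le) (auto intro: less_imp_le order.strict_trans1)
    then show ?thesis using trivial_limit_at_right_real[of "s k"] by (metis bot.extremum_uniqueI)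
  qed
  ultimately have "orthant_partial k ?G s = (\<Sum>d\<in>I. P d * (real (d ?x - ?m ?x) * label_sum ls s ?x ^ (d ?x - ?m ?x - 1)))"
    unfolding orthant_partial_def by (intro vector_derivative_within)
  also have "\<dots> = (\<Sum>d\<in>I. c d * (\<Prod>l\<in>UNIV. falling (d l) (count_list (drop k ls) l) * label_sum ls s l ^ (d l - count_list (drop k ls) l)))"
  proof (rule sum.cong[OF refl])
    fix d
    have "(\<Prod>l\<in>UNIV - {?x}. falling (d l) (count_list (drop k ls) l) * label_sum ls s l ^ (d l - count_list (drop k ls) l))
        = (\<Prod>l\<in>UNIV - {?x}. falling (d l) (?m l) * label_sum ls s l ^ (d l - ?m l))"
      by (rule prod.cong) (auto simp: cnt)
    then have "(\<Prod>l\<in>UNIV. falling (d l) (count_list (drop k ls) l) * label_sum ls s l ^ (d l - count_list (drop k ls) l))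
        = (falling (d ?x) (Suc (?m ?x)) * label_sum ls s ?x ^ (d ?x - Suc (?m ?x)))
          * (\<Prod>l\<in>UNIV - {?x}. falling (d l) (?m l) * label_sum ls s l ^ (d l - ?m l))"
      by (subst prod.remove[of _ ?x]) (auto simp: cnt)
    then show "P d * (real (d ?x - ?m ?x) * label_sum ls s ?x ^ (d ?x - ?m ?x - 1))
        = c d * (\<Prod>l\<in>UNIV. falling (d l) (count_list (drop k ls) l) * label_sum ls s l ^ (d l - count_list (drop k ls) l))"
      by (simp add: P_def falling_Suc)
  qed
  finally show ?case using step.hyps by (simp add: upt_conv_Cons)
qed

text \<open>After the differentiations only the monomial with exponents \<open>count_list ls\<close>
  survives at the origin.\<close>

lemma mixed_volume_labels:
  fixes G :: "'l::finite \<Rightarrow> 'a::euclidean_space set"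
  assumes G: "\<And>l. convex (G l)" "\<And>l. G l \<noteq> {}" and "finite I"
    and c: "\<And>t. (\<forall>l. t $ l \<ge> 0) \<Longrightarrow> measure lebesgue (msum G t) = (\<Sum>d\<in>I. c d * (\<Prod>l\<in>UNIV. (t $ l) ^ d l))"
    and d: "count_list ls \<in> I"
  shows "mixed_volume (map G ls) = c (count_list ls) * (\<Prod>l\<in>UNIV. fact (count_list ls l)) / fact (length ls)"
proof -
  let ?F = "\<lambda>s. measure lebesgue (minkowski_comb (map G ls) s)"
  have F: "?F s = (\<Sum>d\<in>I. c d * (\<Prod>l\<in>UNIV. label_sum ls s l ^ d l))" if "\<And>i. 0 \<le> s i" for s
  proof -
    have nn: "0 \<le> label_sum ls s l" for l by (rule label_sum_nonneg) (rule that)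
    have "?F s = measure lebesgue (msum G (\<chi> l. label_sum ls s l))"
      by (subst minkowski_comb_labels) (use G that in auto)
    also have "\<dots> = (\<Sum>d\<in>I. c d * (\<Prod>l\<in>UNIV. ((\<chi> l. label_sum ls s l) $ l) ^ d l))" by (rule c) (simp add: nn)
    finally show ?thesis by simp
  qed
  have "foldr orthant_partial [0..<length ls] ?F (\<lambda>_. 0) =
    (\<Sum>d\<in>I. c d * (\<Prod>l\<in>UNIV. falling (d l) (count_list ls l) * 0 ^ (d l - count_list ls l)))"
    by (subst foldr_orthant_partial[OF \<open>finite I\<close> F]) (auto simp: label_sum_def)
  also have "\<dots> = (\<Sum>d\<in>I. if d = count_list ls then c d * (\<Prod>l\<in>UNIV. fact (count_list ls l)) else 0)"
  proof (rule sum.cong[OF refl])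
    fix d
    show "c d * (\<Prod>l\<in>UNIV. falling (d l) (count_list ls l) * 0 ^ (d l - count_list ls l))
      = (if d = count_list ls then c d * (\<Prod>l\<in>UNIV. fact (count_list ls l)) else 0)"
    proof (cases "d = count_list ls")
      case False
      then obtain l where "d l \<noteq> count_list ls l" by blast
      then have "(\<Prod>l\<in>UNIV. if d l = count_list ls l then fact (count_list ls l) else 0) = (0 :: real)"
        by (intro prod_zero) auto
      then show ?thesis using False unfolding falling_power_0 by simp
    next
      case True
      have "falling a a = fact a" for a using falling_power_0[of a a] by simp
      then show ?thesis using True by simp
    qed
  qed
  also have "\<dots> = c (count_list ls) * (\<Prod>l\<in>UNIV. fact (count_list ls l))" using d \<open>finite I\<close> by simp
  finally show ?thesis by (simp add: mixed_volume_def)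
qed

section \<open>The volume polynomial of the embedded bodies\<close>

text \<open>
  The indices \<open>0, 1, \<dots>, p\<close> correspond to \<^term>\<open>None\<close> and \<open>Some (factor 1), \<dots>, Some (factor p)\<close>.
\<close>

definition lab :: "nat \<Rightarrow> 'p::finite option" where
  "lab i = (if i = 0 then None else Some (factor i))"

definition unlab :: "'p::finite option \<Rightarrow> nat" where
  "unlab = the_inv_into {0..CARD('p)} lab"

lemma bij_betw_lab: "bij_betw lab {0..CARD('p)} (UNIV :: 'p::finite option set)"
proof -
  have "bij_betw lab {1..CARD('p)} (Some ` (UNIV :: 'p set))"
  proof -
    have "bij_betw (Some \<circ> factor) {1..CARD('p)} (Some ` (UNIV :: 'p set))"
      using bij_betw_factor by (rule bij_betw_trans) (simp add: bij_betw_def)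
    then show ?thesis by (rule bij_betw_cong[THEN iffD1, rotated]) (simp add: lab_def)
  qed
  moreover have "bij_betw lab {0} {None :: 'p option}" by (simp add: bij_betw_def lab_def)
  ultimately have "bij_betw lab ({0} \<union> {1..CARD('p)}) ({None} \<union> Some ` (UNIV :: 'p set))"
    by (intro bij_betw_combine) auto
  moreover have "{0} \<union> {1..CARD('p)} = {0..CARD('p)}" by auto
  moreover have "{None} \<union> Some ` UNIV = (UNIV :: 'p option set)" using UNIV_option_conv by auto
  ultimately show ?thesis by metis
qed

lemma unlab_lab: "i \<le> CARD('p) \<Longrightarrow> unlab (lab i :: 'p::finite option) = i"
  unfolding unlab_def using bij_betw_lab[where 'p='p] by (intro the_inv_into_f_f) (auto simp: bij_betw_def)

lemma lab_unlab: "lab (unlab l) = (l :: 'p::finite option)"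
  unfolding unlab_def using bij_betw_lab[where 'p='p] by (intro f_the_inv_into_f) (auto simp: bij_betw_def)

lemma unlab_le: "unlab (l :: 'p::finite option) \<le> CARD('p)"
  using the_inv_into_into[of lab "{0..CARD('p)}" l "{0..CARD('p)}"] bij_betw_lab[where 'p='p]
  by (auto simp: unlab_def bij_betw_def)

definition emb :: "'p::finite option \<Rightarrow> real ^ 'n \<Rightarrow> real ^ 'n ^ 'p" where
  "emb l x = (case l of None \<Rightarrow> - diag_embed x | Some a \<Rightarrow> axis a x)"

lemma linear_emb: "linear (emb l)"
  by (rule linearI) (auto simp: emb_def diag_embed_def axis_def vec_eq_iff split: option.splits)

abbreviation body :: "(real ^ 'n) set \<Rightarrow> 'p::finite option \<Rightarrow> (real ^ 'n ^ 'p) set" where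
  "body K l \<equiv> emb l ` K"

definition label_list :: "nat \<Rightarrow> (nat \<Rightarrow> nat) \<Rightarrow> 'p::finite option list" where
  "label_list n j = concat (map (\<lambda>i. replicate (n - j i) (lab i)) [0..<CARD('p) + 1])"

lemma count_list_concat_replicate:
  assumes "inj_on f {..<k}" "i < k"
  shows "count_list (concat (map (\<lambda>i. replicate (m i) (f i)) [0..<k])) (f i) = m i"
proof -
  have rep: "count_list (replicate a x) y = (if x = y then a else 0)" for a and x y :: 'a by (induction a) auto
  have "count_list (concat (map (\<lambda>i. replicate (m i) (f i)) [0..<k'])) (f i) = (if i < k' then m i else 0)" if "k' \<le> k" for k'
    using that
  proof (induction k')
    case (Suc k')
    then show ?case using assms inj_onD[OF assms(1), of k' i] by (auto simp: rep less_Suc_eq)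
  qed simp
  then show ?thesis using assms(2) by simp
qed

lemma count_label_list: "count_list (label_list n j :: 'p::finite option list) l = n - j (unlab l)"
proof -
  have "inj_on (lab :: nat \<Rightarrow> 'p option) {..<CARD('p) + 1}"
    using bij_betw_lab[where 'p='p] by (auto simp: bij_betw_def inj_on_def)
  from count_list_concat_replicate[OF this, of "unlab l" "\<lambda>i. n - j i"] show ?thesis
    using unlab_le[of l] by (simp add: label_list_def lab_unlab)
qed

lemma W_eq_mixed_volume:
  "W TYPE('p::finite) K j = mixed_volume (map (body K :: 'p option \<Rightarrow> (real ^ 'n ^ 'p) set) (label_list CARD('n) j))"
proof -
  have *: "map (body K :: 'p option \<Rightarrow> (real ^ 'n ^ 'p) set) (concat (map (\<lambda>i. replicate (CARD('n) - j i) (lab i)) xs))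
      = concat (map (\<lambda>i. replicate (CARD('n) - j i) (body K (lab i))) xs)" for xs
    by (simp add: map_concat comp_def)
  have 0: "body K (lab 0 :: 'p option) = uminus ` diag_embed ` K"
    by (simp add: lab_def emb_def image_image)
  have 1: "body K (lab i :: 'p option) = incl i ` K" if "i \<ge> 1" for i
    using that by (simp add: lab_def emb_def incl_def[abs_def])
  have "concat (map (\<lambda>i. replicate (CARD('n) - j i) (incl i ` K)) [1..<CARD('p) + 1])
      = concat (map (\<lambda>i. replicate (CARD('n) - j i) (body K (lab i :: 'p option))) [1..<CARD('p) + 1])"
  proof (intro arg_cong[of _ _ concat] map_cong refl)
    fix i assume "i \<in> set [1..<CARD('p) + 1]"
    then have "body K (lab i :: 'p option) = incl i ` K" by (intro 1) auto
    then show "replicate (CARD('n) - j i) (incl i ` K) = replicate (CARD('n) - j i) (body K (lab i :: 'p option))" by simp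
  qed
  moreover have "[0..<CARD('p) + 1] = 0 # [1..<CARD('p) + 1]" by (simp add: upt_conv_Cons del: upt_Suc)
  ultimately show ?thesis
    unfolding W_def label_list_def * by (simp only: list.map concat.simps 0)
qed

text \<open>The exponents \<open>n - j l\<close> add up to \<open>n * (p + 1) - n = n * p\<close>;
  conversely the cap \<open>n\<close> ensures that \<open>n - (n - d l)\<close> gives back
  \<open>d l\<close>.\<close>

lemma J_set_degrees:
  "bij_betw (\<lambda>j l. n - j (unlab l)) (J_set n CARD('p)) (degrees n (n * CARD('p)) :: ('p::finite option \<Rightarrow> nat) set)"
proof -
  have sum_lab: "(\<Sum>l\<in>(UNIV :: 'p option set). f (unlab l)) = (\<Sum>i=0..CARD('p). f i)" for f :: "nat \<Rightarrow> nat"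
    using sum.reindex_bij_betw[OF bij_betw_lab[where 'p='p], of "\<lambda>l. f (unlab l)"] by (simp add: unlab_lab)
  have le: "j i \<le> n" if "j \<in> J_set n CARD('p)" "i \<le> CARD('p)" for i j
    using that member_le_sum[of i "{0..CARD('p)}" j] by (auto simp: J_set_def)
  show ?thesis
  \<comment> \<open>The value \<open>undefined\<close> beyond the index range is forced by the
    extensionality of the members of \<open>J_set\<close>.\<close>
  proof (rule bij_betw_byWitness[where f' = "\<lambda>d i. if i \<le> CARD('p) then n - d (lab i) else undefined"])
    show "\<forall>j\<in>J_set n CARD('p). (\<lambda>i. if i \<le> CARD('p) then n - (n - j (unlab (lab i :: 'p option))) else undefined) = j"
    proof
      fix j assume j: "j \<in> J_set n CARD('p)"
      then show "(\<lambda>i. if i \<le> CARD('p) then n - (n - j (unlab (lab i :: 'p option))) else undefined) = j"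
        using le[OF j] by (auto simp: fun_eq_iff unlab_lab J_set_def PiE_def extensional_def)
    qed
    show "\<forall>d\<in>degrees n (n * CARD('p)). (\<lambda>l. n - (if unlab l \<le> CARD('p) then n - d (lab (unlab l :: nat) :: 'p option) else undefined)) = d"
      by (auto simp: fun_eq_iff unlab_le lab_unlab degrees_def)
    show "(\<lambda>j l. n - j (unlab l)) ` J_set n CARD('p) \<subseteq> (degrees n (n * CARD('p)) :: ('p option \<Rightarrow> nat) set)"
    proof (rule image_subsetI)
      fix j assume j: "j \<in> J_set n CARD('p)"
      have "(\<Sum>i=0..CARD('p). n - j i) = (\<Sum>i=0..CARD('p). n) - (\<Sum>i=0..CARD('p). j i)"
        by (rule sum_subtractf_nat) (use le[OF j] in auto)
      also have "\<dots> = n * CARD('p)" using j by (simp add: J_set_def)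
      finally show "(\<lambda>l. n - j (unlab l)) \<in> (degrees n (n * CARD('p)) :: ('p option \<Rightarrow> nat) set)"
        by (simp add: degrees_def sum_lab[of "\<lambda>i. n - j i"])
    qed
    show "(\<lambda>d i. if i \<le> CARD('p) then n - d (lab i) else undefined) ` (degrees n (n * CARD('p)) :: ('p option \<Rightarrow> nat) set) \<subseteq> J_set n CARD('p)"
    proof (rule image_subsetI)
      fix d :: "'p option \<Rightarrow> nat" assume d: "d \<in> degrees n (n * CARD('p))"
      have sd: "(\<Sum>i=0..CARD('p). d (lab i)) = n * CARD('p)"
        using sum_lab[of "\<lambda>i. d (lab i)"] d by (simp add: lab_unlab degrees_def)
      have "(\<Sum>i=0..CARD('p). n - d (lab i)) = (\<Sum>i=0..CARD('p). n) - (\<Sum>i=0..CARD('p). d (lab i))"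
        by (rule sum_subtractf_nat) (use d in \<open>auto simp: degrees_def\<close>)
      also have "\<dots> = n" by (simp add: sd)
      finally show "(\<lambda>i. if i \<le> CARD('p) then n - d (lab i) else undefined) \<in> J_set n CARD('p)"
        by (simp add: J_set_def PiE_def extensional_def)
    qed
  qed
qed

text \<open>By \<open>mixed_volume_labels\<close> each coefficient is a mixed volume times
  \<open>fact (n * p)\<close> over the factorials of its exponents, which is
  \<open>multinomial_coeff\<close>. The subspaces \<open>range (emb l)\<close> bound the exponents
  by \<open>n\<close>.\<close>

lemma measure_msum_body:
  fixes K :: "(real ^ 'n) set"
  assumes K: "convex_body K" and t: "\<And>l. t $ l \<ge> 0"
  shows "measure lebesgue (msum (body K :: 'p::finite option \<Rightarrow> (real ^ 'n ^ 'p) set) t)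
    = (\<Sum>j\<in>J_set CARD('n) CARD('p). multinomial_coeff CARD('n) CARD('p) j * W TYPE('p) K j * (\<Prod>i=0..CARD('p). (t $ lab i) ^ (CARD('n) - j i)))"
proof -
  let ?n = "CARD('n)" and ?p = "CARD('p)"
  let ?G = "body K :: 'p option \<Rightarrow> (real ^ 'n ^ 'p) set"
  have G: "convex (?G l)" "compact (?G l)" "?G l \<noteq> {}" for l
  proof -
    have bl: "bounded_linear (emb l :: real ^ 'n \<Rightarrow> real ^ 'n ^ 'p)" using linear_emb linear_conv_bounded_linear by blast
    show "convex (?G l)" using K by (intro convex_linear_image linear_emb) (simp add: convex_body_def)
    show "compact (?G l)" using K bl by (intro compact_continuous_image linear_continuous_on) (simp_all add: convex_body_def)
    show "?G l \<noteq> {}" using K by (simp add: convex_body_def)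
  qed
  have DIM: "DIM(real ^ 'n ^ 'p) = ?n * ?p" by simp
  have "\<exists>c. \<forall>t. (\<forall>l. t $ l \<ge> 0) \<longrightarrow>
    measure lebesgue (msum ?G t) = (\<Sum>d\<in>degrees ?n DIM(real ^ 'n ^ 'p). c d * (\<Prod>l\<in>UNIV. (t $ l) ^ d l))"
  proof (rule measure_msum_polynomial[where U = "\<lambda>l. range (emb l)"])
    fix l :: "'p option"
    show "subspace (range (emb l) :: (real ^ 'n ^ 'p) set)"
      by (intro linear_subspace_image linear_emb subspace_UNIV)
    show "dim (range (emb l) :: (real ^ 'n ^ 'p) set) \<le> ?n"
      using dim_image_le[OF linear_emb, of l "UNIV :: (real ^ 'n) set"] by simp
  qed (use G in auto)
  then obtain c where c: "\<And>t. (\<forall>l. t $ l \<ge> 0) \<Longrightarrow>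
      measure lebesgue (msum ?G t) = (\<Sum>d\<in>degrees ?n (?n * ?p). c d * (\<Prod>l\<in>UNIV. (t $ l) ^ d l))"
    unfolding DIM by blast
  have coef: "multinomial_coeff ?n ?p j * W TYPE('p) K j = c (\<lambda>l. ?n - j (unlab l))" if j: "j \<in> J_set ?n ?p" for j
  proof -
    let ?ls = "label_list ?n j :: 'p option list"
    have cnt: "count_list ?ls = (\<lambda>l. ?n - j (unlab l))" by (rule ext) (rule count_label_list)
    have inD: "count_list ?ls \<in> degrees ?n (?n * ?p)"
      unfolding cnt using bij_betw_apply[OF J_set_degrees j] .
    have len: "length ?ls = ?n * ?p"
      using sum_count_set[of ?ls UNIV] inD by (simp add: degrees_def)
    have "W TYPE('p) K j = c (count_list ?ls) * (\<Prod>l\<in>UNIV. fact (count_list ?ls l)) / fact (length ?ls)"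
      unfolding W_eq_mixed_volume by (rule mixed_volume_labels[OF G(1,3) finite_degrees _ inD]) (rule c)
    also have "(\<Prod>l\<in>UNIV. fact (count_list ?ls l)) = (\<Prod>i=0..?p. fact (?n - j i) :: real)"
      using prod.reindex_bij_betw[OF bij_betw_lab[where 'p='p], of "\<lambda>l. fact (?n - j (unlab l)) :: real"]
      by (simp add: cnt unlab_lab)
    finally show ?thesis
      unfolding multinomial_coeff_def len cnt by (simp add: prod_zero_iff)
  qed
  have "measure lebesgue (msum ?G t) = (\<Sum>d\<in>degrees ?n (?n * ?p). c d * (\<Prod>l\<in>UNIV. (t $ l) ^ d l))"
    using c t by blast
  also have "\<dots> = (\<Sum>j\<in>J_set ?n ?p. c (\<lambda>l. ?n - j (unlab l)) * (\<Prod>l\<in>UNIV. (t $ l) ^ (?n - j (unlab (l :: 'p option)))))"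
    by (rule sum.reindex_bij_betw[OF J_set_degrees, symmetric])
  also have "\<dots> = (\<Sum>j\<in>J_set ?n ?p. multinomial_coeff ?n ?p j * W TYPE('p) K j * (\<Prod>i=0..?p. (t $ lab i) ^ (?n - j i)))"
  proof (rule sum.cong[OF refl])
    fix j assume j: "j \<in> J_set ?n ?p"
    have "(\<Prod>l\<in>UNIV. (t $ l) ^ (?n - j (unlab (l :: 'p option)))) = (\<Prod>i=0..?p. (t $ lab i) ^ (?n - j i))"
      using prod.reindex_bij_betw[OF bij_betw_lab[where 'p='p], of "\<lambda>l. (t $ l) ^ (?n - j (unlab l))"]
      by (simp add: unlab_lab)
    then show "c (\<lambda>l. ?n - j (unlab l)) * (\<Prod>l\<in>UNIV. (t $ l) ^ (?n - j (unlab (l :: 'p option))))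
        = multinomial_coeff ?n ?p j * W TYPE('p) K j * (\<Prod>i=0..?p. (t $ lab i) ^ (?n - j i))"
      using coef[OF j] by simp
  qed
  finally show ?thesis .
qed

text \<open>With \<open>u = (1 - s) * m\<close> the weight in \<open>q\<close> is the density
  \<open>n * u ^ (n - 1)\<close> in the variable \<open>u\<close>, and its products are the
  monomials of the volume at \<open>t - u\<close>.\<close>

lemma sum_q_W_has_integral:
  fixes K :: "(real ^ 'n) set"
  assumes K: "convex_body K" and t: "t \<in> Theta CARD('p::finite)"
  defines "m \<equiv> t_min CARD('p) t"
  shows "((\<lambda>s. real CARD('n) * m ^ CARD('n) * (1 - s) ^ (CARD('n) - 1)
      * measure lebesgue (msum (body K :: 'p option \<Rightarrow> (real ^ 'n ^ 'p) set) (\<chi> l. t (unlab l) - (1 - s) * m)))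
    has_integral (\<Sum>j\<in>J_set CARD('n) CARD('p). q CARD('n) CARD('p) j t * W TYPE('p) K j)) {0..1}"
proof -
  let ?n = "CARD('n)" and ?p = "CARD('p)"
  have m0: "0 \<le> m" unfolding m_def t_min_def using t by (intro Min.boundedI) (auto simp: Theta_def)
  have mt: "m \<le> t i" if "i \<le> ?p" for i unfolding m_def t_min_def using that by (intro Min_le) auto
  have summand: "((\<lambda>s. real ?n * m ^ ?n * (1 - s) ^ (?n - 1) * (multinomial_coeff ?n ?p j * W TYPE('p) K j
        * (\<Prod>i=0..?p. (t i - (1 - s) * m) ^ (?n - j i))))
      has_integral q ?n ?p j t * W TYPE('p) K j) {0..1}" for j
  proof -
    have "continuous_on {0..1} (\<lambda>s. (1 - s) ^ (?n - 1) * (\<Prod>i=0..?p. (t i - (1 - s) * m) ^ (?n - j i)))"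
      by (intro continuous_intros)
    then have "((\<lambda>s. (1 - s) ^ (?n - 1) * (\<Prod>i=0..?p. (t i - (1 - s) * m) ^ (?n - j i)))
      has_integral integral {0..1} (\<lambda>s. (1 - s) ^ (?n - 1) * (\<Prod>i=0..?p. (t i - (1 - s) * m) ^ (?n - j i)))) {0..1}"
      by (intro integrable_integral integrable_continuous_interval)
    from has_integral_mult_right[OF this, of "real ?n * m ^ ?n * multinomial_coeff ?n ?p j * W TYPE('p) K j"]
    show ?thesis unfolding q_def m_def[symmetric] by (simp add: mult_ac)
  qed
  have "((\<lambda>s. \<Sum>j\<in>J_set ?n ?p. real ?n * m ^ ?n * (1 - s) ^ (?n - 1) * (multinomial_coeff ?n ?p j * W TYPE('p) K j
        * (\<Prod>i=0..?p. (t i - (1 - s) * m) ^ (?n - j i))))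
      has_integral (\<Sum>j\<in>J_set ?n ?p. q ?n ?p j t * W TYPE('p) K j)) {0..1}"
    by (rule has_integral_sum[OF finite_J_set summand])
  then show ?thesis
  proof (rule has_integral_eq[rotated])
    fix s :: real assume s: "s \<in> {0..1}"
    \<comment> \<open>As \<open>m\<close> is the least coordinate, the coefficients stay in the
      closed orthant, where the volume is the polynomial.\<close>
    have nn: "(1 - s) * m \<le> t i" if "i \<le> ?p" for i
      using mult_left_le_one_le[of m "1 - s"] m0 s mt[OF that] by auto
    have lu: "t (unlab (lab i :: 'p option)) = t i" if "i \<in> {0..?p}" for i using that by (simp add: unlab_lab)
    have "measure lebesgue (msum (body K :: 'p option \<Rightarrow> (real ^ 'n ^ 'p) set) (\<chi> l. t (unlab l) - (1 - s) * m))
        = (\<Sum>j\<in>J_set ?n ?p. multinomial_coeff ?n ?p j * W TYPE('p) K j * (\<Prod>i=0..?p. (t i - (1 - s) * m) ^ (?n - j i)))"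
    proof -
      have "0 \<le> (\<chi> l :: 'p option. t (unlab l) - (1 - s) * m) $ l" for l
        using nn[OF unlab_le] by simp
      from measure_msum_body[OF K this] show ?thesis
        by (simp only:) (intro sum.cong prod.cong refl arg_cong2[where f = "(*)"], simp add: lu)
    qed
    then show "(\<Sum>j\<in>J_set ?n ?p. real ?n * m ^ ?n * (1 - s) ^ (?n - 1) * (multinomial_coeff ?n ?p j * W TYPE('p) K j
        * (\<Prod>i=0..?p. (t i - (1 - s) * m) ^ (?n - j i))))
      = real ?n * m ^ ?n * (1 - s) ^ (?n - 1)
        * measure lebesgue (msum (body K :: 'p option \<Rightarrow> (real ^ 'n ^ 'p) set) (\<chi> l. t (unlab l) - (1 - s) * m))"
      by (simp add: sum_distrib_left)
  qed
qed

section \<open>The inequality\<close>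

lemma measurable_vec_lambda:
  "(\<lambda>f. \<chi> a. f a) \<in> borel_measurable (\<Pi>\<^sub>M a\<in>(UNIV :: 'p::finite set). (lborel :: 'a::euclidean_space measure))"
proof (rule borel_measurable_euclidean_space[THEN iffD2], intro ballI)
  fix i :: "'a ^ 'p" assume "i \<in> Basis"
  then obtain a u where i: "i = axis a u" "u \<in> Basis" by (auto simp: Basis_vec_def)
  show "(\<lambda>f. (\<chi> a. f a) \<bullet> i) \<in> borel_measurable (\<Pi>\<^sub>M a\<in>(UNIV :: 'p set). (lborel :: 'a measure))"
    unfolding i(1) inner_axis by simp
qed

text \<open>Lebesgue measure is determined by the volumes of boxes, and a box in the power is a
  product of boxes.\<close>

lemma lborel_vec_eq_distr_PiM:
  "(lborel :: (('a::euclidean_space) ^ 'p::finite) measure) = distr (\<Pi>\<^sub>M a\<in>UNIV. lborel) borel (\<lambda>f. \<chi> a. f a)"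
proof (rule lborel_eqI)
  interpret product_sigma_finite "\<lambda>_ :: 'p. lborel :: 'a measure" by standard
  have meas: "(\<lambda>f. \<chi> a. f a) \<in> borel_measurable (\<Pi>\<^sub>M a\<in>(UNIV :: 'p set). (lborel :: 'a measure))"
    by (rule measurable_vec_lambda)
  fix l u :: "'a ^ 'p" assume le: "\<And>b. b \<in> Basis \<Longrightarrow> l \<bullet> b \<le> u \<bullet> b"
  have le': "l $ a \<bullet> b \<le> u $ a \<bullet> b" if "b \<in> Basis" for a b
    using le[of "axis a b"] that by (auto simp: inner_axis Basis_vec_def)
  have "(\<lambda>f. \<chi> a. f a) -` box l u \<inter> space (\<Pi>\<^sub>M a\<in>(UNIV :: 'p set). (lborel :: 'a measure)) = Pi\<^sub>E UNIV (\<lambda>a. box (l $ a) (u $ a))"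
    by (auto simp: space_PiM box_def Basis_vec_def inner_axis PiE_def)
  then have "emeasure (distr (\<Pi>\<^sub>M a\<in>UNIV. lborel) borel (\<lambda>f. \<chi> a. f a)) (box l u)
      = emeasure (\<Pi>\<^sub>M a\<in>(UNIV :: 'p set). (lborel :: 'a measure)) (Pi\<^sub>E UNIV (\<lambda>a. box (l $ a) (u $ a)))"
    by (subst emeasure_distr[OF meas]) simp_all
  also have "\<dots> = (\<Prod>a\<in>UNIV. emeasure lborel (box (l $ a) (u $ a)))"
    by (rule emeasure_PiM) auto
  also have "\<dots> = (\<Prod>a\<in>UNIV. ennreal (\<Prod>b\<in>Basis. (u $ a - l $ a) \<bullet> b))"
    by (intro prod.cong refl emeasure_lborel_box le')
  also have "\<dots> = ennreal (\<Prod>a\<in>UNIV. \<Prod>b\<in>Basis. (u $ a - l $ a) \<bullet> b)"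
    by (rule prod_ennreal) (auto intro!: prod_nonneg simp: inner_diff_left le')
  also have "(\<Prod>a\<in>(UNIV :: 'p set). \<Prod>b\<in>Basis. (u $ a - l $ a) \<bullet> b) = (\<Prod>b\<in>Basis. (u - l) \<bullet> b)"
  proof -
    have "(\<Prod>b\<in>Basis. (u - l) \<bullet> b) = (\<Prod>a\<in>(UNIV :: 'p set). \<Prod>b\<in>(\<lambda>b. axis a b) ` Basis. (u - l) \<bullet> b)"
    proof -
      have B: "(Basis :: ('a ^ 'p) set) = (\<Union>a\<in>UNIV. (\<lambda>b. axis a b) ` Basis)" by (auto simp: Basis_vec_def)
      show ?thesis unfolding B
        by (rule prod.UNION_disjoint) (auto simp: axis_eq_axis)
    qed
    also have "\<dots> = (\<Prod>a\<in>(UNIV :: 'p set). \<Prod>b\<in>Basis. (u $ a - l $ a) \<bullet> b)"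
      by (intro prod.cong refl) (simp add: prod.reindex inj_on_def axis_eq_axis inner_axis)
    finally show ?thesis ..
  qed
  finally show "emeasure (distr (\<Pi>\<^sub>M a\<in>UNIV. lborel) borel (\<lambda>f. \<chi> a. f a)) (box l u) = (\<Prod>b\<in>Basis. (u - l) \<bullet> b)" .
qed simp

lemma emeasure_lborel_vec_product:
  fixes A :: "'p::finite \<Rightarrow> 'a::euclidean_space set"
  assumes "\<And>a. A a \<in> sets borel"
  shows "emeasure lborel {x :: 'a ^ 'p. \<forall>a. x $ a \<in> A a} = (\<Prod>a\<in>UNIV. emeasure lborel (A a))"
proof -
  interpret product_sigma_finite "\<lambda>_ :: 'p. lborel :: 'a measure" by standard
  have meas: "(\<lambda>f. \<chi> a. f a) \<in> borel_measurable (\<Pi>\<^sub>M a\<in>(UNIV :: 'p set). (lborel :: 'a measure))"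
    by (rule measurable_vec_lambda)
  have "{x :: 'a ^ 'p. \<forall>a. x $ a \<in> A a} = (\<Inter>a. (\<lambda>x. x $ a) -` A a)" by auto
  moreover have "(\<lambda>x :: 'a ^ 'p. x $ a) -` A a \<in> sets borel" for a
  proof -
    have "(\<lambda>x :: 'a ^ 'p. x $ a) \<in> borel_measurable borel"
      by (intro borel_measurable_continuous_onI continuous_intros)
    from measurable_sets[OF this assms] show ?thesis by simp
  qed
  ultimately have S: "{x :: 'a ^ 'p. \<forall>a. x $ a \<in> A a} \<in> sets borel" by (auto intro!: sets.countable_INT)
  have "(\<lambda>f. \<chi> a. f a) -` {x :: 'a ^ 'p. \<forall>a. x $ a \<in> A a} \<inter> space (\<Pi>\<^sub>M a\<in>(UNIV :: 'p set). (lborel :: 'a measure)) = Pi\<^sub>E UNIV A"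
    by (auto simp: space_PiM PiE_def)
  then show ?thesis
    unfolding lborel_vec_eq_distr_PiM using assms by (subst emeasure_distr[OF meas S]) (simp add: emeasure_PiM)
qed

section \<open>The intersections and their total volume\<close>

definition shift :: "'a::zero ^ 'p::finite \<Rightarrow> 'p option \<Rightarrow> 'a" where
  "shift x l = (case l of None \<Rightarrow> 0 | Some a \<Rightarrow> x $ a)"

text \<open>The body \<open>C(x)\<close> of the introduction, with \<open>x\<^sub>0 = 0\<close>.\<close>

definition common_part :: "(real ^ 'n) set \<Rightarrow> real ^ ('p::finite option) \<Rightarrow> real ^ 'n ^ 'p \<Rightarrow> (real ^ 'n) set" where
  "common_part K t x = {z. \<forall>l. z + shift x l \<in> (*\<^sub>R) (t $ l) ` K}"

lemma forall_option: "(\<forall>l. P l) \<longleftrightarrow> P None \<and> (\<forall>a. P (Some a))"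
  by (metis option.exhaust)

lemma sum_emb_nth:
  "(\<Sum>l\<in>UNIV. (t $ l) *\<^sub>R emb l (g l)) $ a = (t $ Some a) *\<^sub>R g (Some a) - (t $ None) *\<^sub>R g None"
  for g :: "'p::finite option \<Rightarrow> real ^ 'n"
proof -
  have "(\<Sum>l\<in>UNIV. (t $ l) *\<^sub>R emb l (g l)) $ a = (\<Sum>l\<in>UNIV. (t $ l) *\<^sub>R (emb l (g l) $ a))" by simp
  also have "\<dots> = (t $ None) *\<^sub>R (emb None (g None) $ a) + (\<Sum>b\<in>UNIV. (t $ Some b) *\<^sub>R (emb (Some b) (g (Some b)) $ a))"
    by (simp add: UNIV_option_conv sum.reindex)
  also have "(\<Sum>b\<in>UNIV. (t $ Some b) *\<^sub>R (emb (Some b) (g (Some b)) $ a)) = (\<Sum>b\<in>UNIV. if b = a then (t $ Some a) *\<^sub>R g (Some a) else 0)"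
    by (intro sum.cong) (auto simp: emb_def axis_def)
  finally show ?thesis by (simp add: emb_def diag_embed_def)
qed

text \<open>A point of the sum has components \<open>x_a = t_a k_a - t_0 k_0\<close>, so
  \<open>z = t_0 k_0\<close> is common to all translates; conversely a common point provides all the
  \<open>k_l\<close>.\<close>

lemma msum_body_iff:
  fixes K :: "(real ^ 'n) set" and t :: "real ^ ('p::finite option)"
  shows "x \<in> msum (body K) t \<longleftrightarrow> common_part K t x \<noteq> {}"
proof
  assume "x \<in> msum (body K) t"
  then obtain g where g: "\<And>l. g l \<in> body K l" "x = (\<Sum>l\<in>UNIV. (t $ l) *\<^sub>R g l)" by (rule msumE) blast
  then have "\<forall>l. \<exists>k\<in>K. g l = emb l k" by blast
  then obtain k where k: "\<And>l. k l \<in> K" "\<And>l. g l = emb l (k l)" by metis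
  have "x $ a = (t $ Some a) *\<^sub>R k (Some a) - (t $ None) *\<^sub>R k None" for a
    unfolding g(2) k(2) by (rule sum_emb_nth)
  then have "(t $ None) *\<^sub>R k None \<in> common_part K t x"
    using k(1) by (auto simp: common_part_def forall_option shift_def)
  then show "common_part K t x \<noteq> {}" by blast
next
  assume "common_part K t x \<noteq> {}"
  then obtain z where "z \<in> common_part K t x" by blast
  then have "\<forall>l. \<exists>k\<in>K. z + shift x l = (t $ l) *\<^sub>R k" unfolding common_part_def by blast
  then obtain k where k: "\<And>l. k l \<in> K" "\<And>l. z + shift x l = (t $ l) *\<^sub>R k l" by metis
  have "x = (\<Sum>l\<in>UNIV. (t $ l) *\<^sub>R emb l (k l))"
    unfolding vec_eq_iff[of x] sum_emb_nth using k(2)[of None] k(2)[of "Some _"]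
    by (auto simp: shift_def k(2)[symmetric])
  then show "x \<in> msum (body K) t" using k(1) by (intro msumI[of "\<lambda>l. emb l (k l)"]) auto
qed

text \<open>By convexity \<open>(t_l - u) K + u K\<close> lies in \<open>t_l K\<close>, so
  \<open>z\<close> can be thickened to \<open>z + u K\<close> in all translates at once.\<close>

lemma common_part_homothet:
  fixes K :: "(real ^ 'n) set" and t :: "real ^ ('p::finite option)"
  assumes "convex K" "0 \<le> u" "\<And>l. u \<le> t $ l" and z: "z \<in> common_part K (\<chi> l. t $ l - u) x"
  shows "(\<lambda>k. z + u *\<^sub>R k) ` K \<subseteq> common_part K t x"
proof (rule image_subsetI)
  fix k assume k: "k \<in> K"
  have "(z + u *\<^sub>R k) + shift x l \<in> (*\<^sub>R) (t $ l) ` K" for l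
  proof -
    obtain k' where k': "k' \<in> K" "z + shift x l = (t $ l - u) *\<^sub>R k'" using z by (auto simp: common_part_def)
    have eq: "(z + u *\<^sub>R k) + shift x l = (t $ l - u) *\<^sub>R k' + u *\<^sub>R k" using k'(2) by (simp add: algebra_simps)
    show ?thesis
    proof (cases "t $ l = 0")
      case True
      then have "u = 0" using assms(2) assms(3)[of l] by linarith
      then show ?thesis using eq True k' by auto
    next
      case False
      then have pos: "t $ l > 0" using assms(2) assms(3)[of l] by linarith
      let ?k = "((t $ l - u) / t $ l) *\<^sub>R k' + (u / t $ l) *\<^sub>R k"
      have "?k \<in> K" using assms(2) assms(3)[of l] pos
        by (intro convexD[OF assms(1) k'(1) k]) (auto simp: add_divide_distrib[symmetric])
      moreover have "(t $ l) *\<^sub>R ?k = (t $ l - u) *\<^sub>R k' + u *\<^sub>R k" using pos by (simp add: scaleR_add_right)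
      ultimately show ?thesis unfolding eq by (metis imageI)
    qed
  qed
  then show "z + u *\<^sub>R k \<in> common_part K t x" by (simp add: common_part_def)
qed

lemma emeasure_homothet:
  fixes K :: "'a::euclidean_space set"
  assumes "compact K" "r \<ge> 0"
  shows "emeasure lborel ((\<lambda>k. z + r *\<^sub>R k) ` K) = ennreal (r ^ DIM('a)) * emeasure lborel K"
proof -
  have "compact ((\<lambda>k. z + r *\<^sub>R k) ` K)" using assms(1) by (intro compact_continuous_image continuous_intros)
  then have "emeasure lborel ((\<lambda>k. z + r *\<^sub>R k) ` K) = emeasure lebesgue ((\<lambda>k. r *\<^sub>R k + z) ` K)"
    by (simp add: borel_compact add.commute)
  also have "\<dots> = ennreal (r ^ DIM('a)) * emeasure lebesgue K"
    using emeasure_lebesgue_affine[of r z K] assms(2) by (simp add: ennreal_power)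
  finally show ?thesis using assms(1) by (simp add: borel_compact)
qed

lemma continuous_on_shift: "continuous_on S (\<lambda>x. shift x l)"
  for S :: "('a::{zero,topological_space} ^ 'p::finite) set"
  by (cases l) (auto simp: shift_def intro!: continuous_intros)

lemma closed_common_part_pairs:
  fixes K :: "(real ^ 'n) set" and t :: "real ^ ('p::finite option)"
  assumes "compact K"
  shows "closed {(x :: real ^ 'n ^ 'p, z). z \<in> common_part K t x}"
proof -
  have "{(x, z). z \<in> common_part K t x} = (\<Inter>l. (\<lambda>w. snd w + shift (fst w) l) -` ((*\<^sub>R) (t $ l) ` K))"
    by (auto simp: common_part_def)
  moreover have "closed ((*\<^sub>R) (t $ l) ` K)" for l
    using assms by (intro compact_imp_closed compact_continuous_image continuous_intros)
  moreover have "continuous_on UNIV (\<lambda>w :: (real ^ 'n ^ 'p) \<times> (real ^ 'n). snd w + shift (fst w) l)" for l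
    by (intro continuous_on_add continuous_on_snd continuous_on_compose2[OF continuous_on_shift[of UNIV]] continuous_on_fst continuous_on_id) auto
  ultimately show ?thesis by (auto intro!: closed_INT closed_vimage)
qed

text \<open>Fubini: for fixed \<open>z\<close> in \<open>t_0 K\<close> the admissible
  \<open>x\<close> form the product of the sets \<open>t_a K - z\<close>, whose volume does not
  depend on \<open>z\<close>.\<close>

lemma nn_integral_common_part:
  fixes K :: "(real ^ 'n) set" and t :: "real ^ ('p::finite option)"
  assumes K: "compact K" and t: "\<And>l. 0 \<le> t $ l"
  shows "(\<integral>\<^sup>+x. emeasure lborel (common_part K t x) \<partial>lborel)
    = ennreal ((\<Prod>l\<in>UNIV. (t $ l) ^ CARD('n)) * measure lebesgue K ^ Suc CARD('p))"
proof -
  let ?M = "{(x :: real ^ 'n ^ 'p, z). z \<in> common_part K t x}"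
  let ?e = "emeasure lborel K"
  have e: "?e = ennreal (measure lebesgue K)"
    using emeasure_compact_finite[OF K] K
    by (simp add: borel_compact emeasure_eq_ennreal_measure less_top)
  have M: "?M \<in> sets (lborel \<Otimes>\<^sub>M lborel)"
    using closed_common_part_pairs[OF K, of t] unfolding lborel_prod by (simp add: borel_closed)
  have cT: "compact ((*\<^sub>R) (t $ l) ` K)" for l
    using K by (intro compact_continuous_image continuous_intros)
  have "(\<integral>\<^sup>+x. emeasure lborel (common_part K t x) \<partial>lborel) = emeasure (lborel \<Otimes>\<^sub>M lborel) ?M"
    by (subst lborel.emeasure_pair_measure_alt[OF M]) (auto intro!: nn_integral_cong arg_cong[of _ _ "emeasure lborel"])
  also have "\<dots> = (\<integral>\<^sup>+z. emeasure lborel ((\<lambda>x. (x, z)) -` ?M) \<partial>lborel)"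
    by (rule lborel_pair.emeasure_pair_measure_alt2[OF M])
  also have "\<dots> = (\<integral>\<^sup>+z. (\<Prod>a\<in>UNIV. ennreal ((t $ Some a) ^ CARD('n)) * ?e) * indicator ((*\<^sub>R) (t $ None) ` K) z \<partial>lborel)"
  proof (rule nn_integral_cong)
    fix z :: "real ^ 'n"
    have trans: "(\<lambda>v. z + v) -` ((*\<^sub>R) r ` K) = (\<lambda>k. - z + r *\<^sub>R k) ` K" for r :: real
    proof -
      have "z + v = r *\<^sub>R k \<longleftrightarrow> v = - z + r *\<^sub>R k" for v k by (metis add_minus_cancel minus_add_cancel)
      then show ?thesis by auto
    qed
    have "(\<lambda>x. (x, z)) -` ?M = (if z \<in> (*\<^sub>R) (t $ None) ` K then {x. \<forall>a. x $ a \<in> (\<lambda>k. - z + (t $ Some a) *\<^sub>R k) ` K} else {})"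
      unfolding trans[symmetric] by (auto simp: common_part_def forall_option shift_def)
    moreover have "emeasure lborel {x :: real ^ 'n ^ 'p. \<forall>a. x $ a \<in> (\<lambda>k. - z + (t $ Some a) *\<^sub>R k) ` K}
        = (\<Prod>a\<in>UNIV. ennreal ((t $ Some a) ^ CARD('n)) * ?e)"
    proof (subst emeasure_lborel_vec_product)
      show "(\<lambda>k. - z + (t $ Some a) *\<^sub>R k) ` K \<in> sets borel" for a
        using K by (intro borel_compact compact_continuous_image continuous_intros)
    qed (unfold emeasure_homothet[OF K t], simp)
    ultimately show "emeasure lborel ((\<lambda>x. (x, z)) -` ?M) = (\<Prod>a\<in>UNIV. ennreal ((t $ Some a) ^ CARD('n)) * ?e) * indicator ((*\<^sub>R) (t $ None) ` K) z"
      by (auto simp: indicator_def)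
  qed
  also have "\<dots> = (\<Prod>a\<in>UNIV. ennreal ((t $ Some a) ^ CARD('n)) * ?e) * emeasure lborel ((*\<^sub>R) (t $ None) ` K)"
    by (rule nn_integral_cmult_indicator) (simp add: cT borel_compact)
  also have "emeasure lborel ((*\<^sub>R) (t $ None) ` K) = ennreal ((t $ None) ^ CARD('n)) * ?e"
    using emeasure_homothet[OF K t[of None], of 0] by simp
  also have "(\<Prod>a\<in>UNIV. ennreal ((t $ Some a) ^ CARD('n)) * ?e) = ennreal (\<Prod>a\<in>(UNIV :: 'p set). (t $ Some a) ^ CARD('n) * measure lebesgue K)"
    unfolding e using t by (simp add: ennreal_mult[symmetric] prod_ennreal)
  also have "\<dots> * (ennreal ((t $ None) ^ CARD('n)) * ?e) = ennreal ((\<Prod>a\<in>(UNIV :: 'p set). (t $ Some a) ^ CARD('n) * measure lebesgue K) * ((t $ None) ^ CARD('n) * measure lebesgue K))"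
    unfolding e using t by (simp add: ennreal_mult[symmetric] prod_nonneg)
  also have "(\<Prod>a\<in>(UNIV :: 'p set). (t $ Some a) ^ CARD('n) * measure lebesgue K) * ((t $ None) ^ CARD('n) * measure lebesgue K)
      = (\<Prod>l\<in>UNIV. (t $ l) ^ CARD('n)) * measure lebesgue K ^ Suc CARD('p)"
    by (simp add: UNIV_option_conv prod.reindex prod.distrib)
  finally show ?thesis .
qed

section \<open>Depth of a point and the integral inequality\<close>

abbreviation slab :: "(real ^ 'n) set \<Rightarrow> real ^ ('p::finite option) \<Rightarrow> real \<Rightarrow> real \<Rightarrow> (real ^ 'n ^ 'p) set" where
  "slab K t m s \<equiv> msum (body K) (\<chi> l. t $ l - (1 - s) * m)"

text \<open>The set is a continuous image of a compact one. Its closedness gives joint measurability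
  for Fubini and, for fixed \<open>x\<close>, a least admissible \<open>s\<close>.\<close>

lemma closed_slab_pairs:
  fixes K :: "(real ^ 'n) set" and t :: "real ^ ('p::finite option)"
  assumes "compact K"
  shows "closed {(s, x :: real ^ 'n ^ 'p). s \<in> {0..1} \<and> x \<in> slab K t m s}"
proof -
  let ?F = "{g :: (real ^ 'n ^ 'p) ^ ('p option). \<forall>l. g $ l \<in> body K l}"
  have "compact ?F"
    using assms linear_emb by (intro compact_vec_family compact_continuous_image linear_continuous_on)
      (simp_all add: linear_conv_bounded_linear)
  then have "compact ((\<lambda>(s, g). (s, \<Sum>l\<in>UNIV. (t $ l - (1 - s) * m) *\<^sub>R (g $ l))) ` ({0..1::real} \<times> ?F))"
    by (intro compact_continuous_image compact_Times) (auto simp: case_prod_beta intro!: continuous_intros)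
  moreover have "(\<lambda>(s, g). (s, \<Sum>l\<in>UNIV. (t $ l - (1 - s) * m) *\<^sub>R (g $ l))) ` ({0..1::real} \<times> ?F)
      = {(s, x). s \<in> {0..1} \<and> x \<in> slab K t m s}"
    unfolding msum_def by (auto simp: image_iff)
  ultimately show ?thesis by (simp add: compact_imp_closed)
qed

text \<open>
  Substituting \<open>u = (1 - s) m\<close> shows that this is \<open>u\<^sup>n\<close> for the largest \<open>u \<le> m\<close> with \<open>x \<in> D(t - u)\<close>.
\<close>

definition depth_power :: "(real ^ 'n) set \<Rightarrow> real ^ ('p::finite option) \<Rightarrow> real \<Rightarrow> real ^ 'n ^ 'p \<Rightarrow> ennreal" where
  "depth_power K t m x = (\<integral>\<^sup>+s. ennreal (real CARD('n) * m ^ CARD('n) * (1 - s) ^ (CARD('n) - 1))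
      * indicator {(s, x). s \<in> {0..1} \<and> x \<in> slab K t m s} (s, x) \<partial>lborel)"

text \<open>The least admissible \<open>s\<close> gives the largest \<open>u\<close> and thereby the
  homothet. All admissible parameters lie in \<open>{s0..1}\<close>, and the weight integrates to
  \<open>u ^ n\<close> over this interval. The first alternative arises when no \<open>s\<close> is
  admissible.\<close>

lemma depth_power_le:
  fixes K :: "(real ^ 'n) set" and t :: "real ^ ('p::finite option)"
  assumes K: "compact K" "convex K" and m: "0 \<le> m" "\<And>l. m \<le> t $ l"
  shows "depth_power K t m x = 0 \<or>
    (\<exists>z u. 0 \<le> u \<and> (\<lambda>k. z + u *\<^sub>R k) ` K \<subseteq> common_part K t x \<and> depth_power K t m x \<le> ennreal (u ^ CARD('n)))"
proof -
  let ?n = "CARD('n)"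
  define S where "S = {s \<in> {0..1}. x \<in> slab K t m s}"
  have ind: "indicator {(s, x). s \<in> {0..1} \<and> x \<in> slab K t m s} (s, x) = (indicator S s :: ennreal)" for s
    by (auto simp: S_def indicator_def)
  have dp: "depth_power K t m x = (\<integral>\<^sup>+s. ennreal (real ?n * m ^ ?n * (1 - s) ^ (?n - 1)) * indicator S s \<partial>lborel)"
    unfolding depth_power_def ind ..
  show ?thesis
  proof (cases "S = {}")
    case True
    then have "depth_power K t m x = 0" unfolding dp by simp
    then show ?thesis ..
  next
    case False
    have "S = (\<lambda>s. (s, x)) -` {(s, x). s \<in> {0..1} \<and> x \<in> slab K t m s}" by (auto simp: S_def)
    moreover have "closed ((\<lambda>s. (s, x)) -` {(s, x). s \<in> {0..1} \<and> x \<in> slab K t m s})"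
      by (rule continuous_closed_vimage[OF closed_slab_pairs[OF K(1)]]) (intro continuous_intros)
    ultimately have "closed S" by simp
    moreover have bdd: "bdd_below S" by (auto simp: S_def intro: bdd_belowI[of _ 0])
    ultimately have "Inf S \<in> S" using False by (intro closed_contains_Inf)
    moreover define s0 where "s0 = Inf S"
    ultimately have s0: "s0 \<in> {0..1}" "x \<in> slab K t m s0" by (auto simp: S_def)
    have Ssub: "S \<subseteq> {s0..1}" using cInf_lower[OF _ bdd] by (auto simp: S_def s0_def)
    define u where "u = (1 - s0) * m"
    have u: "0 \<le> u" "u \<le> t $ l" for l
    proof -
      show "0 \<le> u" using s0 m by (simp add: u_def)
      have "u \<le> m" unfolding u_def using s0 m by (intro mult_left_le_one_le) auto
      then show "u \<le> t $ l" using m(2)[of l] by linarith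
    qed
    obtain z where "z \<in> common_part K (\<chi> l. t $ l - u) x"
      using s0(2) unfolding msum_body_iff u_def by blast
    then have sub: "(\<lambda>k. z + u *\<^sub>R k) ` K \<subseteq> common_part K t x"
      by (intro common_part_homothet K u)
    have "depth_power K t m x \<le> (\<integral>\<^sup>+s. ennreal (real ?n * m ^ ?n * (1 - s) ^ (?n - 1)) * indicator {s0..1} s \<partial>lborel)"
      unfolding dp using Ssub by (intro nn_integral_mono mult_left_mono) (auto simp: indicator_def)
    also have "\<dots> = ennreal (u ^ ?n)"
    proof -
      have "((\<lambda>s. real ?n * m ^ ?n * (1 - s) ^ (?n - 1)) has_integral (- (m ^ ?n * (1 - 1) ^ ?n) - (- (m ^ ?n * (1 - s0) ^ ?n)))) {s0..1}"
        using s0(1) by (intro fundamental_theorem_of_calculus)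
          (auto intro!: derivative_eq_intros simp: has_real_derivative_iff_has_vector_derivative[symmetric])
      then have "((\<lambda>s. real ?n * m ^ ?n * (1 - s) ^ (?n - 1)) has_integral u ^ ?n) {s0..1}"
        by (simp add: u_def power_mult_distrib mult.commute power_0_left)
      then show ?thesis using m(1) s0(1)
        by (intro nn_integral_has_integral_lebesgue') auto
    qed
    finally show ?thesis using u(1) sub by blast
  qed
qed

lemma emeasure_lborel_compact:
  assumes "compact (S :: 'a::euclidean_space set)"
  shows "emeasure lborel S = ennreal (measure lebesgue S)"
  using emeasure_compact_finite[OF assms] assms
  by (simp add: borel_compact emeasure_eq_ennreal_measure less_top)

lemma compact_body: "compact K \<Longrightarrow> compact (body K l)"
  using linear_emb[of l] by (intro compact_continuous_image linear_continuous_on) (simp_all add: linear_conv_bounded_linear)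

text \<open>Integrating over \<open>x\<close> first leaves the weighted slab volumes of
  \<open>sum_q_W_has_integral\<close>.\<close>

lemma nn_integral_depth_power:
  fixes K :: "(real ^ 'n) set"
  assumes K: "convex_body K" and t: "t \<in> Theta CARD('p::finite)"
  defines "m \<equiv> t_min CARD('p) t" and "T \<equiv> \<chi> l :: 'p option. t (unlab l)"
  shows "(\<integral>\<^sup>+x. depth_power K T m x \<partial>lborel) = ennreal (\<Sum>j\<in>J_set CARD('n) CARD('p). q CARD('n) CARD('p) j t * W TYPE('p) K j)"
    and "depth_power K T m \<in> borel_measurable borel"
proof -
  let ?n = "CARD('n)"
  have cK: "compact K" using K by (simp add: convex_body_def)
  have m0: "0 \<le> m" unfolding m_def t_min_def using t by (intro Min.boundedI) (auto simp: Theta_def)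
  let ?\<Omega> = "{(s, x :: real ^ 'n ^ 'p). s \<in> {0..1} \<and> x \<in> slab K T m s}"
  let ?w = "\<lambda>s. ennreal (real ?n * m ^ ?n * (1 - s) ^ (?n - 1))"
  have \<Omega>: "?\<Omega> \<in> sets (borel \<Otimes>\<^sub>M borel)"
    using closed_slab_pairs[OF cK, of T m] unfolding borel_prod by (rule borel_closed)
  have [measurable]: "(\<lambda>s. ?w s) \<in> borel_measurable borel"
    by (intro measurable_compose[OF _ measurable_ennreal] borel_measurable_continuous_onI continuous_intros)
  have ind: "(\<lambda>w. indicator ?\<Omega> w :: ennreal) \<in> borel_measurable (borel \<Otimes>\<^sub>M borel)"
    using \<Omega> by (rule borel_measurable_indicator)
  have meas: "(\<lambda>(s, x). ?w s * indicator ?\<Omega> (s, x)) \<in> borel_measurable (lborel \<Otimes>\<^sub>M lborel)"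
    using ind by (auto simp: case_prod_beta intro!: borel_measurable_times_ennreal)
  have meas': "(\<lambda>(x, s). ?w s * indicator ?\<Omega> (s, x)) \<in> borel_measurable (borel \<Otimes>\<^sub>M lborel)"
  proof -
    have "(\<lambda>(x, s). indicator ?\<Omega> (s, x) :: ennreal) \<in> borel_measurable (borel \<Otimes>\<^sub>M lborel)"
    proof -
      have "(\<lambda>w :: (real ^ 'n ^ 'p) \<times> real. (snd w, fst w)) \<in> borel \<Otimes>\<^sub>M lborel \<rightarrow>\<^sub>M borel \<Otimes>\<^sub>M borel"
        by measurable
      from measurable_compose[OF this ind] show ?thesis by (simp add: case_prod_beta)
    qed
    then show ?thesis by (auto simp: case_prod_beta intro!: borel_measurable_times_ennreal)
  qed
  show "depth_power K T m \<in> borel_measurable borel"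
    unfolding depth_power_def[abs_def] by (rule lborel.borel_measurable_nn_integral[OF meas'])
  have "(\<integral>\<^sup>+x. depth_power K T m x \<partial>lborel) = (\<integral>\<^sup>+s. (\<integral>\<^sup>+x. ?w s * indicator ?\<Omega> (s, x) \<partial>lborel) \<partial>lborel)"
    unfolding depth_power_def by (rule lborel_pair.Fubini'[OF meas])
  also have "\<dots> = (\<integral>\<^sup>+s. ennreal (real ?n * m ^ ?n * (1 - s) ^ (?n - 1) * measure lebesgue (slab K T m s)) * indicator {0..1} s \<partial>lborel)"
  proof (rule nn_integral_cong)
    fix s :: real
    have c: "compact (slab K T m s)" by (intro compact_msum compact_body cK)
    have "(\<integral>\<^sup>+x. ?w s * indicator ?\<Omega> (s, x) \<partial>lborel) = (\<integral>\<^sup>+x. (?w s * indicator {0..1} s) * indicator (slab K T m s) x \<partial>lborel)"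
      by (intro nn_integral_cong) (auto simp: indicator_def)
    also have "\<dots> = (?w s * indicator {0..1} s) * emeasure lborel (slab K T m s)"
      using c by (intro nn_integral_cmult_indicator) (simp add: borel_compact)
    also have "\<dots> = ennreal (real ?n * m ^ ?n * (1 - s) ^ (?n - 1) * measure lebesgue (slab K T m s)) * indicator {0..1} s"
      unfolding emeasure_lborel_compact[OF c] using m0 by (auto simp: indicator_def ennreal_mult[symmetric])
    finally show "(\<integral>\<^sup>+x. ?w s * indicator ?\<Omega> (s, x) \<partial>lborel)
      = ennreal (real ?n * m ^ ?n * (1 - s) ^ (?n - 1) * measure lebesgue (slab K T m s)) * indicator {0..1} s" .
  qed
  also have "\<dots> = ennreal (\<Sum>j\<in>J_set ?n CARD('p). q ?n CARD('p) j t * W TYPE('p) K j)"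
  proof (rule nn_integral_has_integral_lebesgue')
    show "0 \<le> real ?n * m ^ ?n * (1 - s) ^ (?n - 1) * measure lebesgue (slab K T m s)" if "s \<in> {0..1}" for s
      using that m0 by simp
    show "((\<lambda>s. real ?n * m ^ ?n * (1 - s) ^ (?n - 1) * measure lebesgue (slab K T m s)) has_integral
      (\<Sum>j\<in>J_set ?n CARD('p). q ?n CARD('p) j t * W TYPE('p) K j)) {0..1}"
      using sum_q_W_has_integral[OF K t] unfolding m_def T_def by simp
  qed
  finally show "(\<integral>\<^sup>+x. depth_power K T m x \<partial>lborel) = ennreal (\<Sum>j\<in>J_set ?n CARD('p). q ?n CARD('p) j t * W TYPE('p) K j)" .
qed

text \<open>\<open>K\<close> lies in a hyperplane, so each component of a point of the sum satisfies
  a linear equation; \<open>undefined\<close> selects an arbitrary component.\<close>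

lemma negligible_slab:
  fixes K :: "(real ^ 'n) set" and t :: "real ^ ('p::finite option)"
  assumes K: "convex K" "interior K = {}"
  shows "negligible (msum (body K) t)"
proof -
  obtain c b where c: "c \<noteq> 0" "K \<subseteq> {x. c \<bullet> x = b}" using empty_interior_subset_hyperplane[OF K] by blast
  let ?a = "undefined :: 'p"
  have "msum (body K) t \<subseteq> {x. axis ?a c \<bullet> x = (t $ Some ?a - t $ None) * b}"
  proof
    fix x assume "x \<in> msum (body K) t"
    then obtain z where "z \<in> common_part K t x" unfolding msum_body_iff by blast
    then have "z \<in> (*\<^sub>R) (t $ None) ` K" "z + x $ ?a \<in> (*\<^sub>R) (t $ Some ?a) ` K"
      unfolding common_part_def forall_option by (auto simp: shift_def)
    then obtain k k' where "k \<in> K" "z = (t $ None) *\<^sub>R k" "k' \<in> K" "z + x $ ?a = (t $ Some ?a) *\<^sub>R k'" by blast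
    moreover have "c \<bullet> (x $ ?a) = c \<bullet> (z + x $ ?a) - c \<bullet> z" by (simp add: inner_add_right)
    moreover have "c \<bullet> k = b" "c \<bullet> k' = b" using c(2) calculation by blast+
    ultimately have "c \<bullet> (x $ ?a) = (t $ Some ?a - t $ None) * b" by (simp add: left_diff_distrib)
    then show "x \<in> {x. axis ?a c \<bullet> x = (t $ Some ?a - t $ None) * b}" by (simp add: inner_axis')
  qed
  moreover have "axis ?a c \<noteq> 0" using c(1) by (simp add: axis_eq_0_iff)
  ultimately show ?thesis using negligible_subset[OF negligible_hyperplane] by blast
qed

lemma compact_common_part:
  fixes K :: "(real ^ 'n) set" and t :: "real ^ ('p::finite option)"
  assumes "compact K"
  shows "compact (common_part K t x)"
proof -
  have "common_part K t x = (*\<^sub>R) (t $ None) ` K \<inter> (\<lambda>z. (x, z)) -` {(x, z). z \<in> common_part K t x}"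
    unfolding common_part_def forall_option by (auto simp: shift_def)
  moreover have "closed ((\<lambda>z. (x, z)) -` {(x, z). z \<in> common_part K t x})"
    by (intro continuous_closed_vimage closed_common_part_pairs assms continuous_intros)
  moreover have "compact ((*\<^sub>R) (t $ None) ` K)"
    using assms by (intro compact_continuous_image continuous_intros)
  ultimately show ?thesis by (metis compact_Int_closed)
qed

lemma convex_common_part:
  fixes K :: "(real ^ 'n) set" and t :: "real ^ ('p::finite option)"
  assumes "convex K"
  shows "convex (common_part K t x)"
proof (rule convexI)
  fix z w and u v :: real
  assume zw: "z \<in> common_part K t x" "w \<in> common_part K t x" and uv: "0 \<le> u" "0 \<le> v" "u + v = 1"
  have "(u *\<^sub>R z + v *\<^sub>R w) + shift x l \<in> (*\<^sub>R) (t $ l) ` K" for l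
  proof -
    have "u *\<^sub>R (z + shift x l) + v *\<^sub>R (w + shift x l) \<in> (*\<^sub>R) (t $ l) ` K"
      using zw uv by (intro convexD[OF convex_scaling[OF assms]]) (auto simp: common_part_def)
    also have "u *\<^sub>R (z + shift x l) + v *\<^sub>R (w + shift x l) = (u *\<^sub>R z + v *\<^sub>R w) + (u + v) *\<^sub>R shift x l"
      by (simp add: algebra_simps)
    finally show ?thesis using uv(3) by simp
  qed
  then show "u *\<^sub>R z + v *\<^sub>R w \<in> common_part K t x" by (simp add: common_part_def)
qed

lemma depth_power_le_common_part:
  fixes K :: "(real ^ 'n) set" and t :: "real ^ ('p::finite option)"
  assumes K: "compact K" "convex K" and m: "0 \<le> m" "\<And>l. m \<le> t $ l"
  shows "depth_power K t m x * emeasure lborel K \<le> emeasure lborel (common_part K t x)"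
  using depth_power_le[OF K m, of x]
proof (elim disjE exE conjE)
  fix z u assume u: "0 \<le> u" "(\<lambda>k. z + u *\<^sub>R k) ` K \<subseteq> common_part K t x" "depth_power K t m x \<le> ennreal (u ^ CARD('n))"
  have "depth_power K t m x * emeasure lborel K \<le> ennreal (u ^ CARD('n)) * emeasure lborel K"
    using u(3) by (rule mult_right_mono) simp
  also have "\<dots> = emeasure lborel ((\<lambda>k. z + u *\<^sub>R k) ` K)"
    using emeasure_homothet[OF K(1) u(1), of z] by simp
  also have "\<dots> \<le> emeasure lborel (common_part K t x)"
    using u(2) borel_compact[OF compact_common_part[OF K(1), of t x]] by (intro emeasure_mono) auto
  finally show ?thesis .
qed simp

lemma measure_pos_iff_interior:
  fixes K :: "'a::euclidean_space set"
  assumes "compact K" "convex K"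
  shows "measure lebesgue K > 0 \<longleftrightarrow> interior K \<noteq> {}"
proof -
  have "K \<in> lmeasurable" using assms(1) by (rule lmeasurable_compact)
  then have "measure lebesgue K = 0 \<longleftrightarrow> negligible K" by (rule negligible_iff_measure0[symmetric])
  then show ?thesis using negligible_convex_interior[OF assms(2)] by (metis measure_nonneg less_le)
qed

lemma prod_lab: "(\<Prod>l\<in>(UNIV :: 'p::finite option set). f (unlab l)) = (\<Prod>i=0..CARD('p). f i)"
  for f :: "nat \<Rightarrow> 'a::comm_monoid_mult"
proof -
  have "(\<Prod>i=0..CARD('p). f (unlab (lab i :: 'p option))) = (\<Prod>l\<in>(UNIV :: 'p option set). f (unlab l))"
    by (rule prod.reindex_bij_betw[OF bij_betw_lab])
  moreover have "(\<Prod>i=0..CARD('p). f (unlab (lab i :: 'p option))) = (\<Prod>i=0..CARD('p). f i)"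
    by (intro prod.cong) (auto simp: unlab_lab)
  ultimately show ?thesis by simp
qed

lemma Theta_bounds:
  fixes t :: "nat \<Rightarrow> real"
  assumes "t \<in> Theta CARD('p::finite)"
  shows "0 \<le> t_min CARD('p) t" "t_min CARD('p) t \<le> (\<chi> l :: 'p option. t (unlab l)) $ l"
  using assms unlab_le[of l] unfolding t_min_def Theta_def
  by (auto intro!: Min.boundedI Min_le)

lemma sum_q_W_le:
  fixes K :: "(real ^ 'n) set"
  assumes K: "convex_body K" and t: "t \<in> Theta CARD('p::finite)"
  shows "(\<Sum>j\<in>J_set CARD('n) CARD('p). q CARD('n) CARD('p) j t * W TYPE('p) K j)
    \<le> (\<Prod>l=0..CARD('p). t l ^ CARD('n)) * measure lebesgue K ^ CARD('p)"
    (is "?A \<le> ?R * _")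
proof -
  let ?m = "t_min CARD('p) t" and ?T = "\<chi> l :: 'p option. t (unlab l)"
  have cK: "compact K" "convex K" using K by (auto simp: convex_body_def)
  have tT: "0 \<le> ?T $ l" for l using Theta_bounds(1)[OF t] Theta_bounds(2)[OF t, of l] by linarith
  have R: "(\<Prod>l\<in>UNIV. (?T $ l) ^ CARD('n)) = ?R"
    using prod_lab[of "\<lambda>i. t i ^ CARD('n)", where 'p='p] by simp
  have R0: "0 \<le> ?R" using t by (intro prod_nonneg) (auto simp: Theta_def)
  show ?thesis
  \<comment> \<open>The integrals give the claim multiplied by the volume of \<open>K\<close>. When
    this volume is zero, all slabs are null and the left-hand side vanishes.\<close>
  proof (cases "interior K = {}")
    case True
    have "((\<lambda>s. real CARD('n) * ?m ^ CARD('n) * (1 - s) ^ (CARD('n) - 1)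
      * measure lebesgue (msum (body K :: 'p option \<Rightarrow> (real ^ 'n ^ 'p) set) (\<chi> l. t (unlab l) - (1 - s) * ?m)))
      has_integral 0) {0..1}"
      by (rule has_integral_is_0) (simp add: negligible_imp_measure0[OF negligible_slab[OF cK(2) True]])
    then have "?A = 0" using has_integral_unique[OF sum_q_W_has_integral[OF K t]] by blast
    moreover have "0 \<le> ?R * measure lebesgue K ^ CARD('p)" using R0 by (intro mult_nonneg_nonneg) auto
    ultimately show ?thesis by simp
  next
    case False
    then have v: "measure lebesgue K > 0" using measure_pos_iff_interior[OF cK] by simp
    have "ennreal ?A * emeasure lborel K = (\<integral>\<^sup>+x. depth_power K ?T ?m x * emeasure lborel K \<partial>lborel)"
      using nn_integral_depth_power[OF K t] by (subst nn_integral_multc) auto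
    also have "\<dots> \<le> (\<integral>\<^sup>+x. emeasure lborel (common_part K ?T x) \<partial>lborel)"
      by (intro nn_integral_mono depth_power_le_common_part cK Theta_bounds[OF t])
    also have "\<dots> = ennreal (?R * measure lebesgue K ^ Suc CARD('p))"
      unfolding nn_integral_common_part[OF cK(1) tT] R ..
    finally have le: "ennreal ?A * ennreal (measure lebesgue K) \<le> ennreal (?R * measure lebesgue K ^ Suc CARD('p))"
      unfolding emeasure_lborel_compact[OF cK(1)] .
    show ?thesis
    \<comment> \<open>\<open>ennreal\<close> sends negative numbers to zero, so the extended
      inequality is informative only for a nonnegative left-hand side; for a negative one the claim
      is trivial.\<close>
    proof (cases "?A \<ge> 0")
      case True
      then have "ennreal (?A * measure lebesgue K) \<le> ennreal (?R * measure lebesgue K ^ Suc CARD('p))"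
        using le v by (simp add: ennreal_mult)
      then have "?A * measure lebesgue K \<le> (?R * measure lebesgue K ^ CARD('p)) * measure lebesgue K"
        using R0 by (subst (asm) ennreal_le_iff) (auto simp: mult_ac)
      then show ?thesis using v by simp
    next
      case False
      moreover have "0 \<le> ?R * measure lebesgue K ^ CARD('p)" using R0 by (intro mult_nonneg_nonneg) auto
      ultimately show ?thesis by linarith
    qed
  qed
qed

text \<open>A point of \<open>B\<close> outside the closed set \<open>A\<close> has a neighbourhood
  avoiding \<open>A\<close>, and this meets the interior of \<open>B\<close> in positive
  volume.\<close>

lemma eq_of_emeasure_eq:
  fixes A B :: "'a::euclidean_space set"
  assumes "compact A" "compact B" "convex B" "A \<subseteq> B" and eq: "emeasure lborel A = emeasure lborel B"
    and pos: "emeasure lborel B \<noteq> 0"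
  shows "A = B"
proof (rule ccontr)
  assume "A \<noteq> B"
  then obtain x where x: "x \<in> B" "x \<notin> A" using assms(4) by blast
  have "measure lebesgue B \<noteq> 0" using pos emeasure_lborel_compact[OF assms(2)] by auto
  then have int: "interior B \<noteq> {}"
    using measure_pos_iff_interior[OF assms(2,3)] by (metis measure_nonneg less_le)
  have "x \<in> closure (interior B)" using convex_closure_interior[OF assms(3) int] x(1) closure_subset by blast
  moreover have "open (- A)" using compact_imp_closed[OF assms(1)] by (simp add: open_Compl)
  ultimately have ne: "interior B \<inter> - A \<noteq> {}" using x(2) by (metis Compl_iff closure_iff_nhds_not_empty inf_commute order_refl)
  have op: "open (interior B \<inter> - A)" using \<open>open (- A)\<close> by auto
  have bor: "A \<in> sets lborel" "B \<in> sets lborel" "interior B \<inter> - A \<in> sets lborel"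
    using assms(1,2) op by (auto simp: borel_compact borel_open)
  have "emeasure lborel A + emeasure lborel (interior B \<inter> - A) = emeasure lborel (A \<union> (interior B \<inter> - A))"
    using bor by (intro plus_emeasure) auto
  also have "\<dots> \<le> emeasure lborel B" using assms(4) interior_subset bor by (intro emeasure_mono) auto
  finally have "emeasure lborel A + emeasure lborel (interior B \<inter> - A) \<le> emeasure lborel A + 0" using eq by simp
  then have "emeasure lborel (interior B \<inter> - A) = 0"
    using emeasure_lborel_compact[OF assms(1)] by (subst (asm) ennreal_add_left_cancel_le) auto
  then have "negligible (interior B \<inter> - A)"
    using bor(3) by (simp add: negligible_iff_null_sets null_sets_def)
  then show False using open_not_negligible[OF op ne] by blast
qed

text \<open>Pointwise ordered functions with equal finite integrals agree almost everywhere. Where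
  they agree and are nonzero, the homothet contained in \<open>C(x)\<close> has the full volume of
  \<open>C(x)\<close> and so equals it.\<close>

lemma AE_common_part_homothetic:
  fixes K :: "(real ^ 'n) set"
  assumes K: "convex_body K" and int: "interior K \<noteq> {}" and t: "t \<in> Theta CARD('p::finite)"
    and eq: "(\<Sum>j\<in>J_set CARD('n) CARD('p). q CARD('n) CARD('p) j t * W TYPE('p) K j)
      = (\<Prod>l=0..CARD('p). t l ^ CARD('n)) * measure lebesgue K ^ CARD('p)" (is "?A = ?R * _")
  defines "T \<equiv> \<chi> l :: 'p option. t (unlab l)"
  shows "AE x in lborel. emeasure lborel (common_part K T x) = 0 \<or> (\<exists>z u. 0 \<le> u \<and> common_part K T x = (\<lambda>k. z + u *\<^sub>R k) ` K)"
proof -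
  let ?m = "t_min CARD('p) t"
  let ?e = "emeasure lborel K"
  have cK: "compact K" "convex K" using K by (auto simp: convex_body_def)
  have v: "measure lebesgue K > 0" using measure_pos_iff_interior[OF cK] int by simp
  note m = Theta_bounds[OF t, folded T_def]
  have tT: "0 \<le> T $ l" for l using m(1) m(2)[of l] by linarith
  have R: "(\<Prod>l\<in>UNIV. (T $ l) ^ CARD('n)) = ?R"
    using prod_lab[of "\<lambda>i. t i ^ CARD('n)", where 'p='p] by (simp add: T_def)
  have R0: "0 \<le> ?R" using t by (intro prod_nonneg) (auto simp: Theta_def)
  have le: "depth_power K T ?m x * ?e \<le> emeasure lborel (common_part K T x)" for x
    by (intro depth_power_le_common_part cK m)
  have int2: "(\<integral>\<^sup>+x. emeasure lborel (common_part K T x) \<partial>lborel) = ennreal (?R * measure lebesgue K ^ Suc CARD('p))"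
    unfolding nn_integral_common_part[OF cK(1) tT] R ..
  have dm[measurable]: "depth_power K T ?m \<in> borel_measurable borel"
    unfolding T_def by (rule nn_integral_depth_power(2)[OF K t])
  have int1: "(\<integral>\<^sup>+x. depth_power K T ?m x * ?e \<partial>lborel) = ennreal (?R * measure lebesgue K ^ Suc CARD('p))"
  proof -
    have "(\<integral>\<^sup>+x. depth_power K T ?m x * ?e \<partial>lborel) = ennreal ?A * ?e"
      using nn_integral_depth_power(1)[OF K t] unfolding T_def[symmetric] by (subst nn_integral_multc) auto
    also have "\<dots> = ennreal (?R * measure lebesgue K ^ CARD('p) * measure lebesgue K)"
      unfolding eq emeasure_lborel_compact[OF cK(1)] using R0 by (intro ennreal_mult[symmetric]) auto
    finally show ?thesis by (simp add: mult_ac)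
  qed
  have hm: "(\<lambda>x. emeasure lborel (common_part K T x)) \<in> borel_measurable lborel"
  proof -
    have "{(x :: real ^ 'n ^ 'p, z). z \<in> common_part K T x} \<in> sets (lborel \<Otimes>\<^sub>M lborel)"
      using closed_common_part_pairs[OF cK(1), of T] unfolding lborel_prod by (simp add: borel_closed)
    from lborel.measurable_emeasure_Pair[OF this] show ?thesis by (simp add: vimage_def)
  qed
  have "(\<integral>\<^sup>+x. emeasure lborel (common_part K T x) - depth_power K T ?m x * ?e \<partial>lborel) = 0"
    using hm le by (subst nn_integral_diff) (auto simp: int1 int2)
  then have "AE x in lborel. emeasure lborel (common_part K T x) - depth_power K T ?m x * ?e = 0"
    using hm by (subst (asm) nn_integral_0_iff_AE) auto
  then show ?thesis
  proof (rule AE_mp, intro AE_I2 impI)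
    fix x assume d: "emeasure lborel (common_part K T x) - depth_power K T ?m x * ?e = 0"
    have cC: "compact (common_part K T x)" by (rule compact_common_part[OF cK(1)])
    have eqd: "emeasure lborel (common_part K T x) = depth_power K T ?m x * ?e"
      using d le[of x] by (metis diff_eq_0_iff_ennreal order.antisym leI less_le emeasure_lborel_compact[OF cC] ennreal_minus_eq_0)
    show "emeasure lborel (common_part K T x) = 0 \<or> (\<exists>z u. 0 \<le> u \<and> common_part K T x = (\<lambda>k. z + u *\<^sub>R k) ` K)"
    proof (rule disjCI)
      assume no: "\<not> (\<exists>z u. 0 \<le> u \<and> common_part K T x = (\<lambda>k. z + u *\<^sub>R k) ` K)"
      show "emeasure lborel (common_part K T x) = 0"
      proof (rule ccontr)
        assume pos: "emeasure lborel (common_part K T x) \<noteq> 0"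
        then have "depth_power K T ?m x \<noteq> 0" using eqd by auto
        then obtain z u where zu: "0 \<le> u" "(\<lambda>k. z + u *\<^sub>R k) ` K \<subseteq> common_part K T x"
            "depth_power K T ?m x \<le> ennreal (u ^ CARD('n))"
          using depth_power_le[OF cK m, of x] by blast
        let ?H = "(\<lambda>k. z + u *\<^sub>R k) ` K"
        have cH: "compact ?H" using cK(1) by (intro compact_continuous_image continuous_intros)
        have eH: "emeasure lborel ?H = ennreal (u ^ CARD('n)) * ?e"
          using emeasure_homothet[OF cK(1) zu(1), of z] by simp
        have "emeasure lborel (common_part K T x) \<le> emeasure lborel ?H"
          unfolding eqd eH using zu(3) by (rule mult_right_mono) simp
        moreover have "emeasure lborel ?H \<le> emeasure lborel (common_part K T x)"
          using zu(2) cC by (intro emeasure_mono) (auto simp: borel_compact)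
        ultimately have "?H = common_part K T x"
          using pos by (intro eq_of_emeasure_eq cH cC convex_common_part cK(2) zu(2)) auto
        then show False using no zu(1) by blast
      qed
    qed
  qed
qed

section \<open>Convex bodies whose intersections with translates are homothetic\<close>

text \<open>
  Translate \<open>b K\<close> such that its lowest point in direction \<open>f\<close> lies at depth \<open>\<epsilon> \<omega>\<close> vertically below \<open>e\<close>, where
  \<open>\<omega>\<close> is the width of \<open>K\<close> in direction \<open>f\<close>. The intersection with \<open>K\<close> then has width at most \<open>\<epsilon> \<omega>\<close>, so it is a copy
  of \<open>K\<close> shrunk by a factor of at most \<open>\<epsilon>\<close>; on the other hand, for small \<open>\<epsilon>\<close> the inner ball lets it contain
  the points \<open>e + \<sigma> \<epsilon> (k - e)\<close>.
\<close>

lemma homothety_apex: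
  fixes K :: "'a::euclidean_space set"
  assumes "convex K" "compact K" "b > 0" "r > 0"
    and H: "\<And>x. interior (K \<inter> (\<lambda>k. x + b *\<^sub>R k) ` K) \<noteq> {} \<Longrightarrow>
              \<exists>y u. u \<ge> 0 \<and> K \<inter> (\<lambda>k. x + b *\<^sub>R k) ` K = (\<lambda>k. y + u *\<^sub>R k) ` K"
    and ball: "cball (w + r *\<^sub>R f) r \<subseteq> K" and f: "norm f = 1" and w: "w \<in> K" and fw: "\<And>k. k \<in> K \<Longrightarrow> f \<bullet> w \<le> f \<bullet> k"
    and e: "e \<in> K" and fe: "\<And>k. k \<in> K \<Longrightarrow> f \<bullet> k \<le> f \<bullet> e"
  shows "f \<bullet> w < f \<bullet> e" and "\<And>k. k extreme_point_of K \<Longrightarrow> k \<noteq> e \<Longrightarrow> f \<bullet> k = f \<bullet> w"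
proof -
  define om where "om = f \<bullet> e - f \<bullet> w"
  have ff: "f \<bullet> f = 1" using f by (simp add: norm_eq_1)
  have "w + r *\<^sub>R f + r *\<^sub>R f \<in> K"
    using ball f \<open>r > 0\<close> by (auto simp: dist_norm intro!: subsetD[OF ball])
  from fe[OF this] have om: "om \<ge> 2 * r" by (simp add: om_def inner_add_right ff)
  with \<open>r > 0\<close> have om0: "om > 0" by linarith
  then show "f \<bullet> w < f \<bullet> e" by (simp add: om_def)
  have intK: "interior K \<noteq> {}"
  proof -
    have "ball (w + r *\<^sub>R f) r \<subseteq> K" using ball ball_subset_cball by blast
    then have "ball (w + r *\<^sub>R f) r \<subseteq> interior K" by (simp add: interior_maximal)
    then show ?thesis using \<open>r > 0\<close> by auto
  qed
  have core: "\<exists>\<epsilon> u y. 0 < \<epsilon> \<and> 0 < u \<and> u \<le> \<epsilon> \<and> e \<in> (\<lambda>k. y + u *\<^sub>R k) ` K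
      \<and> e + (\<sigma> * \<epsilon>) *\<^sub>R (k - e) \<in> (\<lambda>k. y + u *\<^sub>R k) ` K \<and> y + u *\<^sub>R e \<in> K"
    if k: "k \<in> K" "k \<noteq> e" and l: "\<sigma> > 0" "\<sigma> * (f \<bullet> e - f \<bullet> k) < om" for k \<sigma>
  proof -
    define \<delta> where "\<delta> = f \<bullet> e - f \<bullet> k"
    have d0: "\<delta> \<ge> 0" using fe[OF k(1)] by (simp add: \<delta>_def)
    \<comment> \<open>The squared distance of
      \<open>e + (\<sigma> * \<epsilon>) *\<^sub>R (k - e)\<close> from \<open>?c\<close> is
      \<open>(b * r)\<^sup>2 + \<epsilon> * (\<epsilon> * Q - R)\<close> minus a nonnegative term,
      so \<open>\<epsilon> * Q < R\<close> puts the point into the ball. The bound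
      \<open>1 / \<sigma>\<close> on \<epsilon> keeps it between \<open>e\<close> and
      \<open>k\<close>.\<close>
    define Q where "Q = \<sigma>^2 * (norm (k - e))^2 + om^2"
    have Q: "Q > 0" using om0 by (simp add: Q_def add_nonneg_pos)
    define R where "R = 2 * b * r * (om - \<sigma> * \<delta>)"
    have R: "R > 0" using l \<open>b>0\<close> \<open>r>0\<close> by (simp add: R_def \<delta>_def)
    define \<epsilon> where "\<epsilon> = min (R / (2 * Q)) (1 / \<sigma>)"
    have e0: "\<epsilon> > 0" using R Q l by (simp add: \<epsilon>_def)
    have "\<epsilon> \<le> R / (2 * Q)" by (simp add: \<epsilon>_def)
    then have eQ: "\<epsilon> * Q < R" using Q R
      by (smt (verit, ccfv_SIG) divide_pos_pos field_sum_of_halves mult_2 mult_less_cancel_right nonzero_eq_divide_eq pos_less_divide_eq times_divide_eq_right)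
    have el: "\<sigma> * \<epsilon> \<le> 1" using l by (simp add: \<epsilon>_def min_def field_simps)
    define x where "x = e - (\<epsilon> * om) *\<^sub>R f - b *\<^sub>R w"
    let ?B = "(\<lambda>k. x + b *\<^sub>R k) ` K"
    let ?c = "e - (\<epsilon> * om) *\<^sub>R f + (b * r) *\<^sub>R f"
    have cb: "cball ?c (b * r) \<subseteq> ?B"
    proof
      fix z assume z: "z \<in> cball ?c (b * r)"
      let ?z = "(1 / b) *\<^sub>R (z - x)"
      have "b *\<^sub>R ?z = z - x" using \<open>b > 0\<close> by simp
      then have "b *\<^sub>R (?z - (w + r *\<^sub>R f)) = z - ?c"
        by (simp add: x_def scaleR_diff_right scaleR_add_right algebra_simps)
      then have "b * norm (?z - (w + r *\<^sub>R f)) = norm (z - ?c)"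
        using \<open>b > 0\<close> by (metis abs_of_pos norm_scaleR)
      also have "\<dots> \<le> b * r" using z by (simp only: mem_cball dist_norm norm_minus_commute)
      finally have "norm (?z - (w + r *\<^sub>R f)) \<le> r" using \<open>b > 0\<close> by simp
      then have "?z \<in> K" using ball by (auto simp: dist_norm norm_minus_commute)
      then show "z \<in> ?B" using \<open>b > 0\<close> by (intro image_eqI[of _ _ ?z]) auto
    qed
    \<comment> \<open>This puts \<open>e\<close> strictly inside the ball, so that the intersection
      has interior points and \<open>H\<close> applies.\<close>
    have eom: "\<epsilon> * om < 2 * b * r"
    proof -
      have "\<epsilon> * om * om \<le> \<epsilon> * Q" using e0 by (simp add: Q_def power2_eq_square)
      also have "\<dots> < R" by (rule eQ)
      also have "R \<le> 2 * b * r * om" using l d0 \<open>b>0\<close> \<open>r>0\<close> by (simp add: R_def)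
      finally show ?thesis using om0 by simp
    qed
    have "e \<in> ball ?c (b * r)"
    proof -
      have "?c - e = (b * r - \<epsilon> * om) *\<^sub>R f" by (simp add: algebra_simps)
      then have "norm (?c - e) = \<bar>b * r - \<epsilon> * om\<bar>" using f by simp
      also have "\<dots> < b * r" using eom e0 om0 by (simp add: abs_less_iff)
      finally show ?thesis by (simp add: dist_norm)
    qed
    moreover have "ball ?c (b * r) \<subseteq> ?B" using cb ball_subset_cball by blast
    then have "ball ?c (b * r) \<subseteq> interior ?B" by (simp add: interior_maximal)
    ultimately have eB: "e \<in> interior ?B" by blast
    have "e \<in> closure (interior K)"
      using e convex_closure_interior[OF \<open>convex K\<close> intK] closure_subset by blast
    then have "interior K \<inter> interior ?B \<noteq> {}"
      using eB by (metis closure_iff_nhds_not_empty inf_commute open_interior order_refl)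
    then have int: "interior (K \<inter> ?B) \<noteq> {}" by simp
    obtain y u where u: "u \<ge> 0" and I: "K \<inter> ?B = (\<lambda>k. y + u *\<^sub>R k) ` K"
      using H[OF int] by blast
    have eI: "e \<in> K \<inter> ?B" using e eB interior_subset by blast
    have pI: "e + (\<sigma> * \<epsilon>) *\<^sub>R (k - e) \<in> K \<inter> ?B"
    proof
      have "e + (\<sigma> * \<epsilon>) *\<^sub>R (k - e) = (1 - \<sigma> * \<epsilon>) *\<^sub>R e + (\<sigma> * \<epsilon>) *\<^sub>R k" by (simp add: algebra_simps)
      then show "e + (\<sigma> * \<epsilon>) *\<^sub>R (k - e) \<in> K"
        using convexD_alt[OF \<open>convex K\<close> e k(1), of "\<sigma> * \<epsilon>"] el l e0 by simp
      define \<eta> where "\<eta> = (\<sigma> * \<epsilon>) *\<^sub>R (k - e)"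
      have "(norm (\<eta> - (b * r - \<epsilon> * om) *\<^sub>R f))\<^sup>2 = (norm \<eta>)\<^sup>2 - 2 * (b * r - \<epsilon> * om) * (f \<bullet> \<eta>) + (b * r - \<epsilon> * om)\<^sup>2"
        by (simp only: power2_norm_eq_inner) (simp add: inner_diff_left inner_diff_right inner_commute ff power2_eq_square algebra_simps)
      also have "f \<bullet> \<eta> = - (\<sigma> * \<epsilon> * \<delta>)" by (simp add: \<eta>_def \<delta>_def inner_diff_right algebra_simps)
      also have "(norm \<eta>)\<^sup>2 = \<sigma>\<^sup>2 * \<epsilon>\<^sup>2 * (norm (k - e))\<^sup>2" by (simp add: \<eta>_def power_mult_distrib)
      also have "\<sigma>\<^sup>2 * \<epsilon>\<^sup>2 * (norm (k - e))\<^sup>2 - 2 * (b * r - \<epsilon> * om) * (- (\<sigma> * \<epsilon> * \<delta>)) + (b * r - \<epsilon> * om)\<^sup>2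
          = (b * r)\<^sup>2 + \<epsilon> * (\<epsilon> * Q - R) - 2 * \<epsilon> * om * \<sigma> * \<epsilon> * \<delta>"
        by (simp add: Q_def R_def power2_eq_square algebra_simps)
      also have "\<dots> \<le> (b * r)\<^sup>2"
      proof -
        have "\<epsilon> * (\<epsilon> * Q - R) \<le> 0" using e0 eQ by (simp add: mult_le_0_iff)
        moreover have "0 \<le> 2 * \<epsilon> * om * \<sigma> * \<epsilon> * \<delta>" using e0 om0 l d0 by simp
        ultimately show ?thesis by linarith
      qed
      finally have "norm (\<eta> - (b * r - \<epsilon> * om) *\<^sub>R f) \<le> b * r"
        by (rule power2_le_imp_le) (use \<open>b>0\<close> \<open>r>0\<close> in simp)
      moreover have "e + \<eta> - ?c = \<eta> - (b * r - \<epsilon> * om) *\<^sub>R f" by (simp add: algebra_simps)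
      ultimately have "e + \<eta> \<in> cball ?c (b * r)" by (simp only: mem_cball dist_norm norm_minus_commute)
      then show "e + (\<sigma> * \<epsilon>) *\<^sub>R (k - e) \<in> ?B" using cb by (auto simp: \<eta>_def)
    qed
    \<comment> \<open>The copy has width \<open>u * om\<close> and lies between the lowest height in
      \<open>?B\<close> and the height of \<open>e\<close>, which differ by
      \<open>\<epsilon> * om\<close>; hence \<open>u \<le> \<epsilon>\<close>.\<close>
    have yB: "y + u *\<^sub>R w \<in> ?B" and yK: "y + u *\<^sub>R e \<in> K" using I w e by blast+
    obtain \<kappa> where \<kappa>: "\<kappa> \<in> K" "y + u *\<^sub>R w = x + b *\<^sub>R \<kappa>" using yB by blast
    have "f \<bullet> (y + u *\<^sub>R w) = f \<bullet> e - \<epsilon> * om + b * (f \<bullet> \<kappa> - f \<bullet> w)"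
      by (simp add: \<kappa> x_def inner_add_right inner_diff_right ff algebra_simps)
    moreover have "b * (f \<bullet> \<kappa> - f \<bullet> w) \<ge> 0" using fw[OF \<kappa>(1)] \<open>b>0\<close> by simp
    moreover have "f \<bullet> (y + u *\<^sub>R e) \<le> f \<bullet> e" using fe[OF yK] .
    ultimately have "u * om \<le> \<epsilon> * om" by (simp add: om_def inner_add_right algebra_simps)
    then have ue: "u \<le> \<epsilon>" using om0 by simp
    have "u \<noteq> 0"
    proof
      assume "u = 0"
      then have "K \<inter> ?B \<subseteq> {y}" using I by auto
      then have "e = y" "e + (\<sigma> * \<epsilon>) *\<^sub>R (k - e) = y" using subsetD[OF _ eI] subsetD[OF _ pI] by blast+
      then have "(\<sigma> * \<epsilon>) *\<^sub>R (k - e) = 0" by (metis add_cancel_right_right)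
      then show False using l e0 k by auto
    qed
    with u have "u > 0" by simp
    then show ?thesis using e0 ue eI pI yK unfolding I by blast
  qed
  \<comment> \<open>At the top height every positive \<sigma> is admissible in \<open>core\<close>.
    It is taken so large that the two points of the copy are farther apart than \<epsilon> times the
    diameter of \<open>K\<close>.\<close>
  have uniq: "k = e" if k: "k \<in> K" "f \<bullet> k = f \<bullet> e" for k
  proof (rule ccontr)
    assume ke: "k \<noteq> e"
    define \<sigma> where "\<sigma> = (diameter K + 1) / norm (k - e)"
    have nk: "norm (k - e) > 0" using ke by simp
    have dia: "diameter K \<ge> 0" using \<open>compact K\<close> compact_imp_bounded diameter_ge_0 by blast
    have "\<sigma> > 0" using nk dia by (simp add: \<sigma>_def)
    then obtain \<epsilon> u y where *: "0 < \<epsilon>" "0 < u" "u \<le> \<epsilon>" "e \<in> (\<lambda>k. y + u *\<^sub>R k) ` K"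
      "e + (\<sigma> * \<epsilon>) *\<^sub>R (k - e) \<in> (\<lambda>k. y + u *\<^sub>R k) ` K" using core[OF k(1) ke, of \<sigma>] k(2) om0 by (metis cancel_comm_monoid_add_class.diff_cancel mult_zero_right)
    obtain k1 k2 where k12: "k1 \<in> K" "k2 \<in> K" "e = y + u *\<^sub>R k1" "e + (\<sigma> * \<epsilon>) *\<^sub>R (k - e) = y + u *\<^sub>R k2"
      using *(4,5) by blast
    have "(\<sigma> * \<epsilon>) *\<^sub>R (k - e) = u *\<^sub>R (k2 - k1)" using k12(3,4) by (simp add: algebra_simps)
    then have "norm ((\<sigma> * \<epsilon>) *\<^sub>R (k - e)) = norm (u *\<^sub>R (k2 - k1))" by simp
    then have "\<sigma> * \<epsilon> * norm (k - e) = u * norm (k2 - k1)" using * \<open>\<sigma> > 0\<close> by simp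
    also have "\<dots> \<le> \<epsilon> * diameter K"
      using * diameter_bounded_bound[of K k2 k1] k12 \<open>compact K\<close> dia
      by (intro mult_mono) (auto simp: dist_norm compact_imp_bounded)
    finally have "\<sigma> * norm (k - e) \<le> diameter K" using * by (simp add: mult.commute mult.left_commute)
    then show False using nk by (simp add: \<sigma>_def)
  qed
  fix k assume ke: "k extreme_point_of K" "k \<noteq> e"
  then have k: "k \<in> K" by (simp add: extreme_point_of_def)
  show "f \<bullet> k = f \<bullet> w"
  \<comment> \<open>If \<open>k\<close> lies above the height of \<open>w\<close>, there is room for
    some \<open>\<sigma> > 1\<close>. By \<open>uniq\<close> the copy sends \<open>e\<close> to
    \<open>e\<close>; since \<open>u \<le> \<epsilon> < \<sigma> * \<epsilon>\<close>, undoing the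
    contraction gives a point \<open>k2\<close> of \<open>K\<close> beyond \<open>k\<close> on the
    ray from \<open>e\<close>, so \<open>k\<close> is not extreme.\<close>
  proof (rule ccontr)
    assume "f \<bullet> k \<noteq> f \<bullet> w"
    with fw[OF k] have lt: "f \<bullet> w < f \<bullet> k" by simp
    define \<delta> where "\<delta> = f \<bullet> e - f \<bullet> k"
    have d: "\<delta> > 0" using fe[OF k] uniq[OF k] ke(2) by (force simp: \<delta>_def)
    have "\<delta> < om" using lt by (simp add: \<delta>_def om_def)
    then have "1 < om / \<delta>" using d by simp
    then obtain \<sigma> where l: "1 < \<sigma>" "\<sigma> < om / \<delta>" using dense by blast
    then have "\<sigma> * (f \<bullet> e - f \<bullet> k) < om" using d by (simp add: \<delta>_def field_simps)
    then obtain \<epsilon> u y where *: "0 < \<epsilon>" "0 < u" "u \<le> \<epsilon>" "e \<in> (\<lambda>k. y + u *\<^sub>R k) ` K"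
      "e + (\<sigma> * \<epsilon>) *\<^sub>R (k - e) \<in> (\<lambda>k. y + u *\<^sub>R k) ` K" "y + u *\<^sub>R e \<in> K" using core[OF k ke(2), of \<sigma>] l by (metis less_trans zero_less_one)
    obtain k1 k2 where k12: "k1 \<in> K" "k2 \<in> K" "e = y + u *\<^sub>R k1" "e + (\<sigma> * \<epsilon>) *\<^sub>R (k - e) = y + u *\<^sub>R k2"
      using *(4,5) by blast
    have "f \<bullet> (y + u *\<^sub>R e) \<le> f \<bullet> e" using fe *(6) by blast
    also have "f \<bullet> e = f \<bullet> (y + u *\<^sub>R k1)" using k12 by simp
    finally have "f \<bullet> e \<le> f \<bullet> k1" using * by (simp add: inner_add_right)
    then have "f \<bullet> k1 = f \<bullet> e" using fe[OF k12(1)] by linarith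
    then have k1: "k1 = e" by (rule uniq[OF k12(1)])
    define \<mu> where "\<mu> = \<sigma> * \<epsilon> / u"
    have "u < \<sigma> * \<epsilon>" using l * mult_strict_right_mono[of 1 \<sigma> \<epsilon>] by linarith
    then have mu: "\<mu> > 1" using * by (simp add: \<mu>_def)
    have "(\<sigma> * \<epsilon>) *\<^sub>R (k - e) = (y + u *\<^sub>R k2) - (y + u *\<^sub>R e)"
      using k12(3,4) k1 by (metis add_diff_cancel_left')
    then have "u *\<^sub>R (\<mu> *\<^sub>R (k - e)) = u *\<^sub>R (k2 - e)"
      using *(2) by (simp add: \<mu>_def scaleR_diff_right)
    then have k2: "\<mu> *\<^sub>R (k - e) = k2 - e" by (rule scaleR_left_imp_eq[rotated]) (use *(2) in simp)
    then have keq: "k = (1 - 1 / \<mu>) *\<^sub>R e + (1 / \<mu>) *\<^sub>R k2"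
    proof -
      have "(1 / \<mu>) *\<^sub>R (\<mu> *\<^sub>R (k - e)) = (1 / \<mu>) *\<^sub>R (k2 - e)" by (simp only: k2)
      moreover have "(1 / \<mu>) *\<^sub>R (\<mu> *\<^sub>R (k - e)) = k - e"
        using mu unfolding scaleR_scaleR by simp
      ultimately have "k - e = (1 / \<mu>) *\<^sub>R (k2 - e)" by metis
      then show ?thesis by (simp add: algebra_simps)
    qed
    have "e \<noteq> k2" using k2 mu ke(2) by auto
    then have "k \<in> open_segment e k2"
      using keq mu by (auto simp: in_segment intro!: exI[of _ "1 / \<mu>"])
    then show False using ke(1) e k12(2) unfolding extreme_point_of_def by blast
  qed
qed

text \<open>For an interior point \<open>z\<close> near \<open>v\<close> and its nearest frontier
  point \<open>w\<close>, the ball about \<open>z\<close> through \<open>w\<close> stays in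
  \<open>K\<close>. A supporting hyperplane of \<open>K\<close> at \<open>w\<close> also supports
  this ball, which determines its normal.\<close>

lemma frontier_touching_ball:
  fixes K :: "'a::euclidean_space set"
  assumes "convex K" "compact K" "interior K \<noteq> {}" "v \<in> frontier K" "\<rho> > 0"
  obtains w r f where "dist v w < \<rho>" "w \<in> K" "r > 0" "norm f = 1" "cball (w + r *\<^sub>R f) r \<subseteq> K"
    "\<And>k. k \<in> K \<Longrightarrow> f \<bullet> w \<le> f \<bullet> k"
proof -
  have "v \<in> closure (interior K)"
    using assms convex_closure_interior[of K] by (simp add: frontier_def)
  then obtain z where z: "z \<in> interior K" "dist z v < \<rho> / 2"
    using \<open>\<rho> > 0\<close> closure_approachable half_gt_zero by metis
  obtain w where w: "w \<in> frontier K" and wmin: "\<And>y. y \<in> frontier K \<Longrightarrow> dist z w \<le> dist z y"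
    using distance_attains_inf[of "frontier K" z] assms frontier_closed by blast
  define r where "r = dist z w"
  have "z \<noteq> w" using z(1) w by (auto simp: frontier_def)
  then have r: "r > 0" by (simp add: r_def)
  have clK: "closed K" using \<open>compact K\<close> compact_imp_closed by blast
  have "ball z r \<inter> frontier K = {}" using wmin by (force simp: r_def)
  moreover have "ball z r \<inter> K \<noteq> {}" using z(1) r interior_subset by (metis IntI centre_in_ball empty_iff subsetD)
  ultimately have "ball z r \<subseteq> K"
    using connected_Int_frontier[of "ball z r" K] connected_ball[of z r] by blast
  then have cb: "cball z r \<subseteq> K" using closure_minimal[OF _ clK, of "ball z r"] r by simp
  have wK: "w \<in> K" using w clK by (simp add: frontier_def)
  obtain a where a: "a \<noteq> 0" "\<And>y. y \<in> K \<Longrightarrow> a \<bullet> w \<le> a \<bullet> y"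
  proof (rule supporting_hyperplane_rel_boundary[OF \<open>convex K\<close> wK])
    show "w \<notin> rel_interior K"
      using w assms(3) by (simp add: frontier_def rel_interior_nonempty_interior)
  qed blast
  define f where "f = (1 / r) *\<^sub>R (z - w)"
  have nf: "norm f = 1" using r by (simp add: f_def r_def dist_norm)
  have zw: "w + r *\<^sub>R f = z" using r by (simp add: f_def)
  \<comment> \<open>The point of the ball lowest in direction \<open>a\<close>; comparison with
    \<open>w\<close> forces equality in the Cauchy-Schwarz inequality, so \<open>a\<close> is a
    positive multiple of \<open>z - w\<close>.\<close>
  have "z - (r / norm a) *\<^sub>R a \<in> K"
    using cb r a(1) by (intro subsetD[OF cb]) (simp add: dist_norm)
  from a(2)[OF this] have "a \<bullet> w \<le> a \<bullet> z - r * norm a"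
    using a(1) by (simp add: inner_diff_right power2_norm_eq_inner[symmetric] power2_eq_square)
  then have "r * norm a \<le> r * (a \<bullet> f)"
    using r by (simp add: f_def inner_diff_right)
  then have "norm a \<le> a \<bullet> f" using r by simp
  then have "a \<bullet> f = norm a * norm f" using norm_cauchy_schwarz[of a f] nf by simp
  then have af: "norm a *\<^sub>R f = a" using norm_cauchy_schwarz_eq[of a f] nf by simp
  show thesis
  proof (rule that[of w r f])
    have "dist z w \<le> dist z v" using wmin assms(4) by blast
    then show "dist v w < \<rho>" using z(2) dist_triangle[of v w z] by (simp add: dist_commute)
    fix k assume "k \<in> K"
    then have "norm a * (f \<bullet> w) \<le> norm a * (f \<bullet> k)" using a(2) af by (metis inner_scaleR_left)
    then show "f \<bullet> w \<le> f \<bullet> k" using a(1) by simp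
  qed (use wK r nf cb zw in auto)
qed

text \<open>An element of \<open>A\<close> is separated by a hyperplane from the affine hull of the
  others, whence independence. Each touching point yields one element of \<open>A\<close>; to reach
  a given extreme point, the touching point is sought on the opposite side of
  \<open>K\<close>.\<close>

lemma simplex_if_homothetic_intersections:
  fixes K :: "'a::euclidean_space set"
  assumes "convex K" "compact K" "interior K \<noteq> {}" "b > 0"
    and H: "\<And>x. interior (K \<inter> (\<lambda>k. x + b *\<^sub>R k) ` K) \<noteq> {} \<Longrightarrow>
              \<exists>y u. u \<ge> 0 \<and> K \<inter> (\<lambda>k. x + b *\<^sub>R k) ` K = (\<lambda>k. y + u *\<^sub>R k) ` K"
  shows "\<exists>d. d simplex K"
proof -
  define A where "A = {e. e extreme_point_of K \<and>
    (\<exists>f \<beta>. f \<bullet> e > \<beta> \<and> (\<forall>k. k extreme_point_of K \<longrightarrow> k \<noteq> e \<longrightarrow> f \<bullet> k = \<beta>))}"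
  have indep: "\<not> affine_dependent A"
  proof
    assume "affine_dependent A"
    then obtain e where e: "e \<in> A" "e \<in> affine hull (A - {e})" by (auto simp: affine_dependent_def)
    then obtain f \<beta> where f: "f \<bullet> e > \<beta>" "\<forall>k. k extreme_point_of K \<longrightarrow> k \<noteq> e \<longrightarrow> f \<bullet> k = \<beta>"
      by (auto simp: A_def)
    have "affine hull (A - {e}) \<subseteq> {x. f \<bullet> x = \<beta>}"
      by (intro hull_minimal affine_hyperplane) (use f(2) in \<open>auto simp: A_def\<close>)
    then show False using e f by auto
  qed
  have KM: "K = convex hull {x. x extreme_point_of K}"
    by (rule Krein_Milman_Minkowski) fact+
  have Kne: "K \<noteq> {}" using assms(3) interior_subset by blast
  have touch: "\<exists>e\<in>A. \<forall>k. k extreme_point_of K \<longrightarrow> k \<noteq> e \<longrightarrow> f \<bullet> k = f \<bullet> w"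
    if "r > 0" "cball (w + r *\<^sub>R f) r \<subseteq> K" "norm f = 1" "w \<in> K" "\<And>k. k \<in> K \<Longrightarrow> f \<bullet> w \<le> f \<bullet> k" for w r f
  proof -
    obtain e0 where e0: "e0 \<in> K" "\<And>k. k \<in> K \<Longrightarrow> f \<bullet> k \<le> f \<bullet> e0"
      using continuous_attains_sup[OF \<open>compact K\<close> Kne, of "\<lambda>x. f \<bullet> x"] continuous_on_inner[OF continuous_on_const continuous_on_id, of K f]
      by (metis (mono_tags, lifting))
    note ap = homothety_apex[OF assms(1,2,4) that(1) H that(2-5) e0]
    have lt: "f \<bullet> w < f \<bullet> e0" by (rule ap(1))
    have others: "f \<bullet> k = f \<bullet> w" if "k extreme_point_of K" "k \<noteq> e0" for k by (rule ap(2)) (use that in auto)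
    \<comment> \<open>Otherwise all extreme points, and with them \<open>K\<close>, would lie in the
      bottom hyperplane.\<close>
    have "e0 extreme_point_of K"
    proof (rule ccontr)
      assume "\<not> e0 extreme_point_of K"
      then have "{x. x extreme_point_of K} \<subseteq> {x. f \<bullet> x = f \<bullet> w}" using others by auto
      then have "convex hull {x. x extreme_point_of K} \<subseteq> {x. f \<bullet> x = f \<bullet> w}"
        by (intro hull_minimal convex_hyperplane)
      then show False using KM e0(1) lt by auto
    qed
    then show ?thesis using lt others by (auto simp: A_def)
  qed
  have "{x. x extreme_point_of K} \<subseteq> A"
  proof (rule ccontr)
    assume "\<not> {x. x extreme_point_of K} \<subseteq> A"
    then obtain x where x: "x extreme_point_of K" "x \<notin> A" by blast
    obtain z \<rho> where z: "\<rho> > 0" "cball z \<rho> \<subseteq> K"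
      using assms(3) by (meson all_not_in_conv mem_interior_cball)
    have zi: "z \<in> interior K" using z by (meson mem_interior_cball)
    have "x \<notin> interior K" using extreme_point_not_in_interior[OF x(1)] .
    then have "z \<noteq> x" using zi by auto
    \<comment> \<open>The ray from \<open>x\<close> through \<open>z\<close> leaves \<open>K\<close>
      at this point, and \<open>w\<close> is taken within \<rho> of it. As \<open>x\<close> is not
      the apex, it lies in the base, at the height of \<open>w\<close>; but the ball about
      \<open>z\<close> makes the exit point higher by at least \<rho>.\<close>
    then obtain d where d: "0 < d" "z + d *\<^sub>R (z - x) \<in> frontier K"
      using ray_to_frontier[OF compact_imp_bounded[OF \<open>compact K\<close>] zi, of "z - x"] by auto
    obtain w r f where w: "dist (z + d *\<^sub>R (z - x)) w < \<rho>" "w \<in> K" "r > 0" "norm f = 1" "cball (w + r *\<^sub>R f) r \<subseteq> K"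
        "\<And>k. k \<in> K \<Longrightarrow> f \<bullet> w \<le> f \<bullet> k"
      using frontier_touching_ball[OF assms(1-3) d(2) z(1)] by metis
    obtain e where e: "e \<in> A" "\<forall>k. k extreme_point_of K \<longrightarrow> k \<noteq> e \<longrightarrow> f \<bullet> k = f \<bullet> w"
      using touch[OF w(3,5,4,2,6)] by blast
    have fx: "f \<bullet> x = f \<bullet> w" using e x by auto
    have "z - \<rho> *\<^sub>R f \<in> K" using z w(4) by (intro subsetD[OF z(2)]) (auto simp: dist_norm)
    from w(6)[OF this] have zr: "f \<bullet> (z - x) \<ge> \<rho>"
      using w(4) fx by (simp add: inner_diff_right norm_eq_1)
    have "\<rho> \<le> f \<bullet> (z - x) + d * (f \<bullet> (z - x))" using zr d z by (simp add: add_increasing2)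
    also have "\<dots> = f \<bullet> (z + d *\<^sub>R (z - x) - w)" using fx by (simp add: inner_add_right inner_diff_right algebra_simps)
    also have "\<dots> \<le> norm f * norm (z + d *\<^sub>R (z - x) - w)" by (rule norm_cauchy_schwarz)
    also have "\<dots> < \<rho>" using w(1,4) by (simp add: dist_norm)
    finally show False by simp
  qed
  then have "{x. x extreme_point_of K} = A" by (auto simp: A_def)
  then have "K = convex hull A" using KM by simp
  then show ?thesis using indep unfolding simplex_def by (intro exI[of _ "int (card A) - 1"] exI[of _ A]) auto
qed

section \<open>The equality case\<close>

lemma norm_shift_diff: "norm (shift x l - shift y l) \<le> norm (x - y)"
  for x y :: "real ^ 'n ^ 'p::finite"
  using Finite_Cartesian_Product.norm_nth_le[of "x - y"] by (cases l) (auto simp: shift_def)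

text \<open>Good parameters are dense, so they approach \<open>x0\<close>. The homotheties are
  bounded and subconverge; the limit copy lies in \<open>C(x0)\<close> by closedness, and it
  contains the points interior to all the bodies, which are dense in \<open>C(x0)\<close>.\<close>

lemma common_part_homothetic_limit:
  fixes K :: "(real ^ 'n) set" and t :: "real ^ ('p::finite option)"
  assumes K: "compact K" "convex K" "interior K \<noteq> {}" and t: "\<And>l. 0 \<le> t $ l"
    and ae: "AE x in lborel. emeasure lborel (common_part K t x) = 0 \<or> (\<exists>z u. 0 \<le> u \<and> common_part K t x = (\<lambda>k. z + u *\<^sub>R k) ` K)"
    and z0: "\<And>l. z0 + shift x0 l \<in> interior ((*\<^sub>R) (t $ l) ` K)"
  shows "\<exists>z u. 0 \<le> u \<and> common_part K t x0 = (\<lambda>k. z + u *\<^sub>R k) ` K"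
proof -
  let ?good = "\<lambda>x. emeasure lborel (common_part K t x) = 0 \<or> (\<exists>z u. 0 \<le> u \<and> common_part K t x = (\<lambda>k. z + u *\<^sub>R k) ` K)"
  have clT: "closed ((*\<^sub>R) (t $ l) ` K)" for l
    using K(1) by (intro compact_imp_closed compact_continuous_image continuous_intros)
  have "\<exists>x. dist x0 x < r \<and> ?good x" if "r > 0" for r
  proof (rule ccontr)
    assume no: "\<not> (\<exists>x. dist x0 x < r \<and> ?good x)"
    obtain N where N: "N \<in> null_sets lborel" "{x. \<not> ?good x} \<subseteq> N"
      using ae by (auto elim!: AE_E simp: null_sets_def)
    have "ball x0 r \<subseteq> N" using no N(2) by auto
    moreover have "negligible N" using N(1) by (simp add: negligible_iff_null_sets null_sets_completionI)
    ultimately have "negligible (ball x0 r)" using negligible_subset by blast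
    then show False using open_not_negligible[of "ball x0 r"] that by simp
  qed
  then have "\<forall>k. \<exists>x. dist x0 x < inverse (real (Suc k)) \<and> ?good x" by simp
  then obtain X where X: "\<And>k. dist x0 (X k) < inverse (real (Suc k))" "\<And>k. ?good (X k)" by metis
  have Xlim: "X \<longlonglongrightarrow> x0"
  proof (rule metric_tendsto_imp_tendsto[OF LIMSEQ_inverse_real_of_nat])
    show "\<forall>\<^sub>F k in sequentially. dist (X k) x0 \<le> dist (inverse (real (Suc k))) 0"
      using X(1) by (intro always_eventually allI) (simp add: dist_commute less_imp_le)
  qed
  have shlim: "(\<lambda>k. shift (X k) l) \<longlonglongrightarrow> shift x0 l" for l
    using Xlim by (cases l) (auto simp: shift_def intro: tendsto_vec_nth)
  have near: "\<forall>\<^sub>F k in sequentially. w \<in> interior (common_part K t (X k))"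
    if w: "\<And>l. w + shift x0 l \<in> interior ((*\<^sub>R) (t $ l) ` K)" for w
  proof -
    have "\<exists>r>0. ball (w + shift x0 l) r \<subseteq> (*\<^sub>R) (t $ l) ` K" for l
      using w[of l] by (simp add: mem_interior)
    then obtain r where r: "\<And>l. r l > 0" "\<And>l. ball (w + shift x0 l) (r l) \<subseteq> (*\<^sub>R) (t $ l) ` K" by metis
    \<comment> \<open>Half the margin, because the point and the shift both move.\<close>
    define \<rho> where "\<rho> = Min (range r) / 2"
    have \<rho>: "\<rho> > 0" "2 * \<rho> \<le> r l" for l using r(1) by (auto simp: \<rho>_def)
    have "\<forall>\<^sub>F k in sequentially. dist (X k) x0 < \<rho>" using Xlim \<rho>(1) by (rule tendstoD)
    then show ?thesis
    proof eventually_elim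
      case (elim k)
      have "ball w \<rho> \<subseteq> common_part K t (X k)"
      proof
        fix v assume v: "v \<in> ball w \<rho>"
        have "v + shift (X k) l \<in> (*\<^sub>R) (t $ l) ` K" for l
        proof -
          have "norm ((w + shift x0 l) - (v + shift (X k) l)) \<le> norm (w - v) + norm (shift x0 l - shift (X k) l)"
            using norm_triangle_ineq[of "w - v" "shift x0 l - shift (X k) l"] by (simp add: algebra_simps)
          also have "\<dots> < \<rho> + \<rho>"
            using v elim norm_shift_diff[of x0 l "X k"] by (intro add_strict_mono) (auto simp: dist_norm norm_minus_commute)
          also have "\<dots> \<le> r l" using \<rho>(2)[of l] by simp
          finally have "v + shift (X k) l \<in> ball (w + shift x0 l) (r l)" by (simp add: dist_norm)
          then show ?thesis using r(2) by blast
        qed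
        then show "v \<in> common_part K t (X k)" by (simp add: common_part_def)
      qed
      then show ?case using \<rho>(1) mem_interior by blast
    qed
  qed
  \<comment> \<open>An interior point means positive volume, which excludes the null
    alternative.\<close>
  have hom: "\<exists>z u. 0 \<le> u \<and> common_part K t (X k) = (\<lambda>k. z + u *\<^sub>R k) ` K"
    if "z0 \<in> interior (common_part K t (X k))" for k
  proof -
    have c: "compact (common_part K t (X k))" "convex (common_part K t (X k))"
      using compact_common_part[OF K(1)] convex_common_part[OF K(2)] by blast+
    have "measure lebesgue (common_part K t (X k)) > 0"
      using measure_pos_iff_interior[OF c] that by blast
    then have "emeasure lborel (common_part K t (X k)) \<noteq> 0" by (simp add: emeasure_lborel_compact[OF c(1)])
    then show ?thesis using X(2)[of k] by blast
  qed
  obtain k0 where "\<And>k. k \<ge> k0 \<Longrightarrow> z0 \<in> interior (common_part K t (X k))"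
    using near[OF z0] unfolding eventually_sequentially by blast
  then have "\<forall>k. \<exists>z u. 0 \<le> u \<and> common_part K t (X (k + k0)) = (\<lambda>k. z + u *\<^sub>R k) ` K" using hom by simp
  then obtain Z U where ZU: "\<And>k. 0 \<le> U k" "\<And>k. common_part K t (X (k + k0)) = (\<lambda>\<kappa>. Z k + U k *\<^sub>R \<kappa>) ` K" by metis
  obtain \<kappa>0 where \<kappa>0: "\<kappa>0 \<in> K" using K(3) interior_subset by blast
  obtain M where M: "\<And>\<kappa>. \<kappa> \<in> K \<Longrightarrow> norm \<kappa> \<le> M" using compact_imp_bounded[OF K(1)] unfolding bounded_iff by blast
  have M0: "M \<ge> 0" using M[OF \<kappa>0] norm_ge_zero order.trans by blast
  have v: "measure lebesgue K > 0" using measure_pos_iff_interior[OF K(1,2)] K(3) by simp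
  have sub: "common_part K t x \<subseteq> (*\<^sub>R) (t $ None) ` K" for x :: "real ^ 'n ^ 'p"
    unfolding common_part_def forall_option by (auto simp: shift_def)
  \<comment> \<open>All intersections lie in \<open>t_0 K\<close>: comparing volumes bounds the
    factors, and the image of one point then bounds the translations.\<close>
  have Ub: "U k \<le> t $ None" for k
  proof -
    have "emeasure lborel ((\<lambda>\<kappa>. Z k + U k *\<^sub>R \<kappa>) ` K) \<le> emeasure lborel ((\<lambda>\<kappa>. 0 + (t $ None) *\<^sub>R \<kappa>) ` K)"
      using sub[of "X (k + k0)"] clT[of None] unfolding ZU(2) by (intro emeasure_mono) (auto simp: borel_closed)
    then have "ennreal (U k ^ CARD('n) * measure lebesgue K) \<le> ennreal ((t $ None) ^ CARD('n) * measure lebesgue K)"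
      unfolding emeasure_homothet[OF K(1) ZU(1)] emeasure_homothet[OF K(1) t] emeasure_lborel_compact[OF K(1)]
      using ZU(1)[of k] t[of None] by (simp add: ennreal_mult)
    then have "U k ^ CARD('n) \<le> (t $ None) ^ CARD('n)" using v t[of None] by (simp add: ennreal_le_iff)
    then show ?thesis using ZU(1) t by (simp add: power_mono_iff)
  qed
  have Zb: "norm (Z k) \<le> 2 * (t $ None * M)" for k
  proof -
    have "Z k + U k *\<^sub>R \<kappa>0 \<in> (*\<^sub>R) (t $ None) ` K" using sub[of "X (k + k0)"] \<kappa>0 unfolding ZU(2) by blast
    then obtain \<kappa> where "\<kappa> \<in> K" "Z k = (t $ None) *\<^sub>R \<kappa> - U k *\<^sub>R \<kappa>0" by (metis add_diff_cancel_right' imageE)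
    then have "norm (Z k) \<le> t $ None * norm \<kappa> + U k * norm \<kappa>0"
      using norm_triangle_ineq4[of "(t $ None) *\<^sub>R \<kappa>" "U k *\<^sub>R \<kappa>0"] t[of None] ZU(1)[of k] by simp
    also have "\<dots> \<le> t $ None * M + t $ None * M"
      using M \<open>\<kappa> \<in> K\<close> \<kappa>0 Ub[of k] ZU(1)[of k] t[of None] M0 by (intro add_mono mult_mono) auto
    finally show ?thesis by (simp add: mult.commute)
  qed
  have "compact (cball (0 :: real ^ 'n) (2 * (t $ None * M)) \<times> {0..t $ None})" by (intro compact_Times) auto
  moreover have "\<forall>k. (Z k, U k) \<in> cball 0 (2 * (t $ None * M)) \<times> {0..t $ None}"
    using Zb Ub ZU(1) by simp
  ultimately obtain zu r where r: "strict_mono r" "((\<lambda>k. (Z k, U k)) \<circ> r) \<longlonglongrightarrow> zu"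
    using seq_compactE[OF compact_imp_seq_compact, of _ "\<lambda>k. (Z k, U k)"] by blast
  obtain z u where zu: "zu = (z, u)" by (cases zu)
  have Zl: "(\<lambda>k. Z (r k)) \<longlonglongrightarrow> z" and Ul: "(\<lambda>k. U (r k)) \<longlonglongrightarrow> u"
    using tendsto_fst[OF r(2)] tendsto_snd[OF r(2)] by (simp_all add: zu comp_def)
  have u0: "0 \<le> u" using Ul ZU(1) by (intro LIMSEQ_le_const[OF Ul]) auto
  have idx: "filterlim (\<lambda>k. r k + k0) sequentially sequentially"
    by (rule filterlim_compose[OF filterlim_add_const_nat_at_top filterlim_subseq[OF r(1)]])
  let ?H = "(\<lambda>\<kappa>. z + u *\<^sub>R \<kappa>) ` K"
  have HC: "?H \<subseteq> common_part K t x0"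
  proof (rule image_subsetI)
    fix \<kappa> assume \<kappa>: "\<kappa> \<in> K"
    have "z + u *\<^sub>R \<kappa> + shift x0 l \<in> (*\<^sub>R) (t $ l) ` K" for l
    proof (rule closed_sequentially[OF clT])
      show "(\<lambda>k. Z (r k) + U (r k) *\<^sub>R \<kappa> + shift (X (r k + k0)) l) \<longlonglongrightarrow> z + u *\<^sub>R \<kappa> + shift x0 l"
        by (intro tendsto_add tendsto_scaleR Zl Ul tendsto_const filterlim_compose[OF shlim idx])
      show "Z (r k) + U (r k) *\<^sub>R \<kappa> + shift (X (r k + k0)) l \<in> (*\<^sub>R) (t $ l) ` K" for k
      proof -
        have "Z (r k) + U (r k) *\<^sub>R \<kappa> \<in> common_part K t (X (r k + k0))" unfolding ZU(2) using \<kappa> by blast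
        then show ?thesis by (simp add: common_part_def)
      qed
    qed
    then show "z + u *\<^sub>R \<kappa> \<in> common_part K t x0" by (simp add: common_part_def)
  qed
  \<comment> \<open>Such a point persists in the nearby intersections; its preimages under their
    homotheties subconverge in \<open>K\<close>.\<close>
  have inH: "w \<in> ?H" if w: "\<And>l. w + shift x0 l \<in> interior ((*\<^sub>R) (t $ l) ` K)" for w
  proof -
    have "\<forall>\<^sub>F k in sequentially. w \<in> interior (common_part K t (X (r k + k0)))"
      using eventually_compose_filterlim[OF near[OF w] idx] .
    then obtain k1 where k1: "\<And>k. k \<ge> k1 \<Longrightarrow> w \<in> common_part K t (X (r k + k0))"
      unfolding eventually_sequentially using interior_subset by blast
    have "\<forall>k. \<exists>\<kappa>\<in>K. w = Z (r (k + k1)) + U (r (k + k1)) *\<^sub>R \<kappa>"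
      using k1[of "_ + k1"] unfolding ZU(2) by fastforce
    then obtain \<kappa> where \<kappa>: "\<And>k. \<kappa> k \<in> K" "\<And>k. w = Z (r (k + k1)) + U (r (k + k1)) *\<^sub>R \<kappa> k" by metis
    obtain \<kappa>' r' where r': "\<kappa>' \<in> K" "strict_mono r'" "(\<kappa> \<circ> r') \<longlonglongrightarrow> \<kappa>'"
      using seq_compactE[OF compact_imp_seq_compact[OF K(1)], of \<kappa>] \<kappa>(1) by blast
    have idx': "filterlim (\<lambda>k. r' k + k1) sequentially sequentially"
      by (rule filterlim_compose[OF filterlim_add_const_nat_at_top filterlim_subseq[OF r'(2)]])
    have "(\<lambda>k. Z (r (r' k + k1)) + U (r (r' k + k1)) *\<^sub>R \<kappa> (r' k)) \<longlonglongrightarrow> z + u *\<^sub>R \<kappa>'"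
      using r'(3) by (intro tendsto_add tendsto_scaleR filterlim_compose[OF Zl idx'] filterlim_compose[OF Ul idx']) (simp add: comp_def)
    then have "(\<lambda>k. w) \<longlonglongrightarrow> z + u *\<^sub>R \<kappa>'" unfolding \<kappa>(2)[symmetric] .
    then have "w = z + u *\<^sub>R \<kappa>'" by (rule LIMSEQ_unique[OF tendsto_const])
    then show ?thesis using r'(1) by blast
  qed
  have "common_part K t x0 \<subseteq> ?H"
  proof
    fix w assume w: "w \<in> common_part K t x0"
    \<comment> \<open>Shrinking towards \<open>z0\<close> moves a point of the intersection into the
      interiors of all bodies.\<close>
    let ?w = "\<lambda>k. w - inverse (real (Suc k)) *\<^sub>R (w - z0)"
    have "closed ?H" using K(1) by (intro compact_imp_closed compact_continuous_image continuous_intros)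
    moreover have "?w k \<in> ?H" for k
    proof (rule inH)
      fix l
      have "(w + shift x0 l) - inverse (real (Suc k)) *\<^sub>R ((w + shift x0 l) - (z0 + shift x0 l)) \<in> interior ((*\<^sub>R) (t $ l) ` K)"
        using w by (intro mem_interior_convex_shrink z0 convex_scaling K(2)) (auto simp: common_part_def inverse_eq_divide)
      then show "?w k + shift x0 l \<in> interior ((*\<^sub>R) (t $ l) ` K)" by (simp add: algebra_simps)
    qed
    moreover have "?w \<longlonglongrightarrow> w - 0 *\<^sub>R (w - z0)"
      by (intro tendsto_diff tendsto_scaleR tendsto_const LIMSEQ_inverse_real_of_nat)
    ultimately show "w \<in> ?H" using closed_sequentially[of ?H ?w w] by simp
  qed
  then show ?thesis using HC u0 by blast
qed

text \<open>Since \<open>t $ l0\<close> is the smallest coordinate, every body other than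
  \<open>l0\<close> and \<open>l1\<close> can be moved to contain \<open>t_l0 K\<close>; then only
  two bodies restrict the intersection.\<close>

lemma two_body_homothetic:
  fixes K :: "(real ^ 'n) set" and t :: "real ^ ('p::finite option)"
  assumes K: "compact K" "convex K" "interior K \<noteq> {}" and m: "0 < t $ l0" "\<And>l. t $ l0 \<le> t $ l" and "l1 \<noteq> l0"
    and ae: "AE x in lborel. emeasure lborel (common_part K t x) = 0 \<or> (\<exists>z u. 0 \<le> u \<and> common_part K t x = (\<lambda>k. z + u *\<^sub>R k) ` K)"
    and int: "interior ((*\<^sub>R) (t $ l0) ` K \<inter> (\<lambda>k. y + (t $ l1) *\<^sub>R k) ` K) \<noteq> {}"
  shows "\<exists>z u. 0 \<le> u \<and> (*\<^sub>R) (t $ l0) ` K \<inter> (\<lambda>k. y + (t $ l1) *\<^sub>R k) ` K = (\<lambda>k. z + u *\<^sub>R k) ` K"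
proof -
  obtain k0 where k0: "k0 \<in> K" using K(3) interior_subset by blast
  \<comment> \<open>By convexity \<open>t_l K - (t_l - t_l0) k0\<close> contains
    \<open>t_l0 K\<close>; for \<open>l0\<close> itself the displacement is zero.\<close>
  define d where "d l = (if l = l1 then - y else (t $ l - t $ l0) *\<^sub>R k0)" for l
  \<comment> \<open>The index \<open>None\<close> has no shift, so displacements are taken relative
    to \<open>d None\<close>, which translates the intersection by \<open>d None\<close>.\<close>
  define x0 where "x0 = (\<chi> a. d (Some a) - d None)"
  have sh: "shift x0 l = d l - d None" for l by (cases l) (auto simp: shift_def x0_def)
  let ?I = "(*\<^sub>R) (t $ l0) ` K \<inter> (\<lambda>k. y + (t $ l1) *\<^sub>R k) ` K"
  have l1: "w + d l1 \<in> (*\<^sub>R) (t $ l1) ` K \<longleftrightarrow> w \<in> (\<lambda>k. y + (t $ l1) *\<^sub>R k) ` K" for w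
    by (auto simp: d_def image_iff algebra_simps)
  have pos: "t $ l > 0" for l using m(1) m(2)[of l] by linarith
  have other: "w + d l \<in> (*\<^sub>R) (t $ l) ` K" if w: "w \<in> (*\<^sub>R) (t $ l0) ` K" "l \<noteq> l1" for w l
  proof -
    obtain k where k: "k \<in> K" "w = (t $ l0) *\<^sub>R k" using w(1) by blast
    let ?k = "(t $ l0 / t $ l) *\<^sub>R k + ((t $ l - t $ l0) / t $ l) *\<^sub>R k0"
    have "?k \<in> K" using m(2)[of l] m(1) pos[of l]
      by (intro convexD[OF K(2) k(1) k0]) (auto simp: add_divide_distrib[symmetric])
    moreover have "w + d l = (t $ l) *\<^sub>R ?k" using pos[of l] w(2) by (simp add: d_def k(2) scaleR_add_right)
    ultimately show ?thesis by blast
  qed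
  have C: "common_part K t x0 = (+) (d None) ` ?I"
  proof -
    have dl0: "d l0 = 0" using \<open>l1 \<noteq> l0\<close> by (simp add: d_def)
    have I: "(\<forall>l. w + d l \<in> (*\<^sub>R) (t $ l) ` K) \<longleftrightarrow> w \<in> ?I" for w
    proof
      assume a: "\<forall>l. w + d l \<in> (*\<^sub>R) (t $ l) ` K"
      then have "w + d l0 \<in> (*\<^sub>R) (t $ l0) ` K" "w + d l1 \<in> (*\<^sub>R) (t $ l1) ` K" by blast+
      then show "w \<in> ?I" using l1 dl0 by simp
    next
      assume w: "w \<in> ?I"
      show "\<forall>l. w + d l \<in> (*\<^sub>R) (t $ l) ` K"
      proof
        fix l
        show "w + d l \<in> (*\<^sub>R) (t $ l) ` K"
        proof (cases "l = l1")
          case True then show ?thesis using IntD2[OF w] l1[of w] by simp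
        next
          case False then show ?thesis by (rule other[OF IntD1[OF w]])
        qed
      qed
    qed
    have "z \<in> common_part K t x0 \<longleftrightarrow> z - d None \<in> ?I" for z
      unfolding I[symmetric] common_part_def mem_Collect_eq sh by (simp add: algebra_simps)
    moreover have "z - d None \<in> ?I \<longleftrightarrow> z \<in> (+) (d None) ` ?I" for z
    proof
      assume "z - d None \<in> ?I"
      then show "z \<in> (+) (d None) ` ?I" by (rule image_eqI[rotated]) simp
    next
      assume "z \<in> (+) (d None) ` ?I"
      then obtain w where w: "w \<in> ?I" "z = d None + w" by blast
      have "z - d None = w" using w(2) by simp
      then show "z - d None \<in> ?I" using w(1) by (simp only:)
    qed
    ultimately show ?thesis by blast
  qed
  obtain w0 where w0: "w0 \<in> interior ?I" using int by blast
  have "(w0 + d None) + shift x0 l \<in> interior ((*\<^sub>R) (t $ l) ` K)" for l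
  proof -
    have "(+) (d l) ` interior ?I \<subseteq> (*\<^sub>R) (t $ l) ` K"
    proof (rule image_subsetI)
      fix w assume "w \<in> interior ?I"
      then have w: "w \<in> ?I" using interior_subset by blast
      have "w + d l \<in> (*\<^sub>R) (t $ l) ` K"
      proof (cases "l = l1")
        case True then show ?thesis using IntD2[OF w] l1[of w] by simp
      next
        case False then show ?thesis by (rule other[OF IntD1[OF w]])
      qed
      then show "d l + w \<in> (*\<^sub>R) (t $ l) ` K" by (simp add: add.commute)
    qed
    then have "(+) (d l) ` interior ?I \<subseteq> interior ((*\<^sub>R) (t $ l) ` K)"
      by (intro interior_maximal open_translation) auto
    then have "d l + w0 \<in> interior ((*\<^sub>R) (t $ l) ` K)" using w0 by blast
    then show ?thesis by (simp add: sh algebra_simps)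
  qed
  then obtain z u where zu: "0 \<le> u" "common_part K t x0 = (\<lambda>k. z + u *\<^sub>R k) ` K"
    using common_part_homothetic_limit[OF K less_imp_le[OF pos] ae] by blast
  have "?I = (+) (- d None) ` common_part K t x0" unfolding C image_image by simp
  also have "\<dots> = (\<lambda>k. (z - d None) + u *\<^sub>R k) ` K" unfolding zu(2) image_image by (simp add: algebra_simps)
  finally show ?thesis using zu(1) by blast
qed

theorem theorem7p6:
  fixes K :: "(real ^ 'n) set" and n p :: nat
  assumes "n = CARD('n)" and "p = CARD('p::finite)" and "n \<ge> 2" and "convex_body K"
  shows "(\<forall>t\<in>Theta p.
            (\<Sum>j\<in>J_set n p. q n p j t * W TYPE('p) K j)
              \<le> (\<Prod>l=0..p. t l ^ n) * measure lebesgue K ^ p)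
       \<and> (aff_dim K = int n \<and>
           (\<exists>t\<in>relint_Theta p.
              (\<Sum>j\<in>J_set n p. q n p j t * W TYPE('p) K j)
                = (\<Prod>l=0..p. t l ^ n) * measure lebesgue K ^ p)
          \<longrightarrow> (\<exists>d. d simplex K))"
proof (intro conjI ballI impI)
  fix t assume "t \<in> Theta p"
  then show "(\<Sum>j\<in>J_set n p. q n p j t * W TYPE('p) K j) \<le> (\<Prod>l=0..p. t l ^ n) * measure lebesgue K ^ p"
    using sum_q_W_le[OF \<open>convex_body K\<close>] unfolding assms(1,2) by blast
next
  assume "aff_dim K = int n \<and> (\<exists>t\<in>relint_Theta p.
    (\<Sum>j\<in>J_set n p. q n p j t * W TYPE('p) K j) = (\<Prod>l=0..p. t l ^ n) * measure lebesgue K ^ p)"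
  then obtain t where dim: "aff_dim K = int CARD('n)" and t: "t \<in> relint_Theta CARD('p)"
    and eq: "(\<Sum>j\<in>J_set CARD('n) CARD('p). q CARD('n) CARD('p) j t * W TYPE('p) K j)
      = (\<Prod>l=0..CARD('p). t l ^ CARD('n)) * measure lebesgue K ^ CARD('p)"
    unfolding assms(1,2) by blast
  have K: "compact K" "convex K" using \<open>convex_body K\<close> by (auto simp: convex_body_def)
  have int: "interior K \<noteq> {}"
    using interior_rel_interior_gen[of K] dim K(2) \<open>convex_body K\<close> by (simp add: rel_interior_eq_empty convex_body_def)
  have tT: "t \<in> Theta CARD('p)" and tpos: "\<And>l. l \<le> CARD('p) \<Longrightarrow> t l > 0" using t by (auto simp: relint_Theta_def)
  define T where "T = (\<chi> l :: 'p option. t (unlab l))"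
  have ae: "AE x in lborel. emeasure lborel (common_part K T x) = 0 \<or> (\<exists>z u. 0 \<le> u \<and> common_part K T x = (\<lambda>k. z + u *\<^sub>R k) ` K)"
    unfolding T_def by (rule AE_common_part_homothetic[OF \<open>convex_body K\<close> int tT eq])
  obtain l0 where l0: "\<And>l. T $ l0 \<le> T $ l"
    using ex_min_if_finite[of "range (\<lambda>l. T $ l)"] by (auto simp: not_less)
  \<comment> \<open>\<open>'p option\<close> has at least two elements, so a second body
    exists.\<close>
  obtain l1 :: "'p option" where l1: "l1 \<noteq> l0" by (metis option.distinct(1))
  have Tpos: "T $ l > 0" for l using tpos[OF unlab_le] by (simp add: T_def)
  let ?a = "T $ l0" and ?b = "T $ l1"
  show "\<exists>d. d simplex K"
  \<comment> \<open>Division by the smallest coordinate turns the smallest body into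
    \<open>K\<close> itself.\<close>
  proof (rule simplex_if_homothetic_intersections[OF K(2,1) int, of "?b / ?a"])
    show "?b / ?a > 0" using Tpos by simp
    fix x assume xi: "interior (K \<inter> (\<lambda>k. x + (?b / ?a) *\<^sub>R k) ` K) \<noteq> {}"
    have scale: "(*\<^sub>R) ?a ` (K \<inter> (\<lambda>k. x + (?b / ?a) *\<^sub>R k) ` K) = (*\<^sub>R) ?a ` K \<inter> (\<lambda>k. ?a *\<^sub>R x + ?b *\<^sub>R k) ` K"
    proof -
      have "inj ((*\<^sub>R) ?a :: real ^ 'n \<Rightarrow> _)" using Tpos[of l0] by (intro injI) simp
      moreover have "(*\<^sub>R) ?a ` (\<lambda>k. x + (?b / ?a) *\<^sub>R k) ` K = (\<lambda>k. ?a *\<^sub>R x + ?b *\<^sub>R k) ` K"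
        unfolding image_image using Tpos[of l0] by (simp add: scaleR_add_right)
      ultimately show ?thesis by (simp add: image_Int)
    qed
    have "interior ((*\<^sub>R) ?a ` (K \<inter> (\<lambda>k. x + (?b / ?a) *\<^sub>R k) ` K)) \<noteq> {}"
    proof -
      have "(*\<^sub>R) ?a ` interior (K \<inter> (\<lambda>k. x + (?b / ?a) *\<^sub>R k) ` K)
          \<subseteq> interior ((*\<^sub>R) ?a ` (K \<inter> (\<lambda>k. x + (?b / ?a) *\<^sub>R k) ` K))"
        using Tpos[of l0] by (intro interior_maximal image_mono interior_subset open_scaling) auto
      then show ?thesis using xi by blast
    qed
    then obtain z u where zu: "0 \<le> u" "(*\<^sub>R) ?a ` K \<inter> (\<lambda>k. ?a *\<^sub>R x + ?b *\<^sub>R k) ` K = (\<lambda>k. z + u *\<^sub>R k) ` K"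
      using two_body_homothetic[OF K int Tpos l0 l1 ae] unfolding scale by blast
    have "K \<inter> (\<lambda>k. x + (?b / ?a) *\<^sub>R k) ` K = (*\<^sub>R) (1 / ?a) ` (*\<^sub>R) ?a ` (K \<inter> (\<lambda>k. x + (?b / ?a) *\<^sub>R k) ` K)"
      unfolding image_image using Tpos[of l0] by simp
    also have "\<dots> = (\<lambda>k. (1 / ?a) *\<^sub>R z + (u / ?a) *\<^sub>R k) ` K"
      unfolding scale zu(2) image_image by (simp add: scaleR_add_right)
    finally show "\<exists>y v. 0 \<le> v \<and> K \<inter> (\<lambda>k. x + (?b / ?a) *\<^sub>R k) ` K = (\<lambda>k. y + v *\<^sub>R k) ` K"
      using zu(1) Tpos[of l0] by (intro exI[of _ "(1 / ?a) *\<^sub>R z"] exI[of _ "u / ?a"]) simp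
  qed
qed

end
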